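(* Let $\Omega\subset\mathbb R^n$ be a bounded smooth uniformly convex domain, let $2\le k\le n$, and let $f_1,f_2\in C^\infty(\overline\Omega)$ satisfy $f_j\ge c_0>0$ on $\overline\Omega$ for $j=1,2$. For each $E\in\mathrm{Gr}(k-1,n)$ put $\phi_E(x)=\frac12|P_Ex|^2$, and for each $t>0$ and $j=1,2$ let $u_{j,t,E}\in C^\infty(\overline\Omega)$ be the unique smooth $k$-admissible solution of $$\sigma_k(D^2u_{j,t,E})=f_j\ \text{ in }\Omega,\qquad u_{j,t,E}=t\phi_E\ \text{ on }\partial\Omega .$$ Assume that for every $E\in\mathrm{Gr}(k-1,n)$ there exists $t_E>0$ such that $$\Lambda_{f_1}\big(t\phi_E|_{\partial\Omega}\big)=\Lambda_{f_2}\big(t\phi_E|_{\partial\Omega}\big)\quad\text{on }\partial\Omega\quad\text{for all }t\ge t_E,$$ i.e. $\partial_\nu u_{1,t,E}=\partial_\nu u_{2,t,E}$ on $\partial\Omega$ for all $t\ge t_E$. Then $f_1=f_2$ in $\Omega$.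
   Context: For a symmetric $n\times n$ matrix $M$ with eigenvalues $\lambda_1,\dots,\lambda_n$, $\sigma_j(M)=\sum_{i_1<\dots<i_j}\lambda_{i_1}\cdots\lambda_{i_j}$ is the $j$-th elementary symmetric function of the eigenvalues. $\Gamma_k=\{\lambda\in\mathbb R^n:\sigma_j(\lambda)>0,\ 1\le j\le k\}$, and $M\in\Gamma_k$ means that the eigenvalue vector of $M$ lies in $\Gamma_k$. A $C^2$ function $u$ is $k$-admissible if $D^2u(x)\in\Gamma_k$ for all $x\in\Omega$. Uniformly convex means that all principal curvatures of $\partial\Omega$ are bounded below by a positive constant. $\mathrm{Gr}(m,n)$ is the Grassmannian of $m$-dimensional linear subspaces of $\mathbb R^n$, and $P_E$ is the Euclidean orthogonal projection onto $E$. $\nu$ is the outward unit normal to $\partial\Omega$. By Caffarelli–Nirenberg–Spruck, for $f\in C^\infty(\overline\Omega)$ with $f\ge c_0>0$ and every $g\in C^\infty(\partial\Omega)$ there is a unique smooth $k$-admissible solution $u_g\in C^\infty(\overline\Omega)$ of $\sigma_k(D^2u_g)=f$ in $\Omega$, $u_g=g$ on $\partial\Omega$. The nonlinear Dirichlet-to-Neumann map is $\Lambda_f:C^\infty(\partial\Omega)\to C^\infty(\partial\Omega)$, $\Lambda_f(g)=\partial_\nu u_g|_{\partial\Omega}$. *)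

theory Defs
  imports "HOL-Analysis.Analysis"
begin

section \<open>Smooth functions\<close>

text \<open>Meant for open \<open>U\<close>: in finite dimensions this says that the \<open>m\<close>-th Frechet derivative
  exists and is continuous on \<open>U\<close>.\<close>

primrec Ck_on ::
  "nat \<Rightarrow> ('a::real_normed_vector) set \<Rightarrow> ('a \<Rightarrow> 'b::real_normed_vector) \<Rightarrow> bool" where
  "Ck_on 0 U f \<longleftrightarrow> continuous_on U f"
| "Ck_on (Suc m) U f \<longleftrightarrow>
     (\<exists>f'. (\<forall>x\<in>U. (f has_derivative f' x) (at x)) \<and> (\<forall>v. Ck_on m U (\<lambda>x. f' x v)))"

definition smooth_on ::
  "('a::real_normed_vector) set \<Rightarrow> ('a \<Rightarrow> 'b::real_normed_vector) \<Rightarrow> bool" where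
  "smooth_on U f \<longleftrightarrow> (\<forall>m. Ck_on m U f)"

text \<open>The space \<open>C\<^sup>\<infinity>\<close> of the closure of \<open>\<Omega>\<close>: restrictions of functions that are smooth in a
  neighbourhood of the closure. The values of \<open>f\<close> off the closure are irrelevant.\<close>

definition smooth_on_closure :: "(real^'n) set \<Rightarrow> (real^'n \<Rightarrow> real) \<Rightarrow> bool" where
  "smooth_on_closure \<Omega> f \<longleftrightarrow>
     (\<exists>U F. open U \<and> closure \<Omega> \<subseteq> U \<and> smooth_on U F \<and> (\<forall>x\<in>closure \<Omega>. F x = f x))"

definition partial_deriv :: "'n \<Rightarrow> (real^'n \<Rightarrow> real) \<Rightarrow> real^'n \<Rightarrow> real" where
  "partial_deriv i f x = frechet_derivative f (at x) (axis i 1)"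

definition grad :: "(real^'n \<Rightarrow> real) \<Rightarrow> real^'n \<Rightarrow> real^'n" where
  "grad f x = (\<chi> i. partial_deriv i f x)"

definition hessian :: "(real^'n \<Rightarrow> real) \<Rightarrow> real^'n \<Rightarrow> real^'n^'n" where
  "hessian f x = (\<chi> i j. partial_deriv i (partial_deriv j f) x)"


section \<open>Elementary symmetric functions of eigenvalues\<close>

definition esym :: "nat \<Rightarrow> real^'n \<Rightarrow> real" where
  "esym j l = (\<Sum>I | card (I :: 'n set) = j. \<Prod>i\<in>I. l $ i)"

text \<open>The eigenvalues of a symmetric matrix, repeated according to (algebraic) multiplicity.
  The vector is unique up to the order of its entries, on which \<open>esym\<close> does not depend.\<close>

definition eigenvalue_vec :: "real^'n^'n \<Rightarrow> real^'n" where
  "eigenvalue_vec M = (SOME l. \<forall>x. det (mat x - M) = (\<Prod>i\<in>UNIV. x - l $ i))"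

definition sigma_fn :: "nat \<Rightarrow> real^'n^'n \<Rightarrow> real" where
  "sigma_fn j M = esym j (eigenvalue_vec M)"

definition Gamma_cone :: "nat \<Rightarrow> (real^'n) set" where
  "Gamma_cone k = {l. \<forall>j\<in>{1..k}. 0 < esym j l}"


section \<open>Smooth uniformly convex domains\<close>

definition local_defining_function ::
  "(real^'n) set \<Rightarrow> real^'n \<Rightarrow> (real^'n) set \<Rightarrow> (real^'n \<Rightarrow> real) \<Rightarrow> bool" where
  "local_defining_function \<Omega> p U \<rho> \<longleftrightarrow>
     open U \<and> p \<in> U \<and> smooth_on U \<rho> \<and> (\<forall>x\<in>U. grad \<rho> x \<noteq> 0) \<and>
     \<Omega> \<inter> U = {x\<in>U. \<rho> x < 0} \<and> frontier \<Omega> \<inter> U = {x\<in>U. \<rho> x = 0}"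

definition smooth_boundary :: "(real^'n) set \<Rightarrow> bool" where
  "smooth_boundary \<Omega> \<longleftrightarrow> (\<forall>p\<in>frontier \<Omega>. \<exists>U \<rho>. local_defining_function \<Omega> p U \<rho>)"

definition outward_normal :: "(real^'n) set \<Rightarrow> real^'n \<Rightarrow> real^'n" where
  "outward_normal \<Omega> p = (THE v. \<exists>U \<rho>. local_defining_function \<Omega> p U \<rho> \<and> v = sgn (grad \<rho> p))"

text \<open>Principal curvatures are the eigenvalues of the Weingarten map, the differential along the
  boundary of the outward unit normal, acting on tangent vectors. With this sign a sphere of
  radius \<open>R\<close> bounding a ball has principal curvatures \<open>1/R\<close>. A derivative \<open>A\<close> within the boundary
  is determined only on tangent vectors, which is where it is used.\<close>

definition principal_curvature :: "(real^'n) set \<Rightarrow> real^'n \<Rightarrow> real \<Rightarrow> bool" where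
  "principal_curvature \<Omega> p \<kappa> \<longleftrightarrow>
     (\<exists>A \<xi>. (outward_normal \<Omega> has_derivative A) (at p within frontier \<Omega>) \<and>
        \<xi> \<noteq> 0 \<and> \<xi> \<bullet> outward_normal \<Omega> p = 0 \<and> A \<xi> = \<kappa> *\<^sub>R \<xi>)"

text \<open>For bounded smooth domains in dimension at least two, convexity follows from the curvature
  bound; it is listed because it is part of the term.\<close>

definition uniformly_convex :: "(real^'n) set \<Rightarrow> bool" where
  "uniformly_convex \<Omega> \<longleftrightarrow> convex \<Omega> \<and>
     (\<exists>\<kappa>0>0. \<forall>p\<in>frontier \<Omega>. \<forall>\<kappa>. principal_curvature \<Omega> p \<kappa> \<longrightarrow> \<kappa>0 \<le> \<kappa>)"

definition bounded_smooth_uniformly_convex_domain :: "(real^'n) set \<Rightarrow> bool" where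
  "bounded_smooth_uniformly_convex_domain \<Omega> \<longleftrightarrow>
     open \<Omega> \<and> connected \<Omega> \<and> \<Omega> \<noteq> {} \<and> bounded \<Omega> \<and> smooth_boundary \<Omega> \<and> uniformly_convex \<Omega>"


section \<open>The Hessian Dirichlet problem and its Dirichlet-to-Neumann map\<close>

definition k_admissible :: "nat \<Rightarrow> (real^'n) set \<Rightarrow> (real^'n \<Rightarrow> real) \<Rightarrow> bool" where
  "k_admissible k \<Omega> u \<longleftrightarrow> (\<forall>x\<in>\<Omega>. eigenvalue_vec (hessian u x) \<in> Gamma_cone k)"

definition smooth_admissible_solution ::
  "(real^'n) set \<Rightarrow> nat \<Rightarrow> (real^'n \<Rightarrow> real) \<Rightarrow> (real^'n \<Rightarrow> real) \<Rightarrow> (real^'n \<Rightarrow> real) \<Rightarrow> bool" where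
  "smooth_admissible_solution \<Omega> k f g u \<longleftrightarrow>
     smooth_on_closure \<Omega> u \<and> k_admissible k \<Omega> u \<and>
     (\<forall>x\<in>\<Omega>. sigma_fn k (hessian u x) = f x) \<and> (\<forall>x\<in>frontier \<Omega>. u x = g x)"

text \<open>One-sided, so that only the values of \<open>u\<close> on the closure of \<open>\<Omega>\<close> enter.\<close>

definition normal_deriv :: "(real^'n) set \<Rightarrow> (real^'n \<Rightarrow> real) \<Rightarrow> real^'n \<Rightarrow> real" where
  "normal_deriv \<Omega> u x = Lim (at_right 0) (\<lambda>s. (u x - u (x - s *\<^sub>R outward_normal \<Omega> x)) / s)"

text \<open>The map \<open>\<Lambda>\<^sub>f\<close>; boundary data and results are functions on the whole space of which only the
  values on \<open>frontier \<Omega>\<close> matter. The solution is unique only on the closure of \<open>\<Omega>\<close>, whence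
  \<open>SOME\<close>; its values elsewhere do not affect \<open>normal_deriv\<close> on \<open>frontier \<Omega>\<close>.\<close>

definition DN_map ::
  "(real^'n) set \<Rightarrow> nat \<Rightarrow> (real^'n \<Rightarrow> real) \<Rightarrow> (real^'n \<Rightarrow> real) \<Rightarrow> real^'n \<Rightarrow> real" where
  "DN_map \<Omega> k f g = normal_deriv \<Omega> (SOME u. smooth_admissible_solution \<Omega> k f g u)"


section \<open>Quadratic boundary data\<close>

definition Gr :: "nat \<Rightarrow> (real^'n) set set" where
  "Gr m = {E. subspace E \<and> dim E = m}"

definition orth_proj :: "(real^'n) set \<Rightarrow> real^'n \<Rightarrow> real^'n" where
  "orth_proj E x = (THE y. y \<in> E \<and> (\<forall>z\<in>E. orthogonal (x - y) z))"

definition phi :: "(real^'n) set \<Rightarrow> real^'n \<Rightarrow> real" where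
  "phi E x = (norm (orth_proj E x))\<^sup>2 / 2"

end

theory Submission
  imports Defs "HOL-Computational_Algebra.Fundamental_Theorem_Algebra"
begin

text \<open>Let \<open>b = t \<phi>\<^sub>E\<close>, let \<open>P\<close> be the matrix of the projection onto \<open>E\<close>, and write \<open>T(M)\<close> for the
  gradient of \<open>\<sigma>\<^sub>k\<close> at \<open>M\<close>; on Hessians it is divergence free, and on \<open>\<Gamma>\<^sub>k\<close> it is positive semidefinite.
  Comparison with quadratic functions gives \<open>0 \<le> b - u\<^sub>j \<le> C\<close> with \<open>C\<close> independent of \<open>t\<close>.
  Along \<open>M\<^sub>s = t P + s (D\<^sup>2u\<^sub>j - t P)\<close> the mean value theorem in \<open>s\<close> and integration by parts turn
  \<open>\<integral> (f\<^sub>1 - f\<^sub>2) h\<close> into a difference of the integrals of \<open>(u\<^sub>j - b) T(M\<^sub>s) \<cdot> D\<^sup>2h\<close>. The boundary terms of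
  \<open>u\<^sub>1\<close> and \<open>u\<^sub>2\<close> cancel: equal Cauchy data force \<open>D\<^sup>2(u\<^sub>1 - u\<^sub>2) = c \<nu> \<nu>\<^sup>T\<close> there, which leaves \<open>T(M\<^sub>s) \<nu>\<close>
  unchanged. If \<open>h\<close> depends on the \<open>E\<close>-variables only, \<open>T(M\<^sub>s) \<cdot> D\<^sup>2h\<close> is controlled by \<open>T(M\<^sub>s) \<cdot> P\<close>, and an
  energy argument bounds \<open>t \<integral> (b - u\<^sub>j) T(M\<^sub>s) \<cdot> P\<close> uniformly in \<open>t\<close>. Letting \<open>t \<rightarrow> \<infinity>\<close> with
  \<open>h = exp (\<xi> \<cdot> x)\<close>, \<open>\<xi> \<in> E\<close>, all exponential moments of \<open>f\<^sub>1 - f\<^sub>2\<close> vanish, since every \<open>\<xi>\<close> lies in some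
  \<open>E\<close>; Stone--Weierstrass finishes the proof.\<close>

section \<open>Coefficient extraction by interpolation\<close>

text \<open>The only bound uniform in t is the one on b - u_j; no derivative of u_j is estimated.
  Derivatives enter through T(M_s), and that factor is handled by exact identities and by its sign.
  The dimension k - 1 of E is tuned to this. It is the largest for which sigma_k(t P) = 0, so b is a
  degenerate quadratic lying above every solution with positive right-hand side. Euler's relation t
  T(M_s) . P = k sigma_k(M_s) - s T(M_s) . D^2(u_j - b) pays for the factor t with sigma_k(M_s),
  whose integral weighted with b - u_j is at most C times the integral of f_j. The outcome is a
  bound const / t for each exponential moment of f_1 - f_2. The constant C is (B + 1) R^2 / 2, where
  f_j <= B on the domain and |x| <= R on its closure: it comes from the paraboloid (B + 1) |x|^2 / 2
  that is added to b to obtain a lower barrier. Surface integrals are avoided throughout: boundary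
  terms occur only inside fields that vanish on the frontier, and the divergence of such a field has
  integral zero.\<close>

definition lagrange_coeff :: "nat \<Rightarrow> nat \<Rightarrow> nat \<Rightarrow> real" where
  "lagrange_coeff n k m =
     coeff (\<Prod>l\<in>{..n} - {m}. smult (1 / (real m - real l)) [:- real l, 1:]) k"

text \<open>Lagrange interpolation at the nodes 0, ..., n, where \<open>lagrange_coeff n k m\<close>
  is the coefficient of X^k in the basis polynomial of node m. The weights do not depend on p, so
  extracting a coefficient is one fixed linear combination of values.\<close>

lemma coeff_eq_sum_lagrange:
  assumes "degree p \<le> n"
  shows "coeff p k = (\<Sum>m\<le>n. lagrange_coeff n k m * poly p (real m))"
proof -
  define L where "L m = (\<Prod>l\<in>{..n} - {m}. smult (1 / (real m - real l)) [:- real l, 1:])" for m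
  define q where "q = (\<Sum>m\<le>n. smult (poly p (real m)) (L m))"
  have L_self: "poly (L m) (real m) = 1" if "m \<le> n" for m
    by (auto simp: L_def poly_prod intro!: prod.neutral simp: divide_simps)
  have L_other: "poly (L m) (real l) = 0" if "l \<le> n" "l \<noteq> m" for l m
    using that unfolding L_def poly_prod by (intro prod_zero) auto
  have deg_L: "degree (L m) \<le> n" if "m \<le> n" for m
  proof -
    have "degree (L m) \<le> (\<Sum>l\<in>{..n} - {m}. degree (smult (1 / (real m - real l)) [:- real l, 1:]))"
      unfolding L_def by (rule order_trans[OF degree_prod_sum_le]) simp_all
    also have "\<dots> \<le> (\<Sum>l\<in>{..n} - {m}. 1)"
      by (intro sum_mono order_trans[OF degree_smult_le]) auto
    also have "\<dots> \<le> n" using that by simp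
    finally show ?thesis .
  qed
  have "p = q"
  proof (rule poly_eqI_degree[where A = "real ` {..n}"])
    fix x assume "x \<in> real ` {..n}"
    then obtain l where l: "x = real l" "l \<le> n" by auto
    have "poly q x = (\<Sum>m\<le>n. poly p (real m) * (if m = l then 1 else 0))"
      unfolding q_def poly_sum using l L_self L_other by (intro sum.cong) auto
    also have "\<dots> = poly p x" using l by (simp add: sum.delta' if_distrib cong: if_cong)
    finally show "poly p x = poly q x" by simp
  next
    have c: "card (real ` {..n}) = Suc n" by (subst card_image) (auto simp: inj_on_def)
    show "card (real ` {..n}) > degree p" using assms c by simp
    have "degree q \<le> n" unfolding q_def
      by (intro degree_sum_le) (auto intro: order_trans[OF degree_smult_le] deg_L)
    then show "card (real ` {..n}) > degree q" using c by simp
  qed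
  then have "coeff p k = coeff q k" by simp
  also have "\<dots> = (\<Sum>m\<le>n. lagrange_coeff n k m * poly p (real m))"
    unfolding q_def coeff_sum lagrange_coeff_def L_def coeff_smult by (simp only: mult.commute)
  finally show ?thesis .
qed

section \<open>Newton's inequality and the cones\<close>

text \<open>Excluding nonreal complex roots, instead of asking for a splitting into real linear
  factors, makes the property multiplicative for free. The zero polynomial fails it; nonzero
  constants satisfy it.\<close>

definition real_rooted :: "real poly \<Rightarrow> bool" where
  "real_rooted p \<longleftrightarrow> (\<forall>z::complex. Im z \<noteq> 0 \<longrightarrow> poly (map_poly complex_of_real p) z \<noteq> 0)"

lemma map_poly_of_real_mult:
  "map_poly complex_of_real (p * q) = map_poly complex_of_real p * map_poly complex_of_real q"
  by (rule poly_eqI) (simp add: coeff_map_poly coeff_mult)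

lemma poly_map_poly_of_real:
  "poly (map_poly complex_of_real p) (complex_of_real x) = complex_of_real (poly p x)"
  by (induction p) (auto simp: map_poly_pCons)

lemma real_rooted_mult:
  "real_rooted (p * q) \<longleftrightarrow> real_rooted p \<and> real_rooted q"
  by (auto simp: real_rooted_def map_poly_of_real_mult)

lemma real_rooted_linear: "real_rooted [:1, a:]"
proof -
  have "1 + z * complex_of_real a \<noteq> 0" if "Im z \<noteq> 0" for z
  proof
    assume *: "1 + z * complex_of_real a = 0"
    then have "Im (1 + z * complex_of_real a) = 0" "Re (1 + z * complex_of_real a) = 0" by auto
    then show False using that by auto
  qed
  then show ?thesis by (auto simp: real_rooted_def map_poly_pCons)
qed

lemma real_rooted_prod: "finite I \<Longrightarrow> real_rooted (\<Prod>i\<in>I. [:1, l i:])"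
proof (induction I rule: finite_induct)
  case empty then show ?case by (simp add: real_rooted_def)
next
  case (insert i I) then show ?case by (simp add: real_rooted_mult real_rooted_linear del: mult_pCons_left)
qed

text \<open>The fundamental theorem of algebra gives a complex root, which real-rootedness forces
  onto the real line. This supports the inductions on the degree below.\<close>

lemma real_rooted_factor:
  assumes "real_rooted p" "degree p = Suc d"
  obtains r q where "p = [:-r, 1:] * q" "real_rooted q" "degree q = d"
proof -
  let ?P = "map_poly complex_of_real p"
  have "degree ?P = Suc d" using assms by (simp add: degree_map_poly)
  then have "\<not> constant (poly ?P)" by (simp add: constant_degree)
  then obtain z where z: "poly ?P z = 0" using fundamental_theorem_of_algebra by blast
  then have "Im z = 0" using assms(1) by (auto simp: real_rooted_def)
  then have "z = complex_of_real (Re z)" by (simp add: complex_eq_iff)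
  then have "poly p (Re z) = 0" using z by (metis of_real_eq_0_iff poly_map_poly_of_real)
  then obtain q where q: "p = [:-Re z, 1:] * q" by (auto simp: poly_eq_0_iff_dvd)
  have "q \<noteq> 0" using q assms(2) by auto
  then have "degree p = Suc (degree q)" unfolding q by (subst degree_mult_eq) auto
  then show ?thesis using that[of "Re z" q] q assms by (auto simp: real_rooted_mult simp del: mult_pCons_left)
qed

text \<open>Away from the roots, p'^2 - p p'' is p^2 times the sum of 1/(x - r)^2 over the roots r.
  Splitting off one root at a time gives the sign without dividing by p.\<close>

lemma laguerre_inequality:
  assumes "real_rooted p"
  shows "poly p x * poly (pderiv (pderiv p)) x \<le> (poly (pderiv p) x)\<^sup>2"
  using assms
proof (induction "degree p" arbitrary: p)
  case 0
  then obtain c where "p = [:c:]" by (metis degree_eq_zeroE)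
  then show ?case by simp
next
  case (Suc d)
  obtain r q where q: "p = [:-r, 1:] * q" "real_rooted q" "degree q = d"
    using real_rooted_factor Suc.prems Suc.hyps(2) by metis
  have IH: "poly q x * poly (pderiv (pderiv q)) x \<le> (poly (pderiv q) x)\<^sup>2"
    using Suc.hyps(1) q by blast
  define a b c y where "a = poly q x" "b = poly (pderiv q) x" "c = poly (pderiv (pderiv q)) x" "y = x - r"
  have e: "poly p x = y * a" "poly (pderiv p) x = a + y * b"
    "poly (pderiv (pderiv p)) x = 2 * b + y * c"
    unfolding q(1) a_b_c_y_def pderiv_mult pderiv_add
    by (simp_all add: pderiv_mult pderiv_add pderiv_pCons algebra_simps del: mult_pCons_left mult_pCons_right)
  \<comment> \<open>For p = (X - r) q the defect p'^2 - p p'' is q^2 plus (x - r)^2 times the defect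
    of q.\<close>
  have "(a + y * b)\<^sup>2 - (y * a) * (2 * b + y * c) = a\<^sup>2 + y\<^sup>2 * (b\<^sup>2 - a * c)"
    by (simp add: power2_eq_square algebra_simps)
  also have "\<dots> \<ge> 0" using IH by (simp add: a_b_c_y_def)
  finally show ?case unfolding e by simp
qed

text \<open>Gauss-Lucas for the real line: p'/p is the sum of 1/(z - r) over the real roots r, and
  every summand has imaginary part of sign opposite to Im z. Hence p' has no zero off the real
  line.\<close>

lemma real_rooted_pderiv:
  assumes "real_rooted p" "degree p > 0"
  shows "real_rooted (pderiv p)"
proof -
  define D where "D p z = poly (map_poly complex_of_real (pderiv p)) z / poly (map_poly complex_of_real p) z" for p z
  have "Im z * Im (D p z) < 0" if "Im z \<noteq> 0" for z
    using assms
  proof (induction "degree p" arbitrary: p)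
    case 0 then show ?case by simp
  next
    case (Suc d)
    obtain r q where q: "p = [:-r, 1:] * q" "real_rooted q" "degree q = d"
      using real_rooted_factor Suc.prems Suc.hyps(2) by metis
    let ?w = "z - complex_of_real r" and ?Q = "poly (map_poly complex_of_real q) z"
      and ?Q' = "poly (map_poly complex_of_real (pderiv q)) z"
    have "Im ?w \<noteq> 0" using that by simp
    then have w: "?w \<noteq> 0" by (metis zero_complex.simps(2))
    have Q: "?Q \<noteq> 0" using q(2) that by (auto simp: real_rooted_def)
    have mp_add: "map_poly complex_of_real (f + g) = map_poly complex_of_real f + map_poly complex_of_real g" for f g
      by (rule poly_eqI) (simp add: coeff_map_poly)
    have "D p z = (?Q + ?w * ?Q') / (?w * ?Q)"
      unfolding D_def q(1) pderiv_mult mp_add map_poly_of_real_mult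
      by (simp add: pderiv_pCons map_poly_pCons algebra_simps map_poly_of_real_mult del: mult_pCons_left mult_pCons_right)
    also have "\<dots> = 1 / ?w + D q z" unfolding D_def using w Q by (simp add: field_simps)
    finally have e: "Im z * Im (D p z) = Im z * Im (1 / ?w) + Im z * Im (D q z)" by (simp add: algebra_simps)
    have "Im z * Im (1 / ?w) = - ((Im z)\<^sup>2 / ((Re z - r)\<^sup>2 + (Im z)\<^sup>2))"
      by (simp add: Im_divide power2_eq_square)
    moreover have "(Re z - r)\<^sup>2 + (Im z)\<^sup>2 > 0" using that by (simp add: add_nonneg_pos)
    ultimately have 1: "Im z * Im (1 / ?w) < 0" using that by (simp add: divide_pos_pos)
    \<comment> \<open>Only the weak sign holds here: q may be constant, and then its logarithmic
      derivative vanishes. The strict sign comes from the root just removed.\<close>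
    have 2: "Im z * Im (D q z) \<le> 0"
    proof (cases "d = 0")
      case True
      then obtain c where "q = [:c:]" using q(3) by (metis degree_eq_zeroE)
      then show ?thesis by (simp add: D_def)
    next
      case False
      then show ?thesis using Suc.hyps(1)[of q] q by auto
    qed
    show ?case using e 1 2 by linarith
  qed
  then show ?thesis by (fastforce simp: real_rooted_def D_def)
qed

text \<open>Laguerre's inequality at 0 is the case m = 0. Differentiation preserves real-rootedness
  and shifts the coefficients down by one place, which moves m up; the weights are those that this
  shift reproduces.\<close>

lemma newton_inequality_weighted:
  assumes "real_rooted p"
  shows "real (m + 2) * (coeff p m * coeff p (m + 2)) \<le> real (m + 1) * (coeff p (m + 1))\<^sup>2"
  using assms
proof (induction m arbitrary: p)
  case 0
  have "poly p 0 = coeff p 0" "poly (pderiv p) 0 = coeff p 1" "poly (pderiv (pderiv p)) 0 = 2 * coeff p 2"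
    by (simp_all add: poly_0_coeff_0 coeff_pderiv numeral_2_eq_2)
  then show ?case using laguerre_inequality[OF 0, of 0] by (simp add: algebra_simps numeral_2_eq_2)
next
  case (Suc m)
  show ?case
  proof (cases "degree p = 0")
    case True then show ?thesis by (simp add: coeff_eq_0)
  next
    case False
    define a b c where "a = coeff p (m + 1)" "b = coeff p (m + 2)" "c = coeff p (m + 3)"
    have c: "coeff (pderiv p) m = (m + 1) * a" "coeff (pderiv p) (m + 1) = (m + 2) * b"
       "coeff (pderiv p) (m + 2) = (m + 3) * c"
      by (simp_all add: coeff_pderiv a_b_c_def algebra_simps eval_nat_numeral)
    have "real (m + 2) * (((m + 1) * a) * ((m + 3) * c)) \<le> real (m + 1) * ((m + 2) * b)\<^sup>2"
      using Suc.IH[OF real_rooted_pderiv[OF Suc.prems]] False unfolding c by simp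
    then have "real ((m + 1) * (m + 2)) * (real (m + 3) * (a * c)) \<le> real ((m + 1) * (m + 2)) * (real (m + 2) * b\<^sup>2)"
      by (simp add: power2_eq_square algebra_simps)
    then have "real (m + 3) * (a * c) \<le> real (m + 2) * b\<^sup>2"
      by (subst (asm) mult_le_cancel_left_pos) (auto simp del: of_nat_mult of_nat_Suc of_nat_add)
    then show ?thesis by (simp add: a_b_c_def numeral_3_eq_3)
  qed
qed

lemma newton_inequality:
  assumes "real_rooted p"
  shows "coeff p m * coeff p (m + 2) \<le> (coeff p (m + 1))\<^sup>2"
proof (rule ccontr)
  assume *: "\<not> ?thesis"
  then have "0 < coeff p m * coeff p (m + 2)" by (smt (verit) zero_le_power2)
  then have "real (m + 1) * (coeff p m * coeff p (m + 2)) \<le> real (m + 2) * (coeff p m * coeff p (m + 2))"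
    by (intro mult_right_mono) auto
  moreover have "real (m + 1) * (coeff p (m + 1))\<^sup>2 < real (m + 1) * (coeff p m * coeff p (m + 2))"
    using * by (intro mult_strict_left_mono) auto
  ultimately show False using newton_inequality_weighted[OF assms, of m] by linarith
qed

lemma coeff_prod_linear_remove:
  fixes l :: "'i \<Rightarrow> real"
  assumes "finite I" "i \<in> I"
  shows "coeff (\<Prod>j\<in>I. [:1, l j:]) (Suc m) =
     coeff (\<Prod>j\<in>I - {i}. [:1, l j:]) (Suc m) + l i * coeff (\<Prod>j\<in>I - {i}. [:1, l j:]) m"
proof -
  have "(\<Prod>j\<in>I. [:1, l j:]) = [:1, l i:] * (\<Prod>j\<in>I - {i}. [:1, l j:])"
    by (rule prod.remove) (use assms in auto)
  then show ?thesis by (simp add: mult_pCons_left)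
qed

lemma coeff_0_prod_linear: "coeff (\<Prod>j\<in>I. [:1, l j:]) 0 = (1::real)"
  by (induction I rule: infinite_finite_induct) (auto simp: mult_pCons_left)

text \<open>The induction step fails only if the next coefficient is nonpositive, and then Newton's
  inequality is violated.\<close>

lemma coeff_prod_linear_remove_pos:
  fixes l :: "'i \<Rightarrow> real"
  assumes I: "finite I" "i \<in> I" and pos: "\<And>j. j \<in> {1..k} \<Longrightarrow> coeff (\<Prod>j\<in>I. [:1, l j:]) j > 0"
  shows "j < k \<Longrightarrow> coeff (\<Prod>j\<in>I - {i}. [:1, l j:]) j > 0"
proof (induction j)
  case 0 then show ?case by (simp add: coeff_0_prod_linear)
next
  case (Suc m)
  let ?q = "\<Prod>j\<in>I - {i}. [:1, l j:]"
  define a b c where "a = coeff ?q m" "b = coeff ?q (Suc m)" "c = coeff ?q (Suc (Suc m))"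
  have a: "a > 0" using Suc by (simp add: a_b_c_def)
  have 1: "b + l i * a > 0"
    using coeff_prod_linear_remove[OF I, of l m] pos[of "Suc m"] Suc.prems by (simp add: a_b_c_def)
  have 2: "c + l i * b > 0"
    using coeff_prod_linear_remove[OF I, of l "Suc m"] pos[of "Suc (Suc m)"] Suc.prems by (simp add: a_b_c_def)
  have N: "a * c \<le> b\<^sup>2"
    using newton_inequality[OF real_rooted_prod[of "I - {i}" l], of m] I(1) by (simp add: a_b_c_def)
  have "b > 0"
  proof (rule ccontr)
    assume "\<not> b > 0"
    then have b: "b \<le> 0" by simp
    \<comment> \<open>With b <= 0 the two positivity facts combine to a c > (l_i a) (- b) >=
      b^2.\<close>
    have "a * c > a * (- (l i * b))" using 2 a by (intro mult_strict_left_mono) auto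
    moreover have "(l i * a) * (- b) \<ge> (- b) * (- b)" using 1 b by (intro mult_right_mono) auto
    ultimately show False using N by (simp add: power2_eq_square algebra_simps)
  qed
  then show ?case by (simp add: a_b_c_def)
qed

lemma esym_eq_coeff: "esym j l = coeff (\<Prod>i\<in>UNIV. [:1, l $ i:]) j"
proof -
  have "(\<Prod>i\<in>UNIV. [:1, l $ i:]) = (\<Prod>i\<in>UNIV. monom (l $ i) 1 + 1)"
    by (simp add: monom_altdef one_pCons)
  also have "\<dots> = (\<Sum>J\<in>Pow UNIV. (\<Prod>i\<in>J. monom (l $ i) 1) * (\<Prod>i\<in>UNIV - J. 1))"
    by (rule prod_add) auto
  also have "\<dots> = (\<Sum>J\<in>UNIV. monom (\<Prod>i\<in>J. l $ i) (card J))"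
  proof -
    have "(\<Prod>i\<in>J. monom (l $ i) 1) = monom (\<Prod>i\<in>J. l $ i) (card J)" for J :: "'a set"
      by (induction J rule: infinite_finite_induct) (auto simp: mult_monom)
    then show ?thesis by simp
  qed
  finally have "coeff (\<Prod>i\<in>UNIV. [:1, l $ i:]) j = (\<Sum>J\<in>(UNIV :: 'a set set). if card J = j then \<Prod>i\<in>J. l $ i else 0)"
    by (simp add: coeff_sum)
  also have "\<dots> = esym j l" unfolding esym_def by (subst sum.inter_filter[symmetric]) auto
  finally show ?thesis by simp
qed

section \<open>Symmetric matrices\<close>

definition diag_mat :: "real^'n \<Rightarrow> real^'n^'n" where
  "diag_mat l = (\<chi> i j. if i = j then l $ i else 0)"

definition rank_one :: "real^'n \<Rightarrow> real^'n^'n" where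
  "rank_one v = (\<chi> i j. v $ i * v $ j)"

definition psd :: "real^'n^'n \<Rightarrow> bool" where
  "psd N \<longleftrightarrow> transpose N = N \<and> (\<forall>x. 0 \<le> x \<bullet> (N *v x))"

text \<open>The quadratic form of M is maximized over the unit sphere of the orthogonal complement
  of S. As S consists of eigenvectors and M is symmetric, M maps this complement to itself, so a
  maximizer is an eigenvector of M and not merely of its compression.\<close>

lemma symmetric_eigenvector_step:
  fixes M :: "real^'n^'n"
  assumes M: "transpose M = M"
    and S: "finite S" "card S < CARD('n)" "\<And>s. s \<in> S \<Longrightarrow> \<exists>l. M *v s = l *\<^sub>R s"
  shows "\<exists>x l. norm x = 1 \<and> (\<forall>s\<in>S. s \<bullet> x = 0) \<and> M *v x = l *\<^sub>R x"
proof -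
  have sym: "x \<bullet> (M *v y) = (M *v x) \<bullet> y" for x y
    by (metis M dot_lmul_matrix vector_transpose_matrix)
  define W where "W = {x. \<forall>s\<in>S. s \<bullet> x = 0}"
  have subW: "subspace W" by (auto simp: W_def subspace_def inner_add_right)
  have "dim (span S) < DIM(real^'n)"
    using dim_le_card'[OF S(1)] S(2) by simp
  then obtain y where y: "y \<noteq> 0" "\<And>x. x \<in> span S \<Longrightarrow> orthogonal y x"
    using orthogonal_to_subspace_exists[of "span S"] by (auto simp: span_span)
  then have yW: "y \<in> W" by (auto simp: W_def orthogonal_def inner_commute span_base)
  define K where "K = W \<inter> sphere 0 1"
  have "compact K" unfolding K_def by (intro closed_Int_compact closed_subspace subW compact_sphere)
  moreover have "y /\<^sub>R norm y \<in> K" using y(1) yW subspace_scale[OF subW] by (auto simp: K_def)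
  moreover define f where "f x = x \<bullet> (M *v x)" for x
  have "continuous_on K f" unfolding f_def
    by (intro continuous_intros linear_continuous_on matrix_vector_mul_bounded_linear)
  ultimately obtain x where x: "x \<in> K" "\<And>z. z \<in> K \<Longrightarrow> f z \<le> f x"
    using continuous_attains_sup[of K f] by blast
  have xW: "x \<in> W" and nx: "norm x = 1" and xx: "x \<bullet> x = 1"
    using x(1) by (auto simp: K_def dot_square_norm)
  have max: "f z \<le> f x * (z \<bullet> z)" if "z \<in> W" for z
  proof (cases "z = 0")
    case True then show ?thesis by (simp add: f_def)
  next
    case False
    have "z /\<^sub>R norm z \<in> K" using False that subspace_scale[OF subW] by (auto simp: K_def)
    from x(2)[OF this] have "f z / (norm z)\<^sup>2 \<le> f x"
      by (simp add: f_def matrix_vector_mult_scaleR power2_eq_square divide_inverse mult.commute mult.left_commute)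
    then show ?thesis using False by (simp add: divide_le_eq dot_square_norm)
  qed
  have orth: "w \<bullet> (M *v x) = 0" if "w \<in> W" "x \<bullet> w = 0" for w
  proof -
    define b a where "b = w \<bullet> (M *v x)" and "a = f w - f x * (w \<bullet> w)"
    \<comment> \<open>The perturbation x + s w stays in the complement, so maximality gives a
      quadratic inequality in s whose linear term must vanish.\<close>
    have *: "2 * s * b + s\<^sup>2 * a \<le> 0" for s
    proof -
      have "x + s *\<^sub>R w \<in> W" using that xW subW by (simp add: subspace_add subspace_scale)
      from max[OF this] have "f (x + s *\<^sub>R w) \<le> f x * ((x + s *\<^sub>R w) \<bullet> (x + s *\<^sub>R w))" .
      moreover have "f (x + s *\<^sub>R w) = f x + 2 * s * b + s\<^sup>2 * f w"
        using sym[of x w]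
        by (simp add: f_def b_def matrix_vector_right_distrib matrix_vector_mult_scaleR inner_add_left inner_add_right
            power2_eq_square algebra_simps inner_commute)
      moreover have "(x + s *\<^sub>R w) \<bullet> (x + s *\<^sub>R w) = 1 + s\<^sup>2 * (w \<bullet> w)"
        using that xx by (simp add: inner_add_left inner_add_right power2_eq_square inner_commute)
      ultimately have "f x + 2 * s * b + s\<^sup>2 * f w \<le> f x * (1 + s\<^sup>2 * (w \<bullet> w))"
        by (simp only:)
      then show ?thesis by (simp add: a_def algebra_simps)
    qed
    \<comment> \<open>The inequality is tested at s = b / c; with this c both c and 2 c + a are
      positive, and b^2 <= 0 results.\<close>
    define c where "c = \<bar>a\<bar> + 1"
    have c: "c > 0" "2 * c + a > 0" by (auto simp: c_def)
    have "2 * (b / c) * b + (b / c)\<^sup>2 * a = b\<^sup>2 / c\<^sup>2 * (2 * c + a)"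
      using c by (simp add: field_simps power2_eq_square)
    then have "b\<^sup>2 / c\<^sup>2 * (2 * c + a) \<le> 0" using *[of "b / c"] by simp
    then have "b\<^sup>2 \<le> 0" using c by (simp add: mult_le_0_iff divide_le_0_iff)
    then show ?thesis by (simp add: b_def)
  qed
  have "M *v x \<in> W" unfolding W_def
  proof (intro CollectI ballI)
    fix s assume s: "s \<in> S"
    obtain l where "M *v s = l *\<^sub>R s" using S(3)[OF s] by blast
    then show "s \<bullet> (M *v x) = 0" using s xW by (simp add: sym W_def)
  qed
  then have yW: "M *v x - f x *\<^sub>R x \<in> W" using subW xW by (simp add: subspace_diff subspace_scale)
  moreover have yx: "x \<bullet> (M *v x - f x *\<^sub>R x) = 0" using xx by (simp add: inner_diff_right f_def)
  ultimately have "(M *v x - f x *\<^sub>R x) \<bullet> (M *v x) = 0" by (rule orth)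
  then have "(M *v x - f x *\<^sub>R x) \<bullet> (M *v x - f x *\<^sub>R x) = 0"
    using yx by (simp add: inner_diff_right inner_commute)
  then have "M *v x = f x *\<^sub>R x" by simp
  then show ?thesis using nx xW by (auto simp: W_def)
qed

text \<open>Orthonormal eigenvectors are collected one at a time up to the full dimension and become
  the columns of Q. The eigenvector equations are exported as well, since later arguments work with
  the columns themselves.\<close>

lemma symmetric_diagonalization:
  fixes M :: "real^'n^'n"
  assumes M: "transpose M = M"
  obtains Q l where "orthogonal_matrix Q" "M = Q ** diag_mat l ** transpose Q"
    "\<And>j. M *v column j Q = l $ j *\<^sub>R column j Q"
proof -
  have ex: "\<exists>S. finite S \<and> card S = m \<and> (\<forall>s\<in>S. norm s = 1 \<and> (\<exists>l. M *v s = l *\<^sub>R s)) \<and>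
       (\<forall>s\<in>S. \<forall>t\<in>S. s \<noteq> t \<longrightarrow> s \<bullet> t = 0)" if "m \<le> CARD('n)" for m
    using that
  proof (induction m)
    case 0 then show ?case by (intro exI[of _ "{}"]) auto
  next
    case (Suc m)
    then obtain S where S: "finite S" "card S = m" "\<forall>s\<in>S. norm s = 1 \<and> (\<exists>l. M *v s = l *\<^sub>R s)"
      "\<forall>s\<in>S. \<forall>t\<in>S. s \<noteq> t \<longrightarrow> s \<bullet> t = 0" by auto
    obtain x l where x: "norm x = 1" "\<forall>s\<in>S. s \<bullet> x = 0" "M *v x = l *\<^sub>R x"
      using symmetric_eigenvector_step[OF M S(1)] S Suc.prems by auto
    have "x \<notin> S" using x(1,2) by (auto simp: dot_square_norm)
    then show ?case
      by (intro exI[of _ "insert x S"]) (use S x in \<open>auto simp: inner_commute\<close>)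
  qed
  obtain S :: "(real^'n) set" where S: "finite S" "card S = CARD('n)"
    "\<forall>s\<in>S. norm s = 1 \<and> (\<exists>l. M *v s = l *\<^sub>R s)" "\<forall>s\<in>S. \<forall>t\<in>S. s \<noteq> t \<longrightarrow> s \<bullet> t = 0"
    using ex[of "CARD('n)"] by auto
  obtain f where f: "bij_betw f (UNIV :: 'n set) S"
    using finite_same_card_bij[of "UNIV :: 'n set" S] S by auto
  then have fS: "f j \<in> S" for j by (auto simp: bij_betw_def)
  have fo: "f i \<bullet> f j = (if i = j then 1 else 0)" for i j
  proof -
    have "f i = f j \<longleftrightarrow> i = j" using f by (auto simp: bij_betw_def inj_on_def)
    then show ?thesis using S(3,4) fS by (auto simp: dot_square_norm)
  qed
  define l where "l = (\<chi> j. SOME c. M *v f j = c *\<^sub>R f j)"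
  have l: "M *v f j = l $ j *\<^sub>R f j" for j
    unfolding l_def using someI_ex[of "\<lambda>c. M *v f j = c *\<^sub>R f j"] S(3) fS by simp
  define Q where "Q = (\<chi> i j. f j $ i)"
  have col: "column j Q = f j" for j by (simp add: Q_def column_def)
  have "transpose Q ** Q = mat 1"
    using fo by (simp add: Q_def transpose_def matrix_matrix_mult_def mat_def inner_vec_def vec_eq_iff)
  then have oQ: "orthogonal_matrix Q" by (simp add: orthogonal_matrix)
  have "M ** Q = Q ** diag_mat l"
  proof -
    have "(M ** Q) $ i $ j = (Q ** diag_mat l) $ i $ j" for i j
    proof -
      have "(M ** Q) $ i $ j = (M *v f j) $ i"
        by (simp add: matrix_matrix_mult_def matrix_vector_mult_def Q_def)
      also have "\<dots> = l $ j * f j $ i" by (simp add: l)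
      also have "\<dots> = (\<Sum>k\<in>UNIV. Q $ i $ k * (if k = j then l $ k else 0))"
        by (simp add: Q_def if_distrib sum.delta cong: if_cong)
      finally show ?thesis by (simp add: matrix_matrix_mult_def diag_mat_def)
    qed
    then show ?thesis by (simp add: vec_eq_iff)
  qed
  then have "M ** Q ** transpose Q = Q ** diag_mat l ** transpose Q" by simp
  then have "M = Q ** diag_mat l ** transpose Q"
    using oQ by (simp add: orthogonal_matrix_def matrix_mul_assoc[symmetric])
  then show ?thesis using that oQ l col by metis
qed

section \<open>Derivative of the determinant\<close>

text \<open>The cofactor matrix. Replacing a row by a basis vector, instead of deleting a row and a
  column, keeps all matrices of the same size, so the row calculus of \<open>det\<close> applies
  directly.\<close>

definition cof :: "real^'n^'n \<Rightarrow> real^'n^'n" where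
  "cof A = (\<chi> i j. det (\<chi> k. if k = i then axis j 1 else A $ k))"

lemma det_row_replace_expand:
  fixes A :: "real^'n^'n"
  shows "det (\<chi> k. if k = i then v else A $ k) = (\<Sum>j\<in>UNIV. cof A $ i $ j * v $ j)"
proof -
  have v: "v = (\<Sum>j\<in>UNIV. v $ j *s axis j 1)" by (simp add: basis_expansion)
  have "det (\<chi> k. if k = i then v else A $ k) =
      det (\<chi> k. if k = i then (\<Sum>j\<in>UNIV. v $ j *s axis j 1) else A $ k)"
    by (subst v) simp
  also have "\<dots> = (\<Sum>j\<in>UNIV. v $ j * cof A $ i $ j)"
    by (subst det_linear_row_sum) (auto simp: det_row_mul cof_def)
  finally show ?thesis by (simp add: mult.commute)
qed

text \<open>Jacobi's formula. Differentiating the Leibniz sum replaces one row at a time by its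
  derivative, and expansion along that row produces the cofactors.\<close>

lemma has_derivative_det:
  fixes A :: "'a::real_normed_vector \<Rightarrow> real^'n^'n"
  assumes A: "\<And>i j. ((\<lambda>x. A x $ i $ j) has_derivative A' i j) (at x within S)"
  shows "((\<lambda>x. det (A x)) has_derivative
     (\<lambda>h. \<Sum>i\<in>UNIV. \<Sum>j\<in>UNIV. cof (A x) $ i $ j * A' i j h)) (at x within S)"
proof -
  let ?PU = "{p. p permutes (UNIV :: 'n set)}"
  have "((\<lambda>x. \<Sum>p\<in>?PU. of_int (sign p) * (\<Prod>i\<in>UNIV. A x $ i $ p i)) has_derivative
     (\<lambda>h. \<Sum>p\<in>?PU. of_int (sign p) * (\<Sum>i\<in>UNIV. A' i (p i) h * (\<Prod>l\<in>UNIV - {i}. A x $ l $ p l)))) (at x within S)"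
    by (intro has_derivative_sum has_derivative_mult_right has_derivative_prod A)
  moreover have "(\<Sum>p\<in>?PU. of_int (sign p) * (\<Sum>i\<in>UNIV. A' i (p i) h * (\<Prod>l\<in>UNIV - {i}. A x $ l $ p l)))
      = (\<Sum>i\<in>UNIV. \<Sum>j\<in>UNIV. cof (A x) $ i $ j * A' i j h)" (is "?L = ?R") for h
  proof -
    have "?L = (\<Sum>i\<in>UNIV. \<Sum>p\<in>?PU. of_int (sign p) * (A' i (p i) h * (\<Prod>l\<in>UNIV - {i}. A x $ l $ p l)))"
      by (simp add: sum_distrib_left sum.swap[of _ ?PU UNIV])
    also have "\<dots> = (\<Sum>i\<in>UNIV. det (\<chi> k. if k = i then (\<chi> j. A' i j h) else A x $ k))"
    proof (intro sum.cong refl)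
      fix i
      have "(\<Prod>l\<in>UNIV. (\<chi> k. if k = i then (\<chi> j. A' i j h) else A x $ k) $ l $ p l) =
         A' i (p i) h * (\<Prod>l\<in>UNIV - {i}. A x $ l $ p l)" for p
        by (subst prod.remove[of _ i]) (auto intro!: prod.cong)
      then show "(\<Sum>p\<in>?PU. of_int (sign p) * (A' i (p i) h * (\<Prod>l\<in>UNIV - {i}. A x $ l $ p l))) =
          det (\<chi> k. if k = i then (\<chi> j. A' i j h) else A x $ k)"
        by (simp add: det_def)
    qed
    also have "\<dots> = ?R" by (simp add: det_row_replace_expand)
    finally show ?thesis .
  qed
  ultimately show ?thesis by (simp add: det_def)
qed

lemma sum_sum_entry:
  fixes f :: "'n::finite \<Rightarrow> 'm::finite \<Rightarrow> real"
  shows "(\<Sum>i\<in>UNIV. \<Sum>j\<in>UNIV. f i j * (if i = a \<and> j = b then c else 0)) = f a b * c"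
proof -
  have "(\<Sum>i\<in>UNIV. \<Sum>j\<in>UNIV. f i j * (if i = a \<and> j = b then c else 0))
     = (\<Sum>i\<in>UNIV. if i = a then f i b * c else 0)"
    by (intro sum.cong refl) (auto simp: if_distrib sum.delta cong: if_cong)
  then show ?thesis by simp
qed

text \<open>Cofactor entries are derivatives of \<open>det\<close> along matrix units, and
  \<open>det\<close> is invariant under transposition, which turns the unit (i, j) into (j,
  i).\<close>

lemma cof_transpose: "cof (transpose A) $ i $ j = cof A $ j $ i"
proof -
  have D: "((\<lambda>s. det (\<chi> k l. B $ k $ l + s * (if k = i \<and> l = j then 1 else 0))) has_derivative
     (\<lambda>h. cof B $ i $ j * h)) (at 0)" for B :: "real^'n^'n" and i j
  proof -
    have "((\<lambda>s. det (\<chi> k l. B $ k $ l + s * (if k = i \<and> l = j then 1 else 0))) has_derivative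
     (\<lambda>h. \<Sum>k\<in>UNIV. \<Sum>l\<in>UNIV. cof (\<chi> k l. B $ k $ l + 0 * (if k = i \<and> l = j then 1 else 0)) $ k $ l
         * (if k = i \<and> l = j then h else 0))) (at 0)"
      by (rule has_derivative_det) (auto intro!: derivative_eq_intros)
    moreover have "(\<chi> k l. B $ k $ l + 0 * (if k = i \<and> l = j then 1 else 0)) = B"
      by (simp add: vec_eq_iff)
    ultimately show ?thesis by (simp only: sum_sum_entry)
  qed
  have "(\<lambda>s. det (\<chi> k l. transpose A $ k $ l + s * (if k = i \<and> l = j then 1 else 0))) =
     (\<lambda>s. det (\<chi> k l. A $ k $ l + s * (if k = j \<and> l = i then 1 else 0)))"
    by (rule ext, subst det_transpose[symmetric]) (auto simp: transpose_def intro!: arg_cong[where f=det] simp: vec_eq_iff)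
  then have "(\<lambda>h. cof (transpose A) $ i $ j * h) = (\<lambda>h. cof A $ j $ i * h)"
    using has_derivative_unique[OF D[of "transpose A" i j]] D[of A j i] by simp
  from fun_cong[OF this, of 1] show ?thesis by simp
qed

lemma det_add_multiples_of_row:
  fixes A :: "real^'n^'n"
  shows "det (\<chi> k. if k = i then v else A $ k + c k *\<^sub>R v) = det (\<chi> k. if k = i then v else A $ k)"
proof -
  have "finite S \<Longrightarrow> i \<notin> S \<Longrightarrow>
     det (\<chi> k. if k = i then v else if k \<in> S then A $ k + c k *\<^sub>R v else A $ k) =
     det (\<chi> k. if k = i then v else A $ k)" for S :: "'n set"
  proof (induction S rule: finite_induct)
    case empty then show ?case by (intro arg_cong[where f = det]) (simp add: vec_eq_iff)
  next
    case (insert a S)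
    let ?B = "\<chi> k. if k = i then v else if k \<in> S then A $ k + c k *\<^sub>R v else A $ k"
    have eq: "(\<chi> k. if k = i then v else if k \<in> insert a S then A $ k + c k *\<^sub>R v else A $ k) =
       (\<chi> k. if k = a then row a ?B + c a *s row i ?B else row k ?B)"
      using insert by (auto simp: vec_eq_iff row_def)
    have "det (\<chi> k. if k = i then v else if k \<in> insert a S then A $ k + c k *\<^sub>R v else A $ k) = det ?B"
      unfolding eq by (rule det_row_operation) (use insert in auto)
    then show ?case using insert by simp
  qed
  from this[of "UNIV - {i}"] show ?thesis by (simp cong: if_cong)
qed

text \<open>Contracting row i of the cofactors with v puts v into row i of the determinant; every
  other row of A + c v v^T differs from that of A by a multiple of v, which a row operation removes.
  This is the algebra behind the agreement of the boundary fluxes.\<close>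

lemma cof_add_rank_one_mult:
  "(\<Sum>j\<in>UNIV. cof (A + c *\<^sub>R rank_one v) $ i $ j * v $ j) = (\<Sum>j\<in>UNIV. cof A $ i $ j * v $ j)"
proof -
  have e: "(A + c *\<^sub>R rank_one v) $ k = A $ k + (c * v $ k) *\<^sub>R v" for k
    by (simp add: vec_eq_iff rank_one_def)
  show ?thesis
    unfolding det_row_replace_expand[symmetric] e by (rule det_add_multiples_of_row)
qed

lemma cof_diag_mat:
  "cof (diag_mat l) $ i $ j = (if i = j then \<Prod>k\<in>UNIV - {i}. l $ k else 0)"
proof (cases "i = j")
  case True
  have "cof (diag_mat l) $ i $ i = (\<Prod>k\<in>UNIV. (\<chi> k. if k = i then axis i 1 else diag_mat l $ k) $ k $ k)"
    unfolding cof_def by (simp, subst det_diagonal) (auto simp: diag_mat_def axis_def)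
  also have "\<dots> = (\<Prod>k\<in>UNIV - {i}. l $ k)"
    by (subst prod.remove[of _ i]) (auto simp: diag_mat_def axis_def intro!: prod.cong)
  finally show ?thesis using True by simp
next
  case False
  have "det (\<chi> k. if k = i then axis j 1 else diag_mat l $ k) = 0"
    by (rule det_zero_column[of i]) (use False in \<open>auto simp: column_def diag_mat_def axis_def vec_eq_iff\<close>)
  then show ?thesis using False by (simp add: cof_def)
qed

lemma det_pencil_poly:
  fixes A B :: "real^'n^'n"
  obtains p where "degree p \<le> CARD('n)" "\<And>s. poly p s = det (A + s *\<^sub>R B)"
proof -
  let ?PU = "{p. p permutes (UNIV :: 'n set)}"
  define q where "q = (\<Sum>p\<in>?PU. smult (of_int (sign p)) (\<Prod>i\<in>UNIV. [:A $ i $ p i, B $ i $ p i:]))"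
  have "degree q \<le> CARD('n)" unfolding q_def
  proof (rule degree_sum_le)
    show "degree (smult (of_int (sign p)) (\<Prod>i\<in>UNIV. [:A $ i $ p i, B $ i $ p i:])) \<le> CARD('n)" for p
    proof -
      have "degree (smult (of_int (sign p)) (\<Prod>i\<in>UNIV. [:A $ i $ p i, B $ i $ p i:]))
        \<le> degree (\<Prod>i\<in>UNIV. [:A $ i $ p i, B $ i $ p i:])" by (rule degree_smult_le)
      also have "\<dots> \<le> sum (degree \<circ> (\<lambda>i. [:A $ i $ p i, B $ i $ p i:])) UNIV"
        by (rule degree_prod_sum_le) simp
      also have "\<dots> \<le> (\<Sum>i\<in>(UNIV::'n set). 1)" by (intro sum_mono) auto
      finally show ?thesis by simp
    qed
  qed simp
  moreover have "poly q s = det (A + s *\<^sub>R B)" for s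
    by (simp add: q_def poly_sum poly_prod det_def)
  ultimately show ?thesis using that by blast
qed

section \<open>The Hessian operator and its linearization\<close>

text \<open>\<open>hsig k M\<close> is the coefficient of \<open>s\<^sup>k\<close> in \<open>det (1 + s M)\<close>, read off by interpolation from the
  values at \<open>s = 0, \<dots>, n\<close>. In this form every linear identity for determinants carries over.\<close>

definition hsig :: "nat \<Rightarrow> real^'n^'n \<Rightarrow> real" where
  "hsig k M = (\<Sum>m\<le>CARD('n). lagrange_coeff CARD('n) k m * det (mat 1 + real m *\<^sub>R M))"

text \<open>Chain rule at each interpolation node, whence the factor \<open>real m\<close>. On
  symmetric matrices and for k >= 1 this is the Newton tensor of order k - 1, called T in the
  overview.\<close>

definition hsig_grad :: "nat \<Rightarrow> real^'n^'n \<Rightarrow> real^'n^'n" where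
  "hsig_grad k M = (\<Sum>m\<le>CARD('n). (lagrange_coeff CARD('n) k m * real m) *\<^sub>R cof (mat 1 + real m *\<^sub>R M))"

definition frob :: "real^'n^'n \<Rightarrow> real^'n^'n \<Rightarrow> real" where
  "frob A B = (\<Sum>i\<in>UNIV. \<Sum>j\<in>UNIV. A $ i $ j * B $ i $ j)"

lemma sum_rotate3:
  fixes f :: "'i \<Rightarrow> 'j \<Rightarrow> 'm \<Rightarrow> real"
  shows "(\<Sum>i\<in>A. \<Sum>j\<in>B. \<Sum>m\<in>C. f i j m) = (\<Sum>m\<in>C. \<Sum>i\<in>A. \<Sum>j\<in>B. f i j m)"
proof -
  have "(\<Sum>i\<in>A. \<Sum>j\<in>B. \<Sum>m\<in>C. f i j m) = (\<Sum>i\<in>A. \<Sum>m\<in>C. \<Sum>j\<in>B. f i j m)"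
    by (intro sum.cong refl sum.swap)
  also have "\<dots> = (\<Sum>m\<in>C. \<Sum>i\<in>A. \<Sum>j\<in>B. f i j m)" by (rule sum.swap)
  finally show ?thesis .
qed

lemma hsig_eq_coeff:
  fixes M :: "real^'n^'n"
  assumes "degree p \<le> CARD('n)" "\<And>s. poly p s = det (mat 1 + s *\<^sub>R M)"
  shows "hsig k M = coeff p k"
  unfolding hsig_def coeff_eq_sum_lagrange[OF assms(1)] assms(2) ..

lemma hsig_grad_entry:
  "hsig_grad k M $ i $ j =
     (\<Sum>m\<le>CARD('n). lagrange_coeff CARD('n) k m * real m * cof (mat 1 + real m *\<^sub>R M) $ i $ j)"
  for M :: "real^'n^'n"
  by (simp add: hsig_grad_def sum_component)

lemma has_derivative_hsig:
  fixes A :: "'a::real_normed_vector \<Rightarrow> real^'n^'n"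
  assumes A: "\<And>i j. ((\<lambda>x. A x $ i $ j) has_derivative A' i j) (at x within S)"
  shows "((\<lambda>x. hsig k (A x)) has_derivative
     (\<lambda>h. \<Sum>i\<in>UNIV. \<Sum>j\<in>UNIV. hsig_grad k (A x) $ i $ j * A' i j h)) (at x within S)"
proof -
  have "((\<lambda>x. \<Sum>m\<le>CARD('n). lagrange_coeff CARD('n) k m * det (mat 1 + real m *\<^sub>R A x)) has_derivative
     (\<lambda>h. \<Sum>m\<le>CARD('n). lagrange_coeff CARD('n) k m * (\<Sum>i\<in>UNIV. \<Sum>j\<in>UNIV.
        cof (mat 1 + real m *\<^sub>R A x) $ i $ j * (real m * A' i j h)))) (at x within S)"
  proof (intro has_derivative_sum has_derivative_mult_right has_derivative_det)
    fix m i j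
    show "((\<lambda>x. (mat 1 + real m *\<^sub>R A x) $ i $ j) has_derivative (\<lambda>h. real m * A' i j h)) (at x within S)"
      using A[of i j] by (auto intro!: derivative_eq_intros)
  qed
  moreover have "(\<Sum>m\<le>CARD('n). lagrange_coeff CARD('n) k m * (\<Sum>i\<in>UNIV. \<Sum>j\<in>UNIV.
        cof (mat 1 + real m *\<^sub>R A x) $ i $ j * (real m * A' i j h))) =
      (\<Sum>i\<in>UNIV. \<Sum>j\<in>UNIV. hsig_grad k (A x) $ i $ j * A' i j h)" for h
  proof -
    have "(\<Sum>i\<in>UNIV. \<Sum>j\<in>UNIV. hsig_grad k (A x) $ i $ j * A' i j h) =
       (\<Sum>i\<in>UNIV. \<Sum>j\<in>UNIV. \<Sum>m\<le>CARD('n). lagrange_coeff CARD('n) k m *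
         (cof (mat 1 + real m *\<^sub>R A x) $ i $ j * (real m * A' i j h)))"
      unfolding hsig_grad_entry sum_distrib_right by (simp add: algebra_simps)
    also have "\<dots> = (\<Sum>m\<le>CARD('n). \<Sum>i\<in>UNIV. \<Sum>j\<in>UNIV. lagrange_coeff CARD('n) k m *
         (cof (mat 1 + real m *\<^sub>R A x) $ i $ j * (real m * A' i j h)))"
      by (rule sum_rotate3)
    finally show ?thesis by (simp add: sum_distrib_left)
  qed
  ultimately show ?thesis unfolding hsig_def by simp
qed

lemma has_derivative_hsig_line:
  fixes A B :: "real^'n^'n"
  shows "((\<lambda>s. hsig k (A + s *\<^sub>R B)) has_real_derivative frob (hsig_grad k (A + s *\<^sub>R B)) B) (at s within S)"
proof -
  have "((\<lambda>s. hsig k (A + s *\<^sub>R B)) has_derivative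
     (\<lambda>h. \<Sum>i\<in>UNIV. \<Sum>j\<in>UNIV. hsig_grad k (A + s *\<^sub>R B) $ i $ j * (h * B $ i $ j))) (at s within S)"
    by (rule has_derivative_hsig) (auto intro!: derivative_eq_intros)
  then show ?thesis
    unfolding has_field_derivative_def
    by (rule has_derivative_eq_rhs) (auto simp: fun_eq_iff frob_def sum_distrib_left sum_distrib_right algebra_simps)
qed

section \<open>Symmetry, Euler's relation and rank-one perturbations\<close>

lemma symmetric_mat_pencil:
  "transpose M = M \<Longrightarrow> transpose (mat 1 + c *\<^sub>R M) = mat 1 + c *\<^sub>R M"
  by (simp add: vec_eq_iff transpose_def mat_def)

lemma hsig_grad_sym:
  assumes "transpose M = M"
  shows "hsig_grad k M $ i $ j = hsig_grad k M $ j $ i"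
proof -
  have "cof (mat 1 + c *\<^sub>R M) $ i $ j = cof (mat 1 + c *\<^sub>R M) $ j $ i" for c
    using cof_transpose[of "mat 1 + c *\<^sub>R M" i j] symmetric_mat_pencil[OF assms] by simp
  then show ?thesis unfolding hsig_grad_entry by (intro sum.cong) simp_all
qed

text \<open>Homogeneity of degree k, read off from the generating polynomial p(s) = det(1 + s M):
  the numbers m p'(m) are the node values of X p', whose coefficient of X^k is k times that of
  p.\<close>

lemma hsig_euler:
  fixes M :: "real^'n^'n"
  shows "frob (hsig_grad k M) M = real k * hsig k M"
proof -
  obtain p where p: "degree p \<le> CARD('n)" "\<And>s. poly p s = det (mat 1 + s *\<^sub>R M)"
    using det_pencil_poly by blast
  define q where "q = pCons 0 (pderiv p)"
  have dq: "degree q \<le> CARD('n)"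
  proof (cases "pderiv p = 0")
    case False
    then have "degree p \<noteq> 0" by (auto simp: pderiv_eq_0_iff)
    then show ?thesis using p(1) by (auto simp: q_def degree_pCons_eq_if degree_pderiv)
  qed (simp add: q_def)
  have pd: "poly (pderiv p) s = frob (cof (mat 1 + s *\<^sub>R M)) M" for s
  proof -
    have "((\<lambda>s. det (mat 1 + s *\<^sub>R M)) has_derivative
       (\<lambda>h. \<Sum>i\<in>UNIV. \<Sum>j\<in>UNIV. cof (mat 1 + s *\<^sub>R M) $ i $ j * (h * M $ i $ j))) (at s)"
      by (rule has_derivative_det) (auto intro!: derivative_eq_intros)
    then have "((\<lambda>s. det (mat 1 + s *\<^sub>R M)) has_real_derivative frob (cof (mat 1 + s *\<^sub>R M)) M) (at s)"
      unfolding has_field_derivative_def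
      by (rule has_derivative_eq_rhs) (auto simp: fun_eq_iff frob_def sum_distrib_left sum_distrib_right algebra_simps)
    moreover have "(poly p has_real_derivative poly (pderiv p) s) (at s)" by (rule poly_DERIV)
    moreover have "poly p = (\<lambda>s. det (mat 1 + s *\<^sub>R M))" using p(2) by auto
    ultimately show ?thesis using DERIV_unique by fastforce
  qed
  have "frob (hsig_grad k M) M = (\<Sum>i\<in>UNIV. \<Sum>j\<in>UNIV. \<Sum>m\<le>CARD('n).
      lagrange_coeff CARD('n) k m * real m * (cof (mat 1 + real m *\<^sub>R M) $ i $ j * M $ i $ j))"
    unfolding frob_def hsig_grad_entry sum_distrib_right by (simp add: algebra_simps)
  also have "\<dots> = (\<Sum>m\<le>CARD('n). \<Sum>i\<in>UNIV. \<Sum>j\<in>UNIV.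
      lagrange_coeff CARD('n) k m * real m * (cof (mat 1 + real m *\<^sub>R M) $ i $ j * M $ i $ j))"
    by (rule sum_rotate3)
  also have "\<dots> = (\<Sum>m\<le>CARD('n). lagrange_coeff CARD('n) k m * poly q (real m))"
    by (simp add: q_def pd frob_def sum_distrib_left algebra_simps)
  also have "\<dots> = coeff q k" by (rule coeff_eq_sum_lagrange[OF dq, symmetric])
  also have "\<dots> = real k * coeff p k"
    by (cases k) (simp_all add: q_def coeff_pderiv)
  finally show ?thesis using hsig_eq_coeff[OF p] by simp
qed

text \<open>The cofactor identity applies at each node, where the perturbation of 1 + m M is m c v
  v^T.\<close>

lemma hsig_grad_add_rank_one_mult:
  "hsig_grad k (M + c *\<^sub>R rank_one v) *v v = hsig_grad k M *v v"
proof -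
  have "(\<Sum>j\<in>UNIV. cof (mat 1 + m *\<^sub>R (M + c *\<^sub>R rank_one v)) $ i $ j * v $ j) =
      (\<Sum>j\<in>UNIV. cof (mat 1 + m *\<^sub>R M) $ i $ j * v $ j)" for i m
    using cof_add_rank_one_mult[of "mat 1 + m *\<^sub>R M" "m * c" v i] by (simp add: algebra_simps)
  then have e: "(\<Sum>j\<in>UNIV. a * cof (mat 1 + m *\<^sub>R (M + c *\<^sub>R rank_one v)) $ i $ j * v $ j) =
      (\<Sum>j\<in>UNIV. a * cof (mat 1 + m *\<^sub>R M) $ i $ j * v $ j)" for a i m
    by (simp add: mult.assoc sum_distrib_left[symmetric])
  have "(hsig_grad k (M + c *\<^sub>R rank_one v) *v v) $ i = (hsig_grad k M *v v) $ i" for i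
    unfolding matrix_vector_mult_def hsig_grad_entry sum_distrib_right vec_lambda_beta
    by (subst (1 2) sum.swap) (simp only: e)
  then show ?thesis by (simp add: vec_eq_iff)
qed

lemma frob_rank_one: "frob A (rank_one v) = v \<bullet> (A *v v)"
  by (simp add: frob_def rank_one_def inner_vec_def matrix_vector_mult_def sum_distrib_left algebra_simps)

lemma frob_scaleR_right: "frob A (c *\<^sub>R B) = c * frob A B"
  by (simp add: frob_def sum_distrib_left algebra_simps)

lemma frob_add_right: "frob A (B + C) = frob A B + frob A C"
  by (simp add: frob_def sum.distrib algebra_simps)

lemma frob_sum_right: "frob A (\<Sum>i\<in>I. B i) = (\<Sum>i\<in>I. frob A (B i))"
  by (induction I rule: infinite_finite_induct) (simp_all add: frob_add_right, simp_all add: frob_def)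

text \<open>By the preceding invariance the slope in c is constant, so sigma_k is affine along
  rank-one directions. Monotonicity thereby reduces to the sign of the slope at the starting
  point.\<close>

lemma hsig_add_rank_one:
  "hsig k (M + c *\<^sub>R rank_one v) = hsig k M + c * (v \<bullet> (hsig_grad k M *v v))"
proof -
  let ?g = "\<lambda>c. hsig k (M + c *\<^sub>R rank_one v) - c * (v \<bullet> (hsig_grad k M *v v))"
  have "(?g has_real_derivative 0) (at s)" for s
    by (auto intro!: derivative_eq_intros has_derivative_hsig_line
        simp: frob_rank_one hsig_grad_add_rank_one_mult)
  then have "?g c = ?g 0" using DERIV_isconst_all[of ?g] by blast
  then show ?thesis by simp
qed

section \<open>Orthogonal invariance and the passage to eigenvalues\<close>

lemma matrix_conj_pencil:
  fixes A B Q R :: "real^'n^'n"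
  shows "Q ** (A + c *\<^sub>R B) ** R = Q ** A ** R + c *\<^sub>R (Q ** B ** R)"
proof -
  have "Q ** (A + c *\<^sub>R B) = Q ** A + c *\<^sub>R (Q ** B)"
    by (simp add: matrix_add_ldistrib matrix_scalar_ac scalar_matrix_assoc)
  moreover have "(A + B) ** R = A ** R + B ** R" for A B :: "real^'n^'n"
    by (simp add: vec_eq_iff matrix_matrix_mult_def algebra_simps sum.distrib)
  ultimately show ?thesis by (simp add: scalar_matrix_assoc)
qed

lemma matrix_conj_one:
  fixes Q :: "real^'n^'n"
  shows "orthogonal_matrix Q \<Longrightarrow> Q ** mat 1 ** transpose Q = mat 1"
  by (simp add: orthogonal_matrix_def)

lemma hsig_orthogonal:
  assumes "orthogonal_matrix Q"
  shows "hsig k (Q ** M ** transpose Q) = hsig k M"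
proof -
  have "mat 1 + m *\<^sub>R (Q ** M ** transpose Q) = Q ** (mat 1 + m *\<^sub>R M) ** transpose Q" for m
    unfolding matrix_conj_pencil matrix_conj_one[OF assms] ..
  then have "det (mat 1 + m *\<^sub>R (Q ** M ** transpose Q)) = det (mat 1 + m *\<^sub>R M) * (det Q * det (transpose Q))" for m
    by (simp add: det_mul)
  moreover have "det Q * det (transpose Q) = 1"
    using assms by (metis det_I det_mul orthogonal_matrix_def)
  ultimately show ?thesis by (simp add: hsig_def)
qed

lemma hsig_diag_mat: "hsig k (diag_mat l) = esym k l"
proof -
  have d: "det (mat 1 + s *\<^sub>R diag_mat l) = poly (\<Prod>i\<in>UNIV. [:1, l $ i:]) s" for s
    by (subst det_diagonal) (auto simp: diag_mat_def mat_def poly_prod)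
  have "degree (\<Prod>i\<in>UNIV. [:1, l $ i:]) \<le> CARD('a)"
  proof -
    have "degree (\<Prod>i\<in>UNIV. [:1, l $ i:]) \<le> sum (degree \<circ> (\<lambda>i. [:1, l $ i:])) UNIV"
      by (rule degree_prod_sum_le) simp
    also have "\<dots> \<le> (\<Sum>i\<in>(UNIV::'a set). 1)" by (intro sum_mono) auto
    finally show ?thesis by simp
  qed
  from hsig_eq_coeff[OF this d[symmetric]] show ?thesis by (simp add: esym_eq_coeff)
qed

text \<open>The derivative of e_(k+1) in one variable is e_k of the remaining ones, hence the index
  \<open>Suc k\<close> against the coefficient k.\<close>

lemma hsig_grad_diag_mat:
  "hsig_grad (Suc k) (diag_mat l) $ i $ j =
     (if i = j then coeff (\<Prod>k\<in>UNIV - {i}. [:1, l $ k:]) k else 0)"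
  for l :: "real^'n"
proof -
  have p: "mat 1 + m *\<^sub>R diag_mat l = diag_mat (\<chi> i. 1 + m * l $ i)" for m
    by (auto simp: vec_eq_iff mat_def diag_mat_def)
  show ?thesis
  proof (cases "i = j")
    case False then show ?thesis by (simp add: hsig_grad_entry p cof_diag_mat)
  next
    case True
    \<comment> \<open>Multiplication by X accounts for the factor \<open>real m\<close> in the node
      weights and moves the coefficient k to place \<open>Suc k\<close>.\<close>
    define q where "q = pCons 0 (\<Prod>k\<in>UNIV - {i}. [:1, l $ k:])"
    have "degree (\<Prod>k\<in>UNIV - {i}. [:1, l $ k:]) \<le> CARD('n) - 1"
    proof -
      have "degree (\<Prod>k\<in>UNIV - {i}. [:1, l $ k:]) \<le> sum (degree \<circ> (\<lambda>i. [:1, l $ i:])) (UNIV - {i})"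
        by (rule degree_prod_sum_le) simp
      also have "\<dots> \<le> (\<Sum>i\<in>(UNIV - {i}). 1)" by (intro sum_mono) auto
      finally show ?thesis by (simp add: card_Diff_singleton)
    qed
    moreover have "CARD('n) > 0" by simp
    ultimately have "degree q \<le> CARD('n)"
      using degree_pCons_le[of 0 "\<Prod>k\<in>UNIV - {i}. [:1, l $ k:]"] unfolding q_def by linarith
    have "hsig_grad (Suc k) (diag_mat l) $ i $ i = (\<Sum>m\<le>CARD('n). lagrange_coeff CARD('n) (Suc k) m * poly q (real m))"
      by (simp add: hsig_grad_entry p cof_diag_mat q_def poly_prod mult.assoc)
    also have "\<dots> = coeff q (Suc k)" by (rule coeff_eq_sum_lagrange[symmetric]) fact
    finally show ?thesis using True by (simp add: q_def)
  qed
qed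

text \<open>About the vector chosen by \<open>SOME\<close> only the characteristic polynomial is
  known. Diagonalization shows that a suitable vector exists, and the characteristic polynomial
  determines det(1 + s M), hence each of its coefficients.\<close>

lemma hsig_eq_esym_eigenvalue_vec:
  fixes M :: "real^'n^'n"
  assumes M: "transpose M = M"
  shows "hsig k M = esym k (eigenvalue_vec M)"
proof -
  obtain Q l where Q: "orthogonal_matrix Q" "M = Q ** diag_mat l ** transpose Q"
    using symmetric_diagonalization[OF M] by blast
  have dQ: "det Q * det (transpose Q) = 1"
    using Q(1) by (metis det_I det_mul orthogonal_matrix_def)
  have "det (mat x - M) = (\<Prod>i\<in>UNIV. x - l $ i)" for x
  proof -
    have x: "mat x - N = (- 1) *\<^sub>R (N + (- x) *\<^sub>R mat 1)" for N :: "real^'n^'n"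
      by (simp add: vec_eq_iff mat_def)
    have "Q ** (diag_mat l + (- x) *\<^sub>R mat 1) ** transpose Q = M + (- x) *\<^sub>R mat 1"
      unfolding matrix_conj_pencil matrix_conj_one[OF Q(1)] Q(2) ..
    then have "mat x - M = Q ** (mat x - diag_mat l) ** transpose Q"
      unfolding x by (simp only: matrix_scalar_ac scalar_matrix_assoc[symmetric])
    then have "det (mat x - M) = det (mat x - diag_mat l)" using dQ by (simp add: det_mul)
    also have "\<dots> = (\<Prod>i\<in>UNIV. x - l $ i)"
      by (subst det_diagonal) (auto simp: mat_def diag_mat_def)
    finally show ?thesis .
  qed
  then have ev: "\<forall>x. det (mat x - M) = (\<Prod>i\<in>UNIV. x - eigenvalue_vec M $ i)"
    unfolding eigenvalue_vec_def
    by (rule someI[of "\<lambda>l. \<forall>x. det (mat x - M) = (\<Prod>i\<in>UNIV. x - l $ i)", OF allI])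
  have "det (mat 1 + s *\<^sub>R M) = det (mat 1 + s *\<^sub>R diag_mat (eigenvalue_vec M))" for s
  proof (cases "s = 0")
    case False
    \<comment> \<open>Reversal of the characteristic polynomial: 1 + s N is - s times the matrix
      (-1/s) - N, so s = 0 is treated apart.\<close>
    have e: "mat 1 + s *\<^sub>R N = (\<chi> i. (- s) *s (mat (- 1 / s) - N) $ i)" for N :: "real^'n^'n"
      using False by (auto simp: vec_eq_iff mat_def)
    have "det (mat 1 + s *\<^sub>R N) = (- s) ^ CARD('n) * det (mat (- 1 / s) - N)" for N :: "real^'n^'n"
      unfolding e by (subst det_rows_mul) (simp add: vec_lambda_eta)
    moreover have "det (mat x - diag_mat (eigenvalue_vec M)) = (\<Prod>i\<in>UNIV. x - eigenvalue_vec M $ i)" for x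
      by (subst det_diagonal) (auto simp: mat_def diag_mat_def)
    ultimately show ?thesis using ev by simp
  qed simp
  then have "hsig k M = hsig k (diag_mat (eigenvalue_vec M))" by (simp add: hsig_def)
  then show ?thesis by (simp add: hsig_diag_mat)
qed

section \<open>Ellipticity on the cone\<close>

text \<open>The matrix form of \<open>Gamma_cone\<close>, phrased by \<open>hsig\<close> so that no
  eigenvalues have to be chosen. Symmetry is built in because diagonalization rests on it.\<close>

definition in_cone :: "nat \<Rightarrow> real^'n^'n \<Rightarrow> bool" where
  "in_cone k M \<longleftrightarrow> transpose M = M \<and> (\<forall>j\<in>{1..k}. 0 < hsig j M)"

text \<open>In an eigenbasis T is diagonal, its i-th entry being e_(k-1) of the eigenvalues other
  than the i-th, and these entries are positive by the Newton argument.\<close>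

lemma hsig_grad_nonneg:
  fixes M :: "real^'n^'n"
  assumes "in_cone k M" "1 \<le> k"
  shows "0 \<le> v \<bullet> (hsig_grad k M *v v)"
proof -
  obtain k' where k: "k = Suc k'" using assms(2) by (cases k) auto
  have M: "transpose M = M" using assms(1) by (simp add: in_cone_def)
  obtain Q l where Q: "orthogonal_matrix Q" "M = Q ** diag_mat l ** transpose Q"
    using symmetric_diagonalization[OF M] by blast
  let ?D = "diag_mat l" and ?w = "transpose Q *v v"
  have "Q ** rank_one ?w ** transpose Q = rank_one v"
  proof -
    have "(Q ** rank_one w ** transpose Q) $ i $ j = (Q *v w) $ i * (Q *v w) $ j" for w i j
    proof -
      have "(Q ** rank_one w) $ i $ l = (Q *v w) $ i * w $ l" for l
        by (simp add: matrix_matrix_mult_def rank_one_def matrix_vector_mult_def sum_distrib_right mult.assoc)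
      then have "(Q ** rank_one w ** transpose Q) $ i $ j = (\<Sum>l\<in>UNIV. (Q *v w) $ i * w $ l * Q $ j $ l)"
        by (simp add: matrix_matrix_mult_def[of "Q ** rank_one w"] transpose_def)
      also have "\<dots> = (Q *v w) $ i * (\<Sum>l\<in>UNIV. Q $ j $ l * w $ l)"
        unfolding sum_distrib_left by (intro sum.cong) (auto simp: mult_ac)
      finally show ?thesis by (simp add: matrix_vector_mult_def)
    qed
    moreover have "Q *v ?w = v"
      using Q(1) unfolding matrix_vector_mul_assoc orthogonal_matrix_def by simp
    ultimately show ?thesis by (simp add: vec_eq_iff rank_one_def)
  qed
  \<comment> \<open>The quadratic form of T is carried to the eigenbasis without conjugating T
    itself: sigma_k is orthogonally invariant and affine in the rank-one term, so v . T v appears as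
    a difference of two invariant quantities.\<close>
  then have "M + 1 *\<^sub>R rank_one v = Q ** (?D + 1 *\<^sub>R rank_one ?w) ** transpose Q"
    unfolding Q(2) matrix_conj_pencil by simp
  then have "hsig k (M + 1 *\<^sub>R rank_one v) = hsig k (?D + 1 *\<^sub>R rank_one ?w)"
    by (simp add: hsig_orthogonal[OF Q(1)])
  moreover have hs: "hsig j M = hsig j ?D" for j unfolding Q(2) by (rule hsig_orthogonal[OF Q(1)])
  ultimately have "v \<bullet> (hsig_grad k M *v v) = ?w \<bullet> (hsig_grad k ?D *v ?w)"
    by (simp only: hsig_add_rank_one)
  also have "\<dots> = (\<Sum>i\<in>UNIV. coeff (\<Prod>k\<in>UNIV - {i}. [:1, l $ k:]) k' * (?w $ i)\<^sup>2)"
  proof -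
    have "(hsig_grad k ?D *v ?w) $ i = coeff (\<Prod>k\<in>UNIV - {i}. [:1, l $ k:]) k' * ?w $ i" for i
    proof -
      have "(hsig_grad k ?D *v ?w) $ i =
          (\<Sum>j\<in>UNIV. if i = j then coeff (\<Prod>k\<in>UNIV - {i}. [:1, l $ k:]) k' * ?w $ j else 0)"
        unfolding k matrix_vector_mult_def vec_lambda_beta hsig_grad_diag_mat by (intro sum.cong) auto
      then show ?thesis by simp
    qed
    then show ?thesis unfolding inner_vec_def inner_real_def
      by (intro sum.cong refl) (simp only: power2_eq_square mult_ac)
  qed
  also have "\<dots> \<ge> 0"
  proof (intro sum_nonneg mult_nonneg_nonneg)
    fix i
    have "coeff (\<Prod>k\<in>UNIV. [:1, l $ k:]) j > 0" if "j \<in> {1..k}" for j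
      using assms(1) that by (simp add: in_cone_def hs hsig_diag_mat esym_eq_coeff)
    then show "0 \<le> coeff (\<Prod>k\<in>UNIV - {i}. [:1, l $ k:]) k'"
      using coeff_prod_linear_remove_pos[of UNIV i k "\<lambda>i. l $ i" k'] k by fastforce
  qed simp
  finally show ?thesis .
qed

lemma transpose_rank_one: "transpose (rank_one v) = rank_one v"
  by (simp add: vec_eq_iff transpose_def rank_one_def)

text \<open>M lies in the cone of every order j <= k, so each affine function sigma_j(M + c v v^T)
  of c has nonnegative slope.\<close>

lemma in_cone_add_rank_one:
  assumes "in_cone k M" "0 \<le> c"
  shows "in_cone k (M + c *\<^sub>R rank_one v)" "j \<in> {1..k} \<Longrightarrow> hsig j M \<le> hsig j (M + c *\<^sub>R rank_one v)"
proof -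
  have le: "hsig j M \<le> hsig j (M + c *\<^sub>R rank_one v)" if "j \<in> {1..k}" for j
  proof -
    have "in_cone j M" using assms(1) that by (auto simp: in_cone_def)
    then have "0 \<le> v \<bullet> (hsig_grad j M *v v)" using that by (intro hsig_grad_nonneg) auto
    then show ?thesis using assms(2) by (simp add: hsig_add_rank_one)
  qed
  have "transpose (M + c *\<^sub>R rank_one v) = M + c *\<^sub>R rank_one v"
    using assms(1) transpose_rank_one[of v] by (simp add: in_cone_def vec_eq_iff transpose_def)
  then show "in_cone k (M + c *\<^sub>R rank_one v)" using assms(1) le unfolding in_cone_def
    by (auto intro: less_le_trans)
  show "j \<in> {1..k} \<Longrightarrow> hsig j M \<le> hsig j (M + c *\<^sub>R rank_one v)" by (rule le)
qed

lemma psd_rank_one_decomposition: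
  fixes N :: "real^'n^'n"
  assumes "psd N"
  obtains l :: "real^'n" and b :: "'n \<Rightarrow> real^'n" where "\<And>i. 0 \<le> l $ i" "N = (\<Sum>i\<in>UNIV. l $ i *\<^sub>R rank_one (b i))"
proof -
  have N: "transpose N = N" using assms by (simp add: psd_def)
  obtain Q l where Q: "orthogonal_matrix Q" "N = Q ** diag_mat l ** transpose Q"
    "\<And>j. N *v column j Q = l $ j *\<^sub>R column j Q" by (rule symmetric_diagonalization[OF N]) (rule that)
  have "0 \<le> l $ j" for j
  proof -
    have "column j Q \<bullet> column j Q = (transpose Q ** Q) $ j $ j"
      by (simp add: column_def inner_vec_def matrix_matrix_mult_def transpose_def)
    also have "\<dots> = 1" using Q(1) unfolding orthogonal_matrix by (simp add: mat_def)
    finally have "column j Q \<bullet> column j Q = 1" .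
    moreover have "0 \<le> column j Q \<bullet> (N *v column j Q)" using assms by (simp add: psd_def)
    ultimately show ?thesis by (simp add: Q(3))
  qed
  moreover have "N = (\<Sum>i\<in>UNIV. l $ i *\<^sub>R rank_one (column i Q))"
  proof -
    have 1: "(Q ** diag_mat l) $ i $ m = l $ m * Q $ i $ m" for i m
    proof -
      have "(Q ** diag_mat l) $ i $ m = (\<Sum>k\<in>UNIV. if k = m then l $ k * Q $ i $ k else 0)"
        unfolding matrix_matrix_mult_def vec_lambda_beta diag_mat_def by (intro sum.cong) auto
      then show ?thesis by simp
    qed
    have "N $ i $ j = (\<Sum>m\<in>UNIV. l $ m * Q $ i $ m * Q $ j $ m)" for i j
      unfolding Q(2) matrix_matrix_mult_def[of "Q ** diag_mat l"] vec_lambda_beta 1 transpose_def ..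
    then show ?thesis by (simp add: vec_eq_iff sum_component rank_one_def column_def mult.assoc)
  qed
  ultimately show ?thesis by (rule that)
qed

text \<open>The psd matrix is added as a sum of rank-one terms. Cone membership travels through the
  induction together with monotonicity, since the sign of each next slope rests on it.\<close>

lemma in_cone_add_psd:
  assumes "in_cone k M" "psd N"
  shows "in_cone k (M + N)" "j \<in> {1..k} \<Longrightarrow> hsig j M \<le> hsig j (M + N)"
proof -
  obtain l :: "real^'a" and b :: "'a \<Rightarrow> real^'a" where N: "\<And>i. 0 \<le> l $ i" "N = (\<Sum>i\<in>UNIV. l $ i *\<^sub>R rank_one (b i))"
    using psd_rank_one_decomposition[OF assms(2)] by blast
  have *: "in_cone k (M + (\<Sum>i\<in>I. l $ i *\<^sub>R rank_one (b i))) \<and>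
     (\<forall>j\<in>{1..k}. hsig j M \<le> hsig j (M + (\<Sum>i\<in>I. l $ i *\<^sub>R rank_one (b i))))" if "finite I" for I
    using that
  proof (induction I rule: finite_induct)
    case empty then show ?case using assms by simp
  next
    case (insert i I)
    let ?M = "M + (\<Sum>i\<in>I. l $ i *\<^sub>R rank_one (b i))"
    have e: "M + (\<Sum>i\<in>insert i I. l $ i *\<^sub>R rank_one (b i)) = ?M + l $ i *\<^sub>R rank_one (b i)"
      using insert by (simp add: algebra_simps)
    have c: "in_cone k ?M" using insert by simp
    show ?case unfolding e
    proof (intro conjI ballI)
      show "in_cone k (?M + l $ i *\<^sub>R rank_one (b i))" by (rule in_cone_add_rank_one(1)[OF c N(1)])
      fix j assume j: "j \<in> {1..k}"
      have "hsig j M \<le> hsig j ?M" using insert.IH j by blast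
      also have "\<dots> \<le> hsig j (?M + l $ i *\<^sub>R rank_one (b i))"
        by (rule in_cone_add_rank_one(2)[OF c N(1) j])
      finally show "hsig j M \<le> hsig j (?M + l $ i *\<^sub>R rank_one (b i))" .
    qed
  qed
  show "in_cone k (M + N)" "j \<in> {1..k} \<Longrightarrow> hsig j M \<le> hsig j (M + N)"
    using *[of UNIV] by (auto simp: N(2))
qed

lemma frob_hsig_grad_psd_nonneg:
  assumes "in_cone k M" "1 \<le> k" "psd N"
  shows "0 \<le> frob (hsig_grad k M) N"
proof -
  obtain l :: "real^'a" and b :: "'a \<Rightarrow> real^'a" where N: "\<And>i. 0 \<le> l $ i" "N = (\<Sum>i\<in>UNIV. l $ i *\<^sub>R rank_one (b i))"
    using psd_rank_one_decomposition[OF assms(3)] by blast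
  show ?thesis unfolding N(2) frob_sum_right frob_scaleR_right frob_rank_one
    by (intro sum_nonneg mult_nonneg_nonneg N(1) hsig_grad_nonneg assms)
qed

lemma hsig_scaleR:
  fixes M :: "real^'n^'n"
  shows "hsig k (c *\<^sub>R M) = c ^ k * hsig k M"
proof -
  obtain p where p: "degree p \<le> CARD('n)" "\<And>s. poly p s = det (mat 1 + s *\<^sub>R M)"
    using det_pencil_poly by blast
  have "poly (p \<circ>\<^sub>p [:0, c:]) s = det (mat 1 + s *\<^sub>R (c *\<^sub>R M))" for s
    by (simp add: poly_pcompose p(2))
  moreover have "degree (p \<circ>\<^sub>p [:0, c:]) \<le> CARD('n)"
    using p(1) degree_pcompose_le[of p "[:0, c:]"] by (auto split: if_splits)
  ultimately have "hsig k (c *\<^sub>R M) = coeff (p \<circ>\<^sub>p [:0, c:]) k" by (intro hsig_eq_coeff)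
  also have "\<dots> = c ^ k * coeff p k" by (simp add: coeff_pcompose_linear)
  finally show ?thesis using hsig_eq_coeff[OF p] by simp
qed

lemma in_cone_scaleR: "in_cone k M \<Longrightarrow> 0 < c \<Longrightarrow> in_cone k (c *\<^sub>R M)"
  by (auto simp: in_cone_def hsig_scaleR transpose_def vec_eq_iff)

section \<open>Smooth functions\<close>

lemma Ck_on_cong:
  assumes "open U" "\<And>x. x \<in> U \<Longrightarrow> f x = g x" "Ck_on m U f"
  shows "Ck_on m U g"
  using assms
proof (induction m arbitrary: f g)
  case 0 then show ?case by (simp cong: continuous_on_cong)
next
  case (Suc m)
  obtain f' where f': "\<forall>x\<in>U. (f has_derivative f' x) (at x)" "\<forall>v. Ck_on m U (\<lambda>x. f' x v)"
    using Suc.prems by auto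
  have "(g has_derivative f' x) (at x)" if "x \<in> U" for x
    by (rule has_derivative_transform_within_open[of f _ _ _ U]) (use f' Suc.prems that in auto)
  then show ?case using f' by auto
qed

lemma Ck_on_Suc_imp: "Ck_on (Suc m) U f \<Longrightarrow> Ck_on m U f"
proof (induction m arbitrary: f)
  case 0
  then show ?case
    by (auto intro!: continuous_at_imp_continuous_on dest: has_derivative_continuous)
next
  case (Suc m)
  then obtain f' where f': "\<forall>x\<in>U. (f has_derivative f' x) (at x)" "\<forall>v. Ck_on (Suc m) U (\<lambda>x. f' x v)"
    by (subst (asm) Ck_on.simps(2)) auto
  then have "\<forall>v. Ck_on m U (\<lambda>x. f' x v)" using Suc.IH by blast
  then show ?case using f'(1) by auto
qed

lemma Ck_on_const: "Ck_on m U (\<lambda>x. c)"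
proof (induction m arbitrary: c)
  case (Suc m)
  have "\<forall>x\<in>U. ((\<lambda>x. c) has_derivative (\<lambda>v. 0)) (at x)" by simp
  then show ?case using Suc by (auto intro!: exI[of _ "\<lambda>x v. 0"])
qed simp

lemma Ck_on_add:
  "Ck_on m U f \<Longrightarrow> Ck_on m U g \<Longrightarrow> Ck_on m U (\<lambda>x. f x + g x)"
proof (induction m arbitrary: f g)
  case 0 then show ?case by (auto intro: continuous_on_add)
next
  case (Suc m)
  obtain f' where f': "\<forall>x\<in>U. (f has_derivative f' x) (at x)" "\<forall>v. Ck_on m U (\<lambda>x. f' x v)"
    using Suc.prems by auto
  obtain g' where g': "\<forall>x\<in>U. (g has_derivative g' x) (at x)" "\<forall>v. Ck_on m U (\<lambda>x. g' x v)"
    using Suc.prems by auto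
  show ?case unfolding Ck_on.simps
    by (rule exI[of _ "\<lambda>x v. f' x v + g' x v"]) (use f' g' Suc.IH in \<open>auto intro: has_derivative_add\<close>)
qed

lemma Ck_on_mult:
  fixes f g :: "'a::real_normed_vector \<Rightarrow> real"
  shows "Ck_on m U f \<Longrightarrow> Ck_on m U g \<Longrightarrow> Ck_on m U (\<lambda>x. f x * g x)"
proof (induction m arbitrary: f g)
  case 0 then show ?case by (auto intro: continuous_on_mult)
next
  case (Suc m)
  obtain f' where f': "\<forall>x\<in>U. (f has_derivative f' x) (at x)" "\<forall>v. Ck_on m U (\<lambda>x. f' x v)"
    using Suc.prems by auto
  obtain g' where g': "\<forall>x\<in>U. (g has_derivative g' x) (at x)" "\<forall>v. Ck_on m U (\<lambda>x. g' x v)"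
    using Suc.prems by auto
  have "Ck_on m U f" "Ck_on m U g" using Suc.prems Ck_on_Suc_imp by blast+
  then have "Ck_on m U (\<lambda>x. f x * g' x v + f' x v * g x)" for v
    using f' g' Suc.IH by (intro Ck_on_add) blast+
  moreover have "\<forall>x\<in>U. ((\<lambda>x. f x * g x) has_derivative (\<lambda>v. f x * g' x v + f' x v * g x)) (at x)"
    using f' g' by (auto intro: has_derivative_mult)
  ultimately show ?case unfolding Ck_on.simps
    by (intro exI[of _ "\<lambda>x v. f x * g' x v + f' x v * g x"]) blast
qed

lemma smooth_on_const: "smooth_on U (\<lambda>x. c)"
  by (simp add: smooth_on_def Ck_on_const)

lemma smooth_on_add: "smooth_on U f \<Longrightarrow> smooth_on U g \<Longrightarrow> smooth_on U (\<lambda>x. f x + g x)"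
  by (simp add: smooth_on_def Ck_on_add)

lemma smooth_on_mult:
  fixes f g :: "'a::real_normed_vector \<Rightarrow> real"
  shows "smooth_on U f \<Longrightarrow> smooth_on U g \<Longrightarrow> smooth_on U (\<lambda>x. f x * g x)"
  by (simp add: smooth_on_def Ck_on_mult)

lemma smooth_on_diff:
  fixes f g :: "'a::real_normed_vector \<Rightarrow> real"
  assumes "smooth_on U f" "smooth_on U g"
  shows "smooth_on U (\<lambda>x. f x - g x)"
  using smooth_on_add[OF assms(1) smooth_on_mult[OF smooth_on_const[of U "-1"] assms(2)]] by simp

lemma smooth_on_sum:
  fixes f :: "'i \<Rightarrow> 'a::real_normed_vector \<Rightarrow> real"
  shows "(\<And>i. i \<in> I \<Longrightarrow> smooth_on U (f i)) \<Longrightarrow> smooth_on U (\<lambda>x. \<Sum>i\<in>I. f i x)"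
  by (induction I rule: infinite_finite_induct) (auto simp: smooth_on_const smooth_on_add)

lemma smooth_on_prod:
  fixes f :: "'i \<Rightarrow> 'a::real_normed_vector \<Rightarrow> real"
  shows "(\<And>i. i \<in> I \<Longrightarrow> smooth_on U (f i)) \<Longrightarrow> smooth_on U (\<lambda>x. \<Prod>i\<in>I. f i x)"
  by (induction I rule: infinite_finite_induct) (auto simp: smooth_on_const smooth_on_mult)

lemma smooth_on_bounded_linear:
  assumes "bounded_linear f" shows "smooth_on U f"
proof -
  have "Ck_on m U f" for m
  proof (cases m)
    case 0 then show ?thesis using assms by (simp add: linear_continuous_on)
  next
    case (Suc m)
    have "\<forall>x\<in>U. (f has_derivative f) (at x)" using assms by (simp add: bounded_linear_imp_has_derivative)
    then show ?thesis unfolding Suc Ck_on.simps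
      by (intro exI[of _ "\<lambda>x. f"]) (auto simp: Ck_on_const)
  qed
  then show ?thesis by (simp add: smooth_on_def)
qed

lemma smooth_on_exp_inner:
  fixes a :: "'a::real_inner"
  shows "smooth_on U (\<lambda>x. exp (a \<bullet> x))"
proof -
  have "Ck_on m U (\<lambda>x. exp (a \<bullet> x))" for m
  proof (induction m)
    case 0 show ?case by (auto intro!: continuous_intros)
  next
    case (Suc m)
    have "\<forall>x\<in>U. ((\<lambda>x. exp (a \<bullet> x)) has_derivative (\<lambda>v. exp (a \<bullet> x) * (a \<bullet> v))) (at x)"
      by (auto intro!: derivative_eq_intros)
    moreover have "Ck_on m U (\<lambda>x. exp (a \<bullet> x) * (a \<bullet> v))" for v
      by (intro Ck_on_mult Suc.IH Ck_on_const)
    ultimately show ?case unfolding Ck_on.simps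
      by (intro exI[of _ "\<lambda>x v. exp (a \<bullet> x) * (a \<bullet> v)"]) blast
  qed
  then show ?thesis by (simp add: smooth_on_def)
qed

lemma Ck_on_subset: "Ck_on m U f \<Longrightarrow> V \<subseteq> U \<Longrightarrow> Ck_on m V f"
proof (induction m arbitrary: f)
  case 0 then show ?case by (auto intro: continuous_on_subset)
next
  case (Suc m)
  then obtain f' where f': "\<forall>x\<in>U. (f has_derivative f' x) (at x)" "\<forall>v. Ck_on m U (\<lambda>x. f' x v)"
    by auto
  then show ?case unfolding Ck_on.simps using Suc by (intro exI[of _ f']) auto
qed

lemma smooth_on_subset: "smooth_on U f \<Longrightarrow> V \<subseteq> U \<Longrightarrow> smooth_on V f"
  by (auto simp: smooth_on_def intro: Ck_on_subset)

lemma smooth_on_continuous: "smooth_on U f \<Longrightarrow> continuous_on U f"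
  unfolding smooth_on_def by (metis Ck_on.simps(1))

section \<open>Partial derivatives, mixed second derivatives and the second-order test\<close>

lemma partial_derivI: "(f has_derivative f') (at x) \<Longrightarrow> partial_deriv i f x = f' (axis i 1)"
  unfolding partial_deriv_def by (simp add: frechet_derivative_at[symmetric])

lemma has_derivative_expand:
  fixes f :: "real^'n \<Rightarrow> real"
  assumes "(f has_derivative f') (at x)"
  shows "f' v = (\<Sum>i\<in>UNIV. v $ i * partial_deriv i f x)"
proof -
  interpret f': bounded_linear f' using assms by (rule has_derivative_bounded_linear)
  have "f' v = f' (\<Sum>i\<in>UNIV. v $ i *\<^sub>R axis i 1)"
    using basis_expansion[of v] by (simp add: scalar_mult_eq_scaleR)
  also have "\<dots> = (\<Sum>i\<in>UNIV. v $ i * partial_deriv i f x)"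
    by (simp add: f'.sum f'.scaleR partial_derivI[OF assms])
  finally show ?thesis .
qed

lemma smooth_on_has_derivative:
  fixes f :: "real^'n \<Rightarrow> real"
  assumes "smooth_on U f" "x \<in> U"
  shows "(f has_derivative (\<lambda>v. \<Sum>i\<in>UNIV. v $ i * partial_deriv i f x)) (at x)"
proof -
  have "Ck_on (Suc 0) U f" using assms(1) by (simp only: smooth_on_def)
  then obtain f' where f': "(f has_derivative f' x) (at x)" using assms(2) by auto
  then have "f' x = (\<lambda>v. \<Sum>i\<in>UNIV. v $ i * partial_deriv i f x)"
    using has_derivative_expand by blast
  with f' show ?thesis by simp
qed

lemma smooth_on_differentiable:
  fixes f :: "real^'n \<Rightarrow> real"
  shows "smooth_on U f \<Longrightarrow> x \<in> U \<Longrightarrow> f differentiable (at x)"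
  using smooth_on_has_derivative differentiable_def by blast

lemma smooth_on_partial_deriv:
  fixes f :: "real^'n \<Rightarrow> real"
  assumes "open U" "smooth_on U f"
  shows "smooth_on U (partial_deriv i f)"
  unfolding smooth_on_def
proof
  fix m
  have "Ck_on (Suc m) U f" using assms(2) by (simp only: smooth_on_def)
  then obtain f' where f': "\<forall>x\<in>U. (f has_derivative f' x) (at x)" "\<forall>v. Ck_on m U (\<lambda>x. f' x v)"
    by auto
  have "f' x (axis i 1) = partial_deriv i f x" if "x \<in> U" for x
    using partial_derivI[of f "f' x" x i] f'(1) that by simp
  then show "Ck_on m U (partial_deriv i f)"
    by (rule Ck_on_cong[OF assms(1), of "\<lambda>x. f' x (axis i 1)"]) (use f' in auto)
qed

lemma partial_deriv_const: "partial_deriv i (\<lambda>x. c) x = 0"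
  by (rule partial_derivI[where f' = "\<lambda>_. 0"]) simp

lemma partial_deriv_add:
  assumes "f differentiable (at x)" "g differentiable (at x)"
  shows "partial_deriv i (\<lambda>x. f x + g x) x = partial_deriv i f x + partial_deriv i g x"
proof -
  obtain f' g' where fg: "(f has_derivative f') (at x)" "(g has_derivative g') (at x)"
    using assms by (auto simp: differentiable_def)
  show ?thesis
    using partial_derivI[OF has_derivative_add[OF fg]] by (simp add: partial_derivI[OF fg(1)] partial_derivI[OF fg(2)])
qed

lemma partial_deriv_mult:
  assumes "f differentiable (at x)" "g differentiable (at x)"
  shows "partial_deriv i (\<lambda>x. f x * g x) x = f x * partial_deriv i g x + partial_deriv i f x * g x"
proof -
  obtain f' g' where fg: "(f has_derivative f') (at x)" "(g has_derivative g') (at x)"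
    using assms by (auto simp: differentiable_def)
  show ?thesis
    using partial_derivI[OF has_derivative_mult[OF fg]] by (simp add: partial_derivI[OF fg(1)] partial_derivI[OF fg(2)])
qed

lemma partial_deriv_cmult:
  assumes "g differentiable (at x)"
  shows "partial_deriv i (\<lambda>x. c * g x) x = c * partial_deriv i g x"
  using partial_deriv_mult[of "\<lambda>x. c" x g i] assms by (simp add: partial_deriv_const)

lemma partial_deriv_diff:
  assumes "f differentiable (at x)" "g differentiable (at x)"
  shows "partial_deriv i (\<lambda>x. f x - g x) x = partial_deriv i f x - partial_deriv i g x"
proof -
  obtain f' g' where fg: "(f has_derivative f') (at x)" "(g has_derivative g') (at x)"
    using assms by (auto simp: differentiable_def)
  show ?thesis
    using partial_derivI[OF has_derivative_diff[OF fg]] by (simp add: partial_derivI[OF fg(1)] partial_derivI[OF fg(2)])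
qed

lemma partial_deriv_sum:
  assumes "finite I" "\<And>j. j \<in> I \<Longrightarrow> f j differentiable (at x)"
  shows "partial_deriv i (\<lambda>x. \<Sum>j\<in>I. f j x) x = (\<Sum>j\<in>I. partial_deriv i (f j) x)"
  using assms
proof (induction I rule: finite_induct)
  case empty then show ?case by (simp add: partial_deriv_const)
next
  case (insert a I)
  have "(\<lambda>x. \<Sum>j\<in>I. f j x) differentiable (at x)"
    by (rule differentiable_sum) (use insert in auto)
  then show ?case using insert by (simp add: partial_deriv_add)
qed

lemma partial_deriv_cong:
  assumes "open U" "x \<in> U" "\<And>y. y \<in> U \<Longrightarrow> f y = g y" "f differentiable (at x)"
  shows "partial_deriv i f x = partial_deriv i g x"
proof -
  obtain f' where f': "(f has_derivative f') (at x)" using assms(4) by (auto simp: differentiable_def)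
  have "(g has_derivative f') (at x)"
    by (rule has_derivative_transform_within_open[OF f' assms(1,2)]) (use assms(3) in auto)
  then show ?thesis using f' by (simp add: partial_derivI)
qed

lemma hessian_cong:
  assumes U: "open U" "x \<in> U" and eq: "\<And>y. y \<in> U \<Longrightarrow> f y = g y" and f: "smooth_on U f"
  shows "hessian f x = hessian g x"
proof -
  have "partial_deriv j f y = partial_deriv j g y" if "y \<in> U" for j y
    by (rule partial_deriv_cong[OF U(1) that eq]) (use f that smooth_on_differentiable in auto)
  then have "partial_deriv i (partial_deriv j f) x = partial_deriv i (partial_deriv j g) x" for i j
    by (rule partial_deriv_cong[OF U])
      (use smooth_on_differentiable[OF smooth_on_partial_deriv[OF U(1) f] U(2)] in auto)
  then show ?thesis by (simp add: hessian_def)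
qed

lemma has_real_derivative_line:
  fixes f :: "real^'n \<Rightarrow> real"
  assumes "smooth_on U f" "p + a *\<^sub>R v \<in> U"
  shows "((\<lambda>s. f (p + s *\<^sub>R v)) has_real_derivative
     (\<Sum>i\<in>UNIV. v $ i * partial_deriv i f (p + a *\<^sub>R v))) (at a within S)"
proof -
  have "((\<lambda>s. p + s *\<^sub>R v) has_derivative (\<lambda>h. h *\<^sub>R v)) (at a within S)"
    by (auto intro!: derivative_eq_intros)
  from has_derivative_compose[OF this smooth_on_has_derivative[OF assms]]
  show ?thesis
    unfolding has_field_derivative_def
    by (rule has_derivative_eq_rhs) (auto simp: fun_eq_iff sum_distrib_left sum_distrib_right algebra_simps)
qed

lemma has_real_derivative_axis:
  fixes f :: "real^'n \<Rightarrow> real"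
  assumes "smooth_on U f" "p + a *\<^sub>R axis i 1 \<in> U"
  shows "((\<lambda>s. f (p + s *\<^sub>R axis i 1)) has_real_derivative partial_deriv i f (p + a *\<^sub>R axis i 1)) (at a)"
proof -
  have "(\<Sum>j\<in>UNIV. axis i 1 $ j * partial_deriv j f y) = partial_deriv i f y" for y
    by (simp add: axis_def if_distrib[of "\<lambda>x. x * _"] cong: if_cong)
  then show ?thesis using has_real_derivative_line[OF assms] by simp
qed

text \<open>Two applications of the mean value theorem, one in each direction, turn the second
  difference into a single value of the mixed derivative.\<close>

lemma mixed_difference_mean_value:
  fixes f :: "real^'n \<Rightarrow> real"
  assumes f: "open U" "smooth_on U f" and s: "0 < s" "ball x (3 * s) \<subseteq> U"
  shows "\<exists>y. dist x y < 3 * s \<and>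
     f (x + s *\<^sub>R axis i 1 + s *\<^sub>R axis j 1) - f (x + s *\<^sub>R axis i 1) - f (x + s *\<^sub>R axis j 1) + f x
       = s\<^sup>2 * partial_deriv j (partial_deriv i f) y"
proof -
  let ?e = "\<lambda>i. axis i 1 :: real^'n"
  \<comment> \<open>The intermediate points are at distance at most 2 s from x; the radius 3 s
    leaves room for the strict inequality.\<close>
  have near: "dist x (x + a *\<^sub>R ?e i + b *\<^sub>R ?e j) < 3 * s" if "0 \<le> a" "a \<le> s" "0 \<le> b" "b \<le> s" for a b i j
  proof -
    have "norm (a *\<^sub>R ?e i + b *\<^sub>R ?e j) \<le> a + b"
      using that by (intro order_trans[OF norm_triangle_ineq]) (simp add: norm_axis_1)
    moreover have "dist x (x + a *\<^sub>R ?e i + b *\<^sub>R ?e j) = norm (a *\<^sub>R ?e i + b *\<^sub>R ?e j)"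
      by (simp add: dist_norm norm_minus_commute algebra_simps)
    ultimately show ?thesis using that s(1) by linarith
  qed
  have inU: "x + a *\<^sub>R ?e i + b *\<^sub>R ?e j \<in> U" if "0 \<le> a" "a \<le> s" "0 \<le> b" "b \<le> s" for a b i j
    using near[OF that] s(2) by auto
  define g where "g a = f ((x + s *\<^sub>R ?e j) + a *\<^sub>R ?e i) - f (x + a *\<^sub>R ?e i)" for a
  have "\<exists>a>0. a < s \<and> g s - g 0 = (s - 0) * (partial_deriv i f ((x + s *\<^sub>R ?e j) + a *\<^sub>R ?e i) - partial_deriv i f (x + a *\<^sub>R ?e i))"
  proof (rule MVT2[OF s(1)])
    fix a assume "0 \<le> a" "a \<le> s"
    then show "(g has_real_derivative (partial_deriv i f ((x + s *\<^sub>R ?e j) + a *\<^sub>R ?e i) - partial_deriv i f (x + a *\<^sub>R ?e i))) (at a)"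
      unfolding g_def using inU[of s a j i] inU[of a 0 i j] s(1)
      by (intro DERIV_diff has_real_derivative_axis[OF f(2)]) auto
  qed
  then obtain a where a: "0 < a" "a < s" "g s - g 0 =
      s * (partial_deriv i f ((x + s *\<^sub>R ?e j) + a *\<^sub>R ?e i) - partial_deriv i f (x + a *\<^sub>R ?e i))" by auto
  have "\<exists>b>0. b < s \<and> partial_deriv i f ((x + a *\<^sub>R ?e i) + s *\<^sub>R ?e j) - partial_deriv i f ((x + a *\<^sub>R ?e i) + 0 *\<^sub>R ?e j)
      = (s - 0) * partial_deriv j (partial_deriv i f) ((x + a *\<^sub>R ?e i) + b *\<^sub>R ?e j)"
  proof (rule MVT2[OF s(1)])
    fix b assume "0 \<le> b" "b \<le> s"
    then show "((\<lambda>b. partial_deriv i f ((x + a *\<^sub>R ?e i) + b *\<^sub>R ?e j)) has_real_derivative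
        partial_deriv j (partial_deriv i f) ((x + a *\<^sub>R ?e i) + b *\<^sub>R ?e j)) (at b)"
      using inU[of a b i j] a by (intro has_real_derivative_axis[OF smooth_on_partial_deriv[OF f]]) auto
  qed
  then obtain b where b: "0 < b" "b < s" "partial_deriv i f ((x + a *\<^sub>R ?e i) + s *\<^sub>R ?e j) - partial_deriv i f (x + a *\<^sub>R ?e i)
      = s * partial_deriv j (partial_deriv i f) ((x + a *\<^sub>R ?e i) + b *\<^sub>R ?e j)" by auto
  have "g s - g 0 = s\<^sup>2 * partial_deriv j (partial_deriv i f) (x + a *\<^sub>R ?e i + b *\<^sub>R ?e j)"
    using a(3) b(3) by (simp add: power2_eq_square add.assoc add.commute add.left_commute)
  moreover have "g s - g 0 = f (x + s *\<^sub>R ?e i + s *\<^sub>R ?e j) - f (x + s *\<^sub>R ?e i) - f (x + s *\<^sub>R ?e j) + f x"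
    by (simp add: g_def add.commute add.left_commute)
  ultimately show ?thesis using near[of a b i j] a b by (intro exI[of _ "x + a *\<^sub>R ?e i + b *\<^sub>R ?e j"]) auto
qed

text \<open>The second difference is symmetric in i and j, while its two evaluations produce the
  mixed derivatives in opposite order; continuity brings both evaluation points back to x.\<close>

lemma partial_deriv_commute:
  fixes f :: "real^'n \<Rightarrow> real"
  assumes f: "open U" "smooth_on U f" and x: "x \<in> U"
  shows "partial_deriv i (partial_deriv j f) x = partial_deriv j (partial_deriv i f) x"
proof (rule ccontr)
  let ?a = "partial_deriv i (partial_deriv j f)" and ?b = "partial_deriv j (partial_deriv i f)"
  assume ne: "?a x \<noteq> ?b x"
  \<comment> \<open>Half the supposed gap: each value moves by less than e, so the gap would be
    smaller than itself.\<close>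
  define e where "e = \<bar>?a x - ?b x\<bar> / 2"
  have e: "e > 0" using ne by (simp add: e_def)
  have "continuous (at x) ?a" "continuous (at x) ?b"
    using smooth_on_continuous[OF smooth_on_partial_deriv[OF f(1) smooth_on_partial_deriv[OF f]]] f(1) x
    by (auto simp: continuous_on_eq_continuous_at)
  then have c: "\<forall>e>0. \<exists>d>0. \<forall>y. dist y x < d \<longrightarrow> dist (?a y) (?a x) < e"
      "\<forall>e>0. \<exists>d>0. \<forall>y. dist y x < d \<longrightarrow> dist (?b y) (?b x) < e"
    unfolding continuous_at_eps_delta by auto
  obtain d1 where d1: "d1 > 0" "\<forall>y. dist y x < d1 \<longrightarrow> dist (?a y) (?a x) < e" using c(1) e by blast
  obtain d2 where d2: "d2 > 0" "\<forall>y. dist y x < d2 \<longrightarrow> dist (?b y) (?b x) < e" using c(2) e by blast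
  obtain r where r: "r > 0" "ball x r \<subseteq> U" using f(1) x open_contains_ball by blast
  define s where "s = min r (min d1 d2) / 3"
  have s: "s > 0" "3 * s \<le> r" "3 * s \<le> d1" "3 * s \<le> d2" using r d1 d2 by (auto simp: s_def)
  then have b: "ball x (3 * s) \<subseteq> U" using r by auto
  obtain y where y: "dist x y < 3 * s" "f (x + s *\<^sub>R axis i 1 + s *\<^sub>R axis j 1) - f (x + s *\<^sub>R axis i 1) - f (x + s *\<^sub>R axis j 1) + f x
       = s\<^sup>2 * ?b y" using mixed_difference_mean_value[OF f s(1) b, of i j] by blast
  obtain z where z: "dist x z < 3 * s" "f (x + s *\<^sub>R axis j 1 + s *\<^sub>R axis i 1) - f (x + s *\<^sub>R axis j 1) - f (x + s *\<^sub>R axis i 1) + f x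
       = s\<^sup>2 * ?a z" using mixed_difference_mean_value[OF f s(1) b, of j i] by blast
  have sw: "x + s *\<^sub>R axis j 1 + s *\<^sub>R axis i 1 = x + s *\<^sub>R axis i 1 + s *\<^sub>R axis j 1" by simp
  have "s\<^sup>2 * ?a z = s\<^sup>2 * ?b y" using y(2) z(2) unfolding sw by linarith
  then have "?a z = ?b y" using s(1) by simp
  moreover have "\<bar>?a z - ?a x\<bar> < e" "\<bar>?b y - ?b x\<bar> < e"
    using d1(2) d2(2) y(1) z(1) s(3,4) by (simp_all add: dist_commute dist_real_def)
  moreover have "\<bar>?a x - ?b x\<bar> \<le> \<bar>?a z - ?a x\<bar> + \<bar>?b y - ?b x\<bar>"
    using abs_triangle_ineq4[of "?a z - ?a x" "?b y - ?b x"] \<open>?a z = ?b y\<close>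
    by (simp add: abs_minus_commute)
  ultimately have "\<bar>?a x - ?b x\<bar> < e + e" by linarith
  then show False by (simp add: e_def)
qed

lemma transpose_hessian:
  fixes f :: "real^'n \<Rightarrow> real"
  assumes "open U" "smooth_on U f" "x \<in> U"
  shows "transpose (hessian f x) = hessian f x"
  using partial_deriv_commute[OF assms] by (simp add: hessian_def transpose_def vec_eq_iff)

text \<open>Second-order test along each line through x. A negative second derivative would make the
  first derivative negative just to the right of 0, and the function would drop below its
  minimum.\<close>

lemma hessian_psd_at_local_min:
  fixes f :: "real^'n \<Rightarrow> real"
  assumes f: "open U" "smooth_on U f" and x: "x \<in> U" and min: "\<And>y. y \<in> U \<Longrightarrow> f x \<le> f y"
  shows "psd (hessian f x)"
  unfolding psd_def
proof (intro conjI allI)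
  show "transpose (hessian f x) = hessian f x" by (rule transpose_hessian) fact+
  fix v :: "real^'n"
  define g where "g s = f (x + s *\<^sub>R v)" for s
  define g' where "g' s = (\<Sum>i\<in>UNIV. v $ i * partial_deriv i f (x + s *\<^sub>R v))" for s
  have "continuous_on UNIV (\<lambda>s. x + s *\<^sub>R v)" by (intro continuous_intros)
  then have "open ((\<lambda>s. x + s *\<^sub>R v) -` U)" using f(1) by (simp add: open_vimage)
  moreover have "0 \<in> (\<lambda>s. x + s *\<^sub>R v) -` U" using x by simp
  ultimately obtain r where r: "r > 0" "ball 0 r \<subseteq> (\<lambda>s. x + s *\<^sub>R v) -` U"
    using open_contains_ball by blast
  have inU: "x + s *\<^sub>R v \<in> U" if "\<bar>s\<bar> < r" for s using r(2) that by (auto simp: subset_eq)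
  have dg: "(g has_real_derivative g' s) (at s)" if "\<bar>s\<bar> < r" for s
    unfolding g_def g'_def by (rule has_real_derivative_line[OF f(2) inU[OF that]])
  have "(g' has_real_derivative (\<Sum>i\<in>UNIV. v $ i * (\<Sum>j\<in>UNIV. v $ j * partial_deriv j (partial_deriv i f) (x + 0 *\<^sub>R v)))) (at 0)"
    unfolding g'_def
    by (intro DERIV_sum DERIV_cmult has_real_derivative_line[OF smooth_on_partial_deriv[OF f]]) (use x in simp)
  also have "(\<Sum>i\<in>UNIV. v $ i * (\<Sum>j\<in>UNIV. v $ j * partial_deriv j (partial_deriv i f) (x + 0 *\<^sub>R v)))
      = v \<bullet> (hessian f x *v v)"
    by (simp add: inner_vec_def matrix_vector_mult_def hessian_def sum_distrib_left partial_deriv_commute[OF f x] algebra_simps)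
  finally have dg': "(g' has_real_derivative (v \<bullet> (hessian f x *v v))) (at 0)" .
  have g0: "g' 0 = 0"
    by (rule DERIV_local_min[OF dg[of 0] r(1)]) (use r(1) min inU in \<open>auto simp: g_def\<close>)
  show "0 \<le> v \<bullet> (hessian f x *v v)"
  proof (rule ccontr)
    assume "\<not> 0 \<le> v \<bullet> (hessian f x *v v)"
    then obtain d where d: "d > 0" "\<And>h. h > 0 \<Longrightarrow> h < d \<Longrightarrow> g' (0 + h) < g' 0"
      using DERIV_neg_dec_right[OF dg'] by (auto simp: not_le)
    define s where "s = min r d / 2"
    have s: "s > 0" "s < r" "s < d" using r d by (auto simp: s_def)
    obtain z where z: "z > 0" "z < s" "g s - g 0 = (s - 0) * g' z"
      using MVT2[OF s(1), of g g'] dg s by auto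
    have "g' z < 0" using d(2)[of z] z s g0 by auto
    then have "s * g' z < 0" using s(1) by (rule mult_pos_neg[rotated])
    then have "g s < g 0" using z(3) by simp
    moreover have "g 0 \<le> g s" using min[OF inU[of s]] s by (simp add: g_def)
    ultimately show False by simp
  qed
qed

section \<open>Integration over convex domains\<close>

lemma set_integrable_continuous_closure:
  fixes f :: "real^'n \<Rightarrow> real"
  assumes "open \<Omega>" "bounded \<Omega>" "continuous_on (closure \<Omega>) f"
  shows "set_integrable lborel \<Omega> f"
proof -
  have "set_integrable lborel (closure \<Omega>) f"
    unfolding set_integrable_def by (rule borel_integrable_compact) (use assms in \<open>auto simp: compact_closure\<close>)
  then show ?thesis by (rule set_integrable_subset) (use assms(1) closure_subset in auto)
qed

lemma lipschitz_on_compact_convex: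
  fixes X :: "real^'n \<Rightarrow> real"
  assumes "compact K" "convex K" "open U" "K \<subseteq> U" "smooth_on U X"
  obtains L where "0 \<le> L" "\<And>x y. x \<in> K \<Longrightarrow> y \<in> K \<Longrightarrow> \<bar>X x - X y\<bar> \<le> L * norm (x - y)"
proof -
  have "\<exists>b\<ge>0. \<forall>x\<in>K. \<bar>partial_deriv i X x\<bar> \<le> b" for i
  proof -
    have "continuous_on K (partial_deriv i X)"
      using smooth_on_continuous[OF smooth_on_partial_deriv[OF assms(3,5)]] assms(4) continuous_on_subset by blast
    then have "bounded (partial_deriv i X ` K)"
      using assms(1) compact_continuous_image compact_imp_bounded by blast
    then obtain b where "b > 0" "\<forall>y\<in>partial_deriv i X ` K. norm y \<le> b" using bounded_pos by blast
    then show ?thesis by (intro exI[of _ b]) auto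
  qed
  then obtain b where b: "\<And>i. b i \<ge> 0" "\<And>i x. x \<in> K \<Longrightarrow> \<bar>partial_deriv i X x\<bar> \<le> b i" by metis
  define L where "L = (\<Sum>i\<in>UNIV. b i)"
  have "norm (X x - X y) \<le> L * norm (x - y)" if "x \<in> K" "y \<in> K" for x y
  proof (rule differentiable_bound[OF assms(2) _ _ that])
    fix z assume z: "z \<in> K"
    show "(X has_derivative (\<lambda>v. \<Sum>i\<in>UNIV. v $ i * partial_deriv i X z)) (at z within K)"
      using smooth_on_has_derivative[OF assms(5)] z assms(4) has_derivative_at_withinI by blast
    show "onorm (\<lambda>v. \<Sum>i\<in>UNIV. v $ i * partial_deriv i X z) \<le> L"
    proof (rule onorm_le)
      fix v :: "real^'n"
      have "norm (\<Sum>i\<in>UNIV. v $ i * partial_deriv i X z) \<le> (\<Sum>i\<in>UNIV. norm v * b i)"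
      proof (rule sum_norm_le)
        fix i
        show "norm (v $ i * partial_deriv i X z) \<le> norm v * b i"
          using component_le_norm_cart[of v i] b(2)[of z i] z b(1)[of i] by (simp add: abs_mult mult_mono)
      qed
      then show "norm (\<Sum>i\<in>UNIV. v $ i * partial_deriv i X z) \<le> L * norm v"
        by (simp add: L_def sum_distrib_left[symmetric] mult.commute)
    qed
  qed
  moreover have "L \<ge> 0" unfolding L_def by (rule sum_nonneg) (rule b)
  ultimately show ?thesis using that by auto
qed

text \<open>Extended by zero, the function is Lipschitz, so its difference quotients, whose integrals
  vanish by translation invariance, converge dominatedly to the derivative.\<close>

lemma integral_partial_deriv_zero:
  fixes X :: "real^'n \<Rightarrow> real"
  assumes Om: "open \<Omega>" "convex \<Omega>" "bounded \<Omega>"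
    and U: "open U" "closure \<Omega> \<subseteq> U" "smooth_on U X"
    and zero: "\<And>x. x \<in> frontier \<Omega> \<Longrightarrow> X x = 0"
  shows "(LINT x:\<Omega>|lborel. partial_deriv i X x) = 0"
proof -
  define K where "K = closure \<Omega>"
  have K: "compact K" "convex K" "K \<subseteq> U" "closed K"
    using Om U by (auto simp: K_def compact_closure convex_closure)
  obtain L where L: "0 \<le> L" "\<And>x y. x \<in> K \<Longrightarrow> y \<in> K \<Longrightarrow> \<bar>X x - X y\<bar> \<le> L * norm (x - y)"
    using lipschitz_on_compact_convex[OF K(1,2) U(1) K(3) U(3)] by blast
  define G where "G x = indicator K x *\<^sub>R X x" for x
  have G_in: "G x = X x" if "x \<in> K" for x using that by (simp add: G_def)
  have G_out: "G x = 0" if "x \<notin> K" for x using that by (simp add: G_def)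
  have contX: "continuous_on K X"
    using smooth_on_continuous[OF U(3)] K(3) continuous_on_subset by blast
  have intG: "integrable lborel G"
    unfolding G_def by (rule borel_integrable_compact[OF K(1) contX])
  \<comment> \<open>A segment leaving K crosses the frontier of the domain, where X vanishes, so the
    Lipschitz bound on the inner piece of the segment suffices.\<close>
  have mixed: "\<bar>G x\<bar> \<le> L * norm (x - y)" if "x \<in> K" "y \<notin> K" for x y
  proof -
    have "closed_segment x y \<inter> frontier K \<noteq> {}"
      by (rule connected_Int_frontier) (use that in auto)
    then obtain z where z: "z \<in> closed_segment x y" "z \<in> frontier K" by blast
    have "\<Omega> \<subseteq> interior K" unfolding K_def by (rule interior_maximal[OF closure_subset Om(1)])
    then have "z \<in> frontier \<Omega>"
      using z(2) by (auto simp: K_def frontier_def interior_open[OF Om(1)])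
    then have "X z = 0" "z \<in> K" using zero by (auto simp: K_def frontier_def)
    then have "\<bar>G x\<bar> \<le> L * norm (x - z)" using L(2)[OF that(1), of z] that by (simp add: G_in)
    also have "\<dots> \<le> L * norm (x - y)"
      using segment_bound(1)[OF z(1)] L(1) by (intro mult_left_mono) (auto simp: norm_minus_commute)
    finally show ?thesis .
  qed
  have GL: "\<bar>G x - G y\<bar> \<le> L * norm (x - y)" for x y
    using L(1) L(2)[of x y] mixed[of x y] mixed[of y x]
    by (cases "x \<in> K"; cases "y \<in> K") (auto simp: G_in G_out norm_minus_commute)
  obtain R where R: "R > 0" "\<And>x. x \<in> K \<Longrightarrow> norm x \<le> R"
    using compact_imp_bounded[OF K(1)] bounded_pos by blast
  let ?e = "axis i 1 :: real^'n"
  define s where "s n = inverse (real (Suc n))" for n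
  have s: "0 < s n" "s n \<le> 1" for n by (auto simp: s_def inverse_le_1_iff)
  have s0: "s \<longlonglongrightarrow> 0" unfolding s_def by (rule LIMSEQ_inverse_real_of_nat)
  define q where "q n x = (G (s n *\<^sub>R ?e + x) - G x) / s n" for n x
  define g where "g x = indicator \<Omega> x *\<^sub>R partial_deriv i X x" for x
  \<comment> \<open>The shifts have length at most 1, so all difference quotients live in the ball
    of radius R + 1, where the Lipschitz constant bounds them.\<close>
  define w where "w x = indicator (cball 0 (R + 1)) x * L" for x :: "real^'n"
  have Gb[measurable]: "G \<in> borel_measurable borel" using intG by simp
  have shift: "integrable lborel (\<lambda>x. G (c + x))" "(\<integral>x. G (c + x) \<partial>lborel) = (\<integral>x. G x \<partial>lborel)" for c
  proof -
    have "integrable (distr lborel borel ((+) c)) G" using intG by (simp add: lborel_distr_plus)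
    then show "integrable lborel (\<lambda>x. G (c + x))" by (subst (asm) integrable_distr_eq) auto
    have "(\<integral>x. G x \<partial>lborel) = (\<integral>x. G x \<partial>distr lborel borel ((+) c))" by (simp add: lborel_distr_plus)
    also have "\<dots> = (\<integral>x. G (c + x) \<partial>lborel)" by (subst integral_distr) auto
    finally show "(\<integral>x. G (c + x) \<partial>lborel) = (\<integral>x. G x \<partial>lborel)" ..
  qed
  have q0: "(\<integral>x. q n x \<partial>lborel) = 0" for n
    unfolding q_def using shift[of "s n *\<^sub>R ?e"] intG by simp
  have lim: "(\<lambda>n. \<integral>x. q n x \<partial>lborel) \<longlonglongrightarrow> (\<integral>x. g x \<partial>lborel)"
  proof (rule integral_dominated_convergence[where w = w])
    have "continuous_on (closure \<Omega>) (partial_deriv i X)"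
      using smooth_on_continuous[OF smooth_on_partial_deriv[OF U(1,3)]] U(2) continuous_on_subset by blast
    from set_integrable_continuous_closure[OF Om(1,3) this]
    show "g \<in> borel_measurable lborel" unfolding g_def set_integrable_def by simp
    show "q n \<in> borel_measurable lborel" for n unfolding q_def by measurable
    show "integrable lborel w" unfolding w_def
      by (intro integrable_mult_left integrable_real_indicator)
        (use emeasure_bounded_finite[OF bounded_cball, of "0 :: real^'n" "R + 1"] in auto)
    show "AE x in lborel. norm (q n x) \<le> w x" for n
    proof (rule AE_I2)
      fix x
      show "norm (q n x) \<le> w x"
      proof (cases "x \<in> cball 0 (R + 1)")
        case True
        have "\<bar>G (s n *\<^sub>R ?e + x) - G x\<bar> \<le> L * s n"
          using GL[of "s n *\<^sub>R ?e + x" x] s[of n] by (simp add: norm_axis_1)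
        then show ?thesis using True s[of n] by (simp add: q_def w_def divide_le_eq)
      next
        case False
        then have nx: "norm x > R + 1" by simp
        have "norm x \<le> norm (s n *\<^sub>R ?e + x) + norm (s n *\<^sub>R ?e)"
          using norm_triangle_ineq4[of "s n *\<^sub>R ?e + x" "s n *\<^sub>R ?e"] by simp
        then have "norm (s n *\<^sub>R ?e + x) > R" using nx s[of n] by (simp add: norm_axis_1)
        then have "s n *\<^sub>R ?e + x \<notin> K" using R(2)[of "s n *\<^sub>R ?e + x"] by linarith
        moreover have "x \<notin> K" using R(2)[of x] nx by linarith
        ultimately have "s n *\<^sub>R ?e + x \<notin> K" "x \<notin> K" by blast+
        then show ?thesis using L(1) by (simp add: q_def w_def G_out)
      qed
    qed
    \<comment> \<open>The quotients converge inside the domain and outside its closure; what remains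
      is the frontier of a convex set, which is null.\<close>
    have "frontier \<Omega> \<in> null_sets lborel"
      using negligible_convex_frontier[OF Om(2)]
      by (auto simp: negligible_iff_null_sets null_sets_completion_iff)
    then have "AE x in lborel. x \<notin> frontier \<Omega>" by (rule AE_not_in)
    then show "AE x in lborel. (\<lambda>n. q n x) \<longlonglongrightarrow> g x"
    proof eventually_elim
      case (elim x)
      have lim: "(\<lambda>n. s n *\<^sub>R ?e + x) \<longlonglongrightarrow> x"
        using tendsto_add[OF tendsto_scaleR[OF s0 tendsto_const[of ?e]] tendsto_const[of x]] by simp
      show ?case
      proof (cases "x \<in> \<Omega>")
        case True
        then have xU: "x \<in> U" "x \<in> K" using U closure_subset by (auto simp: K_def)
        have dq: "((\<lambda>h. (X (x + (0 + h) *\<^sub>R ?e) - X (x + 0 *\<^sub>R ?e)) / h) \<longlongrightarrow> partial_deriv i X (x + 0 *\<^sub>R ?e)) (at 0)"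
          using has_real_derivative_axis[OF U(3), of x 0 i] xU unfolding DERIV_def by simp
        have fs: "filterlim s (at 0) sequentially"
          using s0 s(1) by (intro filterlim_atI always_eventually) (auto simp: less_imp_neq[symmetric])
        have "(\<lambda>n. (X (x + s n *\<^sub>R ?e) - X x) / s n) \<longlonglongrightarrow> partial_deriv i X x"
          using filterlim_compose[OF dq fs] by simp
        moreover have "\<forall>\<^sub>F n in sequentially. (X (x + s n *\<^sub>R ?e) - X x) / s n = q n x"
        proof -
          have "\<forall>\<^sub>F n in sequentially. s n *\<^sub>R ?e + x \<in> \<Omega>"
            using topological_tendstoD[OF lim Om(1) True] .
          then show ?thesis
          proof eventually_elim
            case (elim n)
            then have "s n *\<^sub>R ?e + x \<in> K" using closure_subset by (auto simp: K_def)
            then show ?case using xU by (simp add: q_def G_in add.commute)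
          qed
        qed
        ultimately have "(\<lambda>n. q n x) \<longlonglongrightarrow> partial_deriv i X x" by (rule Lim_transform_eventually)
        then show ?thesis using True by (simp add: g_def)
      next
        case False
        then have xK: "x \<notin> K" using elim by (auto simp: K_def frontier_def interior_open[OF Om(1)])
        have "\<forall>\<^sub>F n in sequentially. s n *\<^sub>R ?e + x \<in> - K"
          using topological_tendstoD[OF lim, of "- K"] K(4) xK by (simp add: open_Compl)
        then have "\<forall>\<^sub>F n in sequentially. 0 = q n x"
          by eventually_elim (use xK in \<open>auto simp: q_def G_out\<close>)
        then have "(\<lambda>n. q n x) \<longlonglongrightarrow> 0" by (rule Lim_transform_eventually[OF tendsto_const])
        then show ?thesis using False by (simp add: g_def)
      qed
    qed
  qed
  have "(\<integral>x. g x \<partial>lborel) = 0"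
    by (rule LIMSEQ_unique[OF lim]) (simp only: q0 tendsto_const)
  then show ?thesis by (simp add: g_def set_lebesgue_integral_def)
qed

section \<open>Boundary behaviour\<close>

lemma inner_grad: "v \<bullet> grad f x = (\<Sum>i\<in>UNIV. v $ i * partial_deriv i f x)"
  by (simp add: inner_vec_def grad_def)

lemma has_derivative_grad:
  fixes f :: "real^'n \<Rightarrow> real"
  shows "smooth_on U f \<Longrightarrow> x \<in> U \<Longrightarrow> (f has_derivative (\<lambda>v. v \<bullet> grad f x)) (at x)"
  using smooth_on_has_derivative by (simp add: inner_grad)

lemma has_real_derivative_line_grad:
  fixes f :: "real^'n \<Rightarrow> real"
  assumes "smooth_on U f" "p \<in> U"
  shows "((\<lambda>s. f (p + s *\<^sub>R v)) has_real_derivative v \<bullet> grad f p) (at 0 within S)"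
  using has_real_derivative_line[OF assms(1), of p 0 v] assms(2) by (simp add: inner_grad)

text \<open>By the intermediate value theorem the boundary has points
  \<open>p + s (\<tau> + o(1))\<close> for every tangent vector \<open>\<tau>\<close>.\<close>

lemma tangential_derivative_zero:
  fixes g :: "real^'n \<Rightarrow> real"
  assumes \<rho>: "local_defining_function \<Omega> p V \<rho>" and p: "p \<in> frontier \<Omega>"
    and W: "open W" "p \<in> W" and zero: "\<And>y. y \<in> frontier \<Omega> \<inter> W \<Longrightarrow> g y = 0"
    and g: "(g has_derivative (\<lambda>v. v \<bullet> G)) (at p)"
    and \<tau>: "\<tau> \<bullet> grad \<rho> p = 0"
  shows "\<tau> \<bullet> G = 0"
proof -
  have V: "open V" "p \<in> V" "smooth_on V \<rho>" "grad \<rho> p \<noteq> 0" "frontier \<Omega> \<inter> V = {x\<in>V. \<rho> x = 0}"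
    using \<rho> by (auto simp: local_defining_function_def)
  have \<rho>p: "\<rho> p = 0" using V p by blast
  have gp: "g p = 0" using p W zero by blast
  define N where "N = grad \<rho> p"
  define c where "c = N \<bullet> N"
  have c: "c > 0" using V(4) by (simp add: c_def N_def)
  define D where "D = norm \<tau> + norm N"
  have D: "D > 0" using V(4) by (simp add: D_def N_def add_nonneg_pos)
  have "\<bar>\<tau> \<bullet> G\<bar> \<le> e" if e: "e > 0" for e
  proof -
    \<comment> \<open>Half of e is reserved for the transversal correction r (N . G) with |r| <=
      \<eta>, the other half for the first-order error of g. The summand 1 covers N . G = 0.\<close>
    define \<eta> where "\<eta> = min 1 (e / (2 * (\<bar>N \<bullet> G\<bar> + 1)))"
    have \<eta>: "0 < \<eta>" "\<eta> \<le> 1" using e by (auto simp: \<eta>_def add_nonneg_pos)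
    have "\<eta> * \<bar>N \<bullet> G\<bar> \<le> \<eta> * (\<bar>N \<bullet> G\<bar> + 1)" using \<eta> by (intro mult_left_mono) auto
    also have "\<dots> \<le> e / (2 * (\<bar>N \<bullet> G\<bar> + 1)) * (\<bar>N \<bullet> G\<bar> + 1)"
      by (intro mult_right_mono) (auto simp: \<eta>_def)
    also have "\<dots> = e / 2"
    proof -
      have "e / (2 * X) * X = e / 2" if "X \<noteq> 0" for X :: real using that by simp
      moreover have "\<bar>N \<bullet> G\<bar> + 1 \<noteq> 0" using abs_ge_zero[of "N \<bullet> G"] by linarith
      ultimately show ?thesis by blast
    qed
    finally have \<eta>G: "\<eta> * \<bar>N \<bullet> G\<bar> \<le> e / 2" .
    have small: "0 < \<eta> * c / (2 * D)" "0 < e / (2 * D)" using \<eta> c D e by simp_all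
    have "\<forall>e>0. \<exists>d>0. \<forall>y. norm (y - p) < d \<longrightarrow> norm (\<rho> y - \<rho> p - (y - p) \<bullet> N) \<le> e * norm (y - p)"
      using has_derivative_grad[OF V(3,2)] unfolding has_derivative_at_alt N_def by (rule conjunct2)
    from this[rule_format, OF small(1)]
    obtain d1 where d1: "d1 > 0" "\<And>y. norm (y - p) < d1 \<Longrightarrow>
          \<bar>\<rho> y - \<rho> p - (y - p) \<bullet> N\<bar> \<le> \<eta> * c / (2 * D) * norm (y - p)"
      unfolding real_norm_def by blast
    have "\<forall>e>0. \<exists>d>0. \<forall>y. norm (y - p) < d \<longrightarrow> norm (g y - g p - (y - p) \<bullet> G) \<le> e * norm (y - p)"
      using g unfolding has_derivative_at_alt by (rule conjunct2)
    from this[rule_format, OF small(2)]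
    obtain d2 where d2: "d2 > 0" "\<And>y. norm (y - p) < d2 \<Longrightarrow>
          \<bar>g y - g p - (y - p) \<bullet> G\<bar> \<le> e / (2 * D) * norm (y - p)"
      unfolding real_norm_def by blast
    obtain d3 where d3: "d3 > 0" "ball p d3 \<subseteq> V \<inter> W"
      using open_contains_ball[of "V \<inter> W"] V(1,2) W by blast
    define s where "s = min d1 (min d2 d3) / (2 * D)"
    have s: "s > 0" using d1 d2 d3 D by (simp add: s_def)
    have sD: "s * D < d1" "s * D < d2" "s * D < d3"
      using D d1 d2 d3 by (auto simp: s_def)
    define y where "y r = p + s *\<^sub>R (\<tau> + r *\<^sub>R N)" for r
    have ny: "norm (y r - p) \<le> s * D" if "\<bar>r\<bar> \<le> 1" for r
    proof -
      have "norm (\<tau> + r *\<^sub>R N) \<le> norm \<tau> + \<bar>r\<bar> * norm N"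
        using norm_triangle_ineq[of \<tau> "r *\<^sub>R N"] by simp
      also have "\<dots> \<le> D" using mult_right_mono[OF that, of "norm N"] by (simp add: D_def)
      finally show ?thesis using s by (simp add: y_def)
    qed
    have yVW: "y r \<in> V \<inter> W" if "\<bar>r\<bar> \<le> 1" for r
      using ny[OF that] sD d3 by (auto simp: subset_eq dist_norm norm_minus_commute)
    have yN: "(y r - p) \<bullet> N = s * r * c" for r
      using \<tau> by (simp add: y_def N_def c_def inner_add_left)
    \<comment> \<open>To first order \<rho> (y r) is s r c. As the error is at most half of s \<eta>
      c, the values at r = - \<eta> and r = \<eta> have opposite signs.\<close>
    have est: "\<bar>\<rho> (y r) - s * r * c\<bar> \<le> s * \<eta> * c / 2" if "\<bar>r\<bar> \<le> 1" for r
    proof -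
      have "\<bar>\<rho> (y r) - s * r * c\<bar> \<le> \<eta> * c / (2 * D) * norm (y r - p)"
        using d1(2)[OF le_less_trans[OF ny[OF that] sD(1)]] \<rho>p yN by simp
      also have "\<dots> \<le> \<eta> * c / (2 * D) * (s * D)"
        using ny[OF that] \<eta> c D by (intro mult_left_mono) auto
      also have "\<dots> = s * \<eta> * c / 2"
      proof -
        have "a / (2 * D) * (s * D) = s * a / 2" for a using D by simp
        from this[of "\<eta> * c"] show ?thesis by (simp only: mult.assoc)
      qed
      finally show ?thesis .
    qed
    have pos: "s * \<eta> * c > 0" using s \<eta> c by simp
    have "s * (- \<eta>) * c = - (s * \<eta> * c)" by simp
    then have "\<rho> (y (- \<eta>)) \<le> 0" using est[of "- \<eta>"] \<eta> pos by linarith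
    moreover have "0 \<le> \<rho> (y \<eta>)" using est[of \<eta>] \<eta> pos by linarith
    moreover have "continuous_on {- \<eta>..\<eta>} (\<lambda>r. \<rho> (y r))"
    proof (rule continuous_on_compose2[OF smooth_on_continuous[OF V(3)]])
      show "continuous_on {- \<eta>..\<eta>} y" unfolding y_def by (intro continuous_intros)
      show "y ` {- \<eta>..\<eta>} \<subseteq> V" using yVW \<eta> by auto
    qed
    moreover have "- \<eta> \<le> \<eta>" using \<eta> by simp
    ultimately have "\<exists>r\<ge>- \<eta>. r \<le> \<eta> \<and> \<rho> (y r) = 0"
      by (intro IVT'[of "\<lambda>r. \<rho> (y r)"])
    then obtain r where r: "- \<eta> \<le> r" "r \<le> \<eta>" "\<rho> (y r) = 0" by blast
    then have r1: "\<bar>r\<bar> \<le> 1" "\<bar>r\<bar> \<le> \<eta>" using \<eta> by auto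
    have yr: "y r \<in> V" "y r \<in> W" using yVW[OF r1(1)] by simp_all
    then have "y r \<in> {x\<in>V. \<rho> x = 0}" using r(3) by simp
    then have "y r \<in> frontier \<Omega> \<inter> W" using yr unfolding V(5)[symmetric] by simp
    then have "g (y r) = 0" by (rule zero)
    then have "\<bar>(y r - p) \<bullet> G\<bar> \<le> e / (2 * D) * norm (y r - p)"
      using d2(2)[OF le_less_trans[OF ny[OF r1(1)] sD(2)]] gp by simp
    also have "\<dots> \<le> e / (2 * D) * (s * D)"
      using ny[OF r1(1)] e D by (intro mult_left_mono) auto
    also have "\<dots> = s * (e / 2)" using D by simp
    also have "(y r - p) \<bullet> G = s * (\<tau> \<bullet> G + r * (N \<bullet> G))"
      by (simp add: y_def inner_add_left)
    finally have "\<bar>s * (\<tau> \<bullet> G + r * (N \<bullet> G))\<bar> \<le> s * (e / 2)" .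
    then have "s * \<bar>\<tau> \<bullet> G + r * (N \<bullet> G)\<bar> \<le> s * (e / 2)" using s by (simp only: abs_mult abs_of_pos)
    then have "\<bar>\<tau> \<bullet> G + r * (N \<bullet> G)\<bar> \<le> e / 2" using s by (rule mult_left_le_imp_le)
    moreover have "\<bar>r * (N \<bullet> G)\<bar> \<le> \<eta> * \<bar>N \<bullet> G\<bar>"
      unfolding abs_mult using r1 by (intro mult_right_mono) auto
    ultimately show ?thesis using \<eta>G by linarith
  qed
  from dense_ge[OF this] have "\<bar>\<tau> \<bullet> G\<bar> \<le> 0" .
  then show ?thesis by simp
qed

lemma parallel_if_orthogonal_complement:
  fixes G N :: "'a::real_inner"
  assumes "N \<noteq> 0" "\<And>\<tau>. \<tau> \<bullet> N = 0 \<Longrightarrow> \<tau> \<bullet> G = 0"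
  shows "\<exists>c. G = c *\<^sub>R N"
proof -
  define k where "k = (G \<bullet> N) / (N \<bullet> N)"
  define t where "t = G - k *\<^sub>R N"
  have tN: "t \<bullet> N = 0" using assms(1) by (simp add: t_def k_def inner_diff_left)
  then have "t \<bullet> G = 0" by (rule assms(2))
  then have "t \<bullet> (G - k *\<^sub>R N) = 0" using tN by (simp add: inner_diff_right)
  then have "t = 0" unfolding t_def[symmetric] by simp
  then have "G = k *\<^sub>R N" by (simp add: t_def)
  then show ?thesis ..
qed

lemma grad_parallel_normal:
  fixes g :: "real^'n \<Rightarrow> real"
  assumes "local_defining_function \<Omega> p V \<rho>" "p \<in> frontier \<Omega>"
    and W: "open W" "p \<in> W" "smooth_on W g" "\<And>y. y \<in> frontier \<Omega> \<inter> W \<Longrightarrow> g y = 0"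
  shows "\<exists>c. grad g p = c *\<^sub>R grad \<rho> p"
proof (rule parallel_if_orthogonal_complement)
  show "grad \<rho> p \<noteq> 0" using assms(1) by (auto simp: local_defining_function_def)
  show "\<tau> \<bullet> grad g p = 0" if "\<tau> \<bullet> grad \<rho> p = 0" for \<tau>
    by (rule tangential_derivative_zero[OF assms(1,2) W(1,2) W(4) has_derivative_grad[OF W(3,2)] that])
qed

lemma inward_ray_in_domain:
  assumes \<rho>: "local_defining_function \<Omega> p V \<rho>" and p: "p \<in> frontier \<Omega>" and v: "v \<bullet> grad \<rho> p < 0"
  shows "\<exists>d>0. \<forall>s>0. s < d \<longrightarrow> p + s *\<^sub>R v \<in> \<Omega> \<inter> V"
proof -
  have V: "open V" "p \<in> V" "smooth_on V \<rho>" "frontier \<Omega> \<inter> V = {x\<in>V. \<rho> x = 0}" "\<Omega> \<inter> V = {x\<in>V. \<rho> x < 0}"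
    using \<rho> by (auto simp: local_defining_function_def)
  have \<rho>p: "\<rho> p = 0" using V(2,4) p by blast
  have "\<exists>d>0. \<forall>h>0. h < d \<longrightarrow> \<rho> (p + 0 *\<^sub>R v) > \<rho> (p + (0 + h) *\<^sub>R v)"
    by (rule DERIV_neg_dec_right[OF has_real_derivative_line_grad[OF V(3,2)] v])
  then obtain d where d: "d > 0" "\<And>h. 0 < h \<Longrightarrow> h < d \<Longrightarrow> \<rho> (p + h *\<^sub>R v) < \<rho> p" by auto
  have "continuous_on UNIV (\<lambda>s. p + s *\<^sub>R v)" by (intro continuous_intros)
  then have "open ((\<lambda>s. p + s *\<^sub>R v) -` V)" using V(1) by (simp add: open_vimage)
  moreover have "0 \<in> (\<lambda>s. p + s *\<^sub>R v) -` V" using V by simp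
  ultimately obtain r where r: "r > 0" "ball 0 r \<subseteq> (\<lambda>s. p + s *\<^sub>R v) -` V"
    using open_contains_ball by blast
  have "p + s *\<^sub>R v \<in> \<Omega> \<inter> V" if "0 < s" "s < min d r" for s
  proof -
    have "p + s *\<^sub>R v \<in> V" using r(2) that by (auto simp: subset_eq)
    moreover have "\<rho> (p + s *\<^sub>R v) < 0" using d(2)[of s] that \<rho>p by simp
    ultimately have "p + s *\<^sub>R v \<in> {x\<in>V. \<rho> x < 0}" by simp
    then show ?thesis unfolding V(5)[symmetric] .
  qed
  then show ?thesis using d(1) r(1) by (intro exI[of _ "min d r"]) auto
qed

text \<open>The definition quantifies over all local defining functions, so the choice must not
  matter: a second one vanishes on the frontier, which makes the gradients parallel, and both being
  negative inside excludes opposite directions.\<close>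

lemma outward_normal_eq:
  fixes \<Omega> :: "(real^'n) set"
  assumes \<rho>: "local_defining_function \<Omega> p V \<rho>" and p: "p \<in> frontier \<Omega>"
  shows "outward_normal \<Omega> p = sgn (grad \<rho> p)"
  unfolding outward_normal_def
proof (rule the_equality)
  show "\<exists>U \<rho>'. local_defining_function \<Omega> p U \<rho>' \<and> sgn (grad \<rho> p) = sgn (grad \<rho>' p)" using \<rho> by blast
  fix v assume "\<exists>U \<rho>. local_defining_function \<Omega> p U \<rho> \<and> v = sgn (grad \<rho> p)"
  then obtain V2 \<rho>2 where \<rho>2: "local_defining_function \<Omega> p V2 \<rho>2" and v: "v = sgn (grad \<rho>2 p)" by blast
  have V2: "open V2" "p \<in> V2" "smooth_on V2 \<rho>2" "grad \<rho>2 p \<noteq> 0" "frontier \<Omega> \<inter> V2 = {x\<in>V2. \<rho>2 x = 0}"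
      "\<Omega> \<inter> V2 = {x\<in>V2. \<rho>2 x < 0}"
    using \<rho>2 by (auto simp: local_defining_function_def)
  have N: "grad \<rho> p \<noteq> 0" using \<rho> by (auto simp: local_defining_function_def)
  obtain c where c: "grad \<rho>2 p = c *\<^sub>R grad \<rho> p"
    using grad_parallel_normal[OF \<rho> p V2(1,2,3)] V2(5) by blast
  have "\<not> c < 0"
  proof
    assume "c < 0"
    then have pos: "(- grad \<rho> p) \<bullet> grad \<rho>2 p > 0" using N by (simp add: c mult_less_0_iff)
    have "\<exists>d>0. \<forall>h>0. h < d \<longrightarrow> \<rho>2 (p + 0 *\<^sub>R (- grad \<rho> p)) < \<rho>2 (p + (0 + h) *\<^sub>R (- grad \<rho> p))"
      by (rule DERIV_pos_inc_right[OF has_real_derivative_line_grad[OF V2(3,2)] pos])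
    then obtain d where d: "d > 0" "\<And>h. 0 < h \<Longrightarrow> h < d \<Longrightarrow> \<rho>2 p < \<rho>2 (p + h *\<^sub>R (- grad \<rho> p))"
      by (simp only: scaleR_zero_left add_0_right add_0_left) blast
    have "(- grad \<rho> p) \<bullet> grad \<rho> p < 0" using N by simp
    then obtain d' where d': "d' > 0" "\<forall>s>0. s < d' \<longrightarrow> p + s *\<^sub>R (- grad \<rho> p) \<in> \<Omega> \<inter> V"
      using inward_ray_in_domain[OF \<rho> p] by blast
    have "continuous_on UNIV (\<lambda>s. p + s *\<^sub>R (- grad \<rho> p))" by (intro continuous_intros)
    then have "open ((\<lambda>s. p + s *\<^sub>R (- grad \<rho> p)) -` V2)" using V2(1) by (simp add: open_vimage)
    moreover have "0 \<in> (\<lambda>s. p + s *\<^sub>R (- grad \<rho> p)) -` V2" using V2 by simp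
    ultimately obtain r where r: "r > 0" "ball 0 r \<subseteq> (\<lambda>s. p + s *\<^sub>R (- grad \<rho> p)) -` V2"
      using open_contains_ball by blast
    define s where "s = min d (min d' r) / 2"
    have s: "0 < s" "s < d" "s < d'" "s < r" using d d' r by (auto simp: s_def)
    have "p + s *\<^sub>R (- grad \<rho> p) \<in> V2" using r(2) s by (auto simp: subset_eq)
    moreover have "p + s *\<^sub>R (- grad \<rho> p) \<in> \<Omega>" using d'(2) s by blast
    ultimately have "p + s *\<^sub>R (- grad \<rho> p) \<in> {x\<in>V2. \<rho>2 x < 0}" unfolding V2(6)[symmetric] by blast
    then have "\<rho>2 (p + s *\<^sub>R (- grad \<rho> p)) < 0" by simp
    moreover have "\<rho>2 p = 0" using V2(2,5) p by blast
    moreover have "\<rho>2 p < \<rho>2 (p + s *\<^sub>R (- grad \<rho> p))" by (rule d(2)[OF s(1,2)])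
    ultimately show False by simp
  qed
  then have "c > 0" using c V2(4) by (cases "c = 0") auto
  then show "v = sgn (grad \<rho> p)" by (simp add: v c sgn_scaleR)
qed

text \<open>The inward ray enters the domain, so the one-sided limit sees only points of the
  closure, where the smooth extension F may replace u.\<close>

lemma normal_deriv_eq:
  fixes \<Omega> :: "(real^'n) set"
  assumes \<rho>: "local_defining_function \<Omega> p V \<rho>" and p: "p \<in> frontier \<Omega>"
    and F: "closure \<Omega> \<subseteq> U" "smooth_on U F" "\<And>x. x \<in> closure \<Omega> \<Longrightarrow> F x = u x"
  shows "normal_deriv \<Omega> u p = outward_normal \<Omega> p \<bullet> grad F p"
proof -
  define \<nu> where "\<nu> = outward_normal \<Omega> p"
  have N: "grad \<rho> p \<noteq> 0" using \<rho> by (auto simp: local_defining_function_def)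
  have \<nu>: "\<nu> = sgn (grad \<rho> p)" unfolding \<nu>_def by (rule outward_normal_eq[OF \<rho> p])
  have "(- \<nu>) \<bullet> grad \<rho> p < 0" using N by (simp add: \<nu> sgn_div_norm)
  then obtain d where d: "d > 0" "\<forall>s>0. s < d \<longrightarrow> p + s *\<^sub>R (- \<nu>) \<in> \<Omega> \<inter> V"
    using inward_ray_in_domain[OF \<rho> p] by blast
  have pc: "p \<in> closure \<Omega>" using p by (simp add: frontier_def)
  then have pU: "p \<in> U" using F(1) by blast
  have "((\<lambda>s. F (p + s *\<^sub>R (- \<nu>))) has_real_derivative (- \<nu>) \<bullet> grad F p) (at 0 within {0<..})"
    by (rule has_real_derivative_line_grad[OF F(2) pU])
  then have "((\<lambda>s. (F (p + s *\<^sub>R (- \<nu>)) - F p) / s) \<longlongrightarrow> (- \<nu>) \<bullet> grad F p) (at_right 0)"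
    by (simp add: has_field_derivative_iff)
  then have "((\<lambda>s. - ((F (p + s *\<^sub>R (- \<nu>)) - F p) / s)) \<longlongrightarrow> - ((- \<nu>) \<bullet> grad F p)) (at_right 0)"
    by (rule tendsto_minus)
  then have "((\<lambda>s. (F p - F (p + s *\<^sub>R (- \<nu>))) / s) \<longlongrightarrow> \<nu> \<bullet> grad F p) (at_right 0)"
    by (simp add: minus_divide_left)
  moreover have "\<forall>\<^sub>F s in at_right 0. (F p - F (p + s *\<^sub>R (- \<nu>))) / s = (u p - u (p - s *\<^sub>R \<nu>)) / s"
    unfolding eventually_at_right_field
  proof (intro exI[of _ d] conjI d(1) allI impI)
    fix s :: real assume "0 < s" "s < d"
    then have "p + s *\<^sub>R (- \<nu>) \<in> closure \<Omega>" using d(2) closure_subset by blast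
    then show "(F p - F (p + s *\<^sub>R (- \<nu>))) / s = (u p - u (p - s *\<^sub>R \<nu>)) / s"
      using F(3)[OF pc] F(3)[of "p + s *\<^sub>R (- \<nu>)"] by simp
  qed
  ultimately have "((\<lambda>s. (u p - u (p - s *\<^sub>R \<nu>)) / s) \<longlongrightarrow> \<nu> \<bullet> grad F p) (at_right 0)"
    by (rule Lim_transform_eventually)
  then show ?thesis unfolding normal_deriv_def \<nu>_def[symmetric]
    by (intro tendsto_Lim) simp_all
qed

text \<open>The gradient of w vanishes on the whole frontier, so each partial derivative is again a
  function vanishing there and has its gradient along the normal. Symmetry of the Hessian then
  leaves only a multiple of \<nu> \<nu>^T.\<close>

lemma equal_cauchy_data:
  fixes w :: "real^'n \<Rightarrow> real"
  assumes \<rho>: "\<And>q. q \<in> frontier \<Omega> \<Longrightarrow> \<exists>V \<rho>. local_defining_function \<Omega> q V \<rho>"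
    and U: "open U" "frontier \<Omega> \<subseteq> U" "smooth_on U w"
    and zero: "\<And>q. q \<in> frontier \<Omega> \<Longrightarrow> w q = 0"
    and nzero: "\<And>q. q \<in> frontier \<Omega> \<Longrightarrow> outward_normal \<Omega> q \<bullet> grad w q = 0"
    and p: "p \<in> frontier \<Omega>"
  shows "grad w p = 0" "\<exists>c. hessian w p = c *\<^sub>R rank_one (outward_normal \<Omega> p)"
proof -
  have g0: "grad w q = 0" if q: "q \<in> frontier \<Omega>" for q
  proof -
    obtain V \<rho>' where \<rho>': "local_defining_function \<Omega> q V \<rho>'" using \<rho>[OF q] by blast
    have N: "grad \<rho>' q \<noteq> 0" using \<rho>' by (auto simp: local_defining_function_def)
    obtain c where c: "grad w q = c *\<^sub>R grad \<rho>' q"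
      using grad_parallel_normal[OF \<rho>' q U(1) _ U(3)] U(2) q zero by blast
    have "sgn (grad \<rho>' q) \<bullet> grad \<rho>' q \<noteq> 0" using N by (simp add: sgn_div_norm)
    then show ?thesis using nzero[OF q] by (simp add: outward_normal_eq[OF \<rho>' q] c)
  qed
  show "grad w p = 0" by (rule g0[OF p])
  obtain V \<rho>' where \<rho>': "local_defining_function \<Omega> p V \<rho>'" using \<rho>[OF p] by blast
  have N: "grad \<rho>' p \<noteq> 0" using \<rho>' by (auto simp: local_defining_function_def)
  define \<nu> where "\<nu> = outward_normal \<Omega> p"
  have \<nu>: "\<nu> = sgn (grad \<rho>' p)" unfolding \<nu>_def by (rule outward_normal_eq[OF \<rho>' p])
  have \<nu>1: "\<nu> \<bullet> \<nu> = 1" using N by (simp add: \<nu> dot_square_norm norm_sgn)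
  have "\<exists>c. grad (partial_deriv j w) p = c *\<^sub>R \<nu>" for j
  proof -
    have "partial_deriv j w q = 0" if "q \<in> frontier \<Omega>" for q
      using g0[OF that] by (simp add: grad_def vec_eq_iff)
    then obtain c where "grad (partial_deriv j w) p = c *\<^sub>R grad \<rho>' p"
      using grad_parallel_normal[OF \<rho>' p U(1) _ smooth_on_partial_deriv[OF U(1,3)]] U(2) p by blast
    then have "grad (partial_deriv j w) p = (c * norm (grad \<rho>' p)) *\<^sub>R \<nu>" using N by (simp add: \<nu> sgn_div_norm)
    then show ?thesis by blast
  qed
  then obtain c where c: "\<And>j. grad (partial_deriv j w) p = c j *\<^sub>R \<nu>" by metis
  have H: "hessian w p $ i $ j = c j * \<nu> $ i" for i j
    using c[of j] by (simp add: hessian_def grad_def vec_eq_iff)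
  have sym: "hessian w p $ i $ j = hessian w p $ j $ i" for i j
    using transpose_hessian[OF U(1,3)] U(2) p by (metis (no_types) transpose_def vec_lambda_beta subsetD)
  \<comment> \<open>Contracting with the unit vector \<nu> and exchanging the indices shows that the
    factors c j are themselves proportional to the components of \<nu>.\<close>
  define a where "a = (\<Sum>i\<in>UNIV. c i * \<nu> $ i)"
  have "c j = a * \<nu> $ j" for j
  proof -
    have "c j = c j * (\<nu> \<bullet> \<nu>)" using \<nu>1 by simp
    also have "\<dots> = (\<Sum>i\<in>UNIV. hessian w p $ i $ j * \<nu> $ i)"
      by (simp add: inner_vec_def H sum_distrib_left mult.assoc)
    also have "\<dots> = (\<Sum>i\<in>UNIV. c i * \<nu> $ j * \<nu> $ i)" by (subst sym) (simp add: H)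
    also have "\<dots> = a * \<nu> $ j" unfolding a_def sum_distrib_right by (intro sum.cong) (auto simp: mult_ac)
    finally show ?thesis .
  qed
  then have "hessian w p = a *\<^sub>R rank_one \<nu>" by (simp add: vec_eq_iff H rank_one_def mult_ac)
  then show "\<exists>c. hessian w p = c *\<^sub>R rank_one (outward_normal \<Omega> p)" by (auto simp: \<nu>_def)
qed

section \<open>Integral identities\<close>

lemma smooth_on_det:
  fixes A :: "'a::real_normed_vector \<Rightarrow> real^'n^'n"
  assumes "\<And>i j. smooth_on U (\<lambda>x. A x $ i $ j)"
  shows "smooth_on U (\<lambda>x. det (A x))"
  unfolding det_def by (intro smooth_on_sum smooth_on_mult smooth_on_const smooth_on_prod assms)

lemma smooth_on_cof:
  fixes A :: "'a::real_normed_vector \<Rightarrow> real^'n^'n"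
  assumes "\<And>i j. smooth_on U (\<lambda>x. A x $ i $ j)"
  shows "smooth_on U (\<lambda>x. cof (A x) $ i $ j)"
proof -
  have "smooth_on U (\<lambda>x. det (\<chi> k. if k = i then axis j 1 else A x $ k))"
  proof (rule smooth_on_det)
    show "smooth_on U (\<lambda>x. (\<chi> k. if k = i then axis j 1 else A x $ k) $ k $ l)" for k l
      using assms[of k l] by (cases "k = i") (simp_all add: smooth_on_const)
  qed
  then show ?thesis by (simp add: cof_def)
qed

lemma smooth_on_pencil:
  fixes A :: "'a::real_normed_vector \<Rightarrow> real^'n^'n"
  assumes "\<And>i j. smooth_on U (\<lambda>x. A x $ i $ j)"
  shows "smooth_on U (\<lambda>x. (mat 1 + c *\<^sub>R A x) $ i $ j)"
  using smooth_on_add[OF smooth_on_const[of U "mat 1 $ i $ j"] smooth_on_mult[OF smooth_on_const[of U c] assms[of i j]]]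
  by simp

lemma smooth_on_hsig:
  fixes A :: "'a::real_normed_vector \<Rightarrow> real^'n^'n"
  assumes "\<And>i j. smooth_on U (\<lambda>x. A x $ i $ j)"
  shows "smooth_on U (\<lambda>x. hsig k (A x))"
  unfolding hsig_def
  by (intro smooth_on_sum smooth_on_mult smooth_on_const smooth_on_det smooth_on_pencil assms)

lemma smooth_on_hsig_grad:
  fixes A :: "'a::real_normed_vector \<Rightarrow> real^'n^'n"
  assumes "\<And>i j. smooth_on U (\<lambda>x. A x $ i $ j)"
  shows "smooth_on U (\<lambda>x. hsig_grad k (A x) $ i $ j)"
  unfolding hsig_grad_entry
  by (intro smooth_on_sum smooth_on_mult smooth_on_const smooth_on_cof smooth_on_pencil assms)

lemma smooth_on_hessian:
  fixes f :: "real^'n \<Rightarrow> real"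
  assumes "open U" "smooth_on U f"
  shows "smooth_on U (\<lambda>x. hessian f x $ i $ j)"
  using smooth_on_partial_deriv[OF assms(1) smooth_on_partial_deriv[OF assms]] by (simp add: hessian_def)

lemma smooth_on_frob:
  fixes A B :: "'a::real_normed_vector \<Rightarrow> real^'n^'n"
  assumes "\<And>i j. smooth_on U (\<lambda>x. A x $ i $ j)" "\<And>i j. smooth_on U (\<lambda>x. B x $ i $ j)"
  shows "smooth_on U (\<lambda>x. frob (A x) (B x))"
  unfolding frob_def by (intro smooth_on_sum smooth_on_mult assms)

section \<open>Divergence structure of the linearized operator\<close>

lemma partial_deriv_hessian_symmetric:
  fixes f :: "real^'n \<Rightarrow> real"
  assumes U: "open U" "x \<in> U" and f: "smooth_on U f"
  shows "partial_deriv j (\<lambda>x. hessian f x $ k $ l) x = partial_deriv l (\<lambda>x. hessian f x $ k $ j) x"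
proof -
  have p: "smooth_on U (partial_deriv i f)" for i by (rule smooth_on_partial_deriv[OF U(1) f])
  have "partial_deriv j (partial_deriv k (partial_deriv l f)) x = partial_deriv k (partial_deriv j (partial_deriv l f)) x" for j l
    by (rule partial_deriv_commute[OF U(1) p U(2)])
  moreover have "partial_deriv k (partial_deriv j (partial_deriv l f)) x = partial_deriv k (partial_deriv l (partial_deriv j f)) x"
    by (rule partial_deriv_cong[OF U partial_deriv_commute[OF U(1) f]])
      (auto intro: smooth_on_differentiable[OF smooth_on_partial_deriv[OF U(1) p] U(2)])
  ultimately show ?thesis by (simp add: hessian_def)
qed

lemma det_swap_two_rows:
  fixes A :: "real^'n^'n"
  assumes "k \<noteq> i"
  shows "det (\<chi> r. if r = k then u else if r = i then v else A $ r) =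
    - det (\<chi> r. if r = k then v else if r = i then u else A $ r)"
proof -
  let ?p = "Transposition.transpose k i" and ?B = "\<chi> r. if r = k then v else if r = i then u else A $ r"
  have "(\<chi> r. if r = k then u else if r = i then v else A $ r) = (\<chi> r. ?B $ ?p r)"
    using assms by (auto simp: vec_eq_iff Transposition.transpose_def)
  then have "det (\<chi> r. if r = k then u else if r = i then v else A $ r) = of_int (sign ?p) * det ?B"
    by (simp only: det_permute_rows[OF permutes_swap_id[of k UNIV i, simplified]])
  then show ?thesis using assms by (simp add: sign_swap_id)
qed

lemma sum_antisymmetric_symmetric:
  fixes a s :: "'n::finite \<Rightarrow> 'n \<Rightarrow> real"
  assumes "\<And>i j. a i j = - a j i" "\<And>i j. s i j = s j i"
  shows "(\<Sum>i\<in>UNIV. \<Sum>j\<in>UNIV. a i j * s i j) = 0"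
proof -
  have "(\<Sum>i\<in>UNIV. \<Sum>j\<in>UNIV. a i j * s i j) = (\<Sum>j\<in>UNIV. \<Sum>i\<in>UNIV. a i j * s i j)" by (rule sum.swap)
  also have "\<dots> = (\<Sum>j\<in>UNIV. \<Sum>i\<in>UNIV. - (a j i * s j i))"
    by (intro sum.cong refl) (metis assms mult_minus_left)
  finally show ?thesis by (simp add: sum_negf)
qed

text \<open>Differentiating another row produces a symmetric third derivative contracted with a
  determinant that is antisymmetric in the two rows involved.\<close>

lemma cof_divergence_free:
  fixes f :: "real^'n \<Rightarrow> real"
  assumes U: "open U" "x \<in> U" and f: "smooth_on U f"
  shows "(\<Sum>j\<in>UNIV. partial_deriv j (\<lambda>x. cof (mat 1 + c *\<^sub>R hessian f x) $ i $ j) x) = 0"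
proof -
  define A where "A x = mat 1 + c *\<^sub>R hessian f x" for x
  \<comment> \<open>Row i is frozen to a basis vector, so only derivatives of the other rows
    contribute.\<close>
  define B where "B j x = (\<chi> k. if k = i then axis j 1 else A x $ k)" for j x
  define S where "S k j l = partial_deriv j (\<lambda>x. hessian f x $ k $ l) x" for k j l
  have dA: "((\<lambda>x. A x $ k $ l) has_derivative (\<lambda>v. c * (\<Sum>m\<in>UNIV. v $ m * S k m l))) (at x)" for k l
  proof -
    have "((\<lambda>x. mat 1 $ k $ l + c * hessian f x $ k $ l) has_derivative
        (\<lambda>v. 0 + c * (\<Sum>m\<in>UNIV. v $ m * S k m l))) (at x)"
      unfolding S_def
      by (intro has_derivative_add has_derivative_const has_derivative_mult_right
          smooth_on_has_derivative[OF smooth_on_hessian[OF U(1) f] U(2)])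
    then show ?thesis by (simp add: A_def)
  qed
  have dB: "((\<lambda>x. B j x $ k $ l) has_derivative (\<lambda>v. if k = i then 0 else c * (\<Sum>m\<in>UNIV. v $ m * S k m l))) (at x)" for j k l
    using dA[of k l] by (cases "k = i") (simp_all add: B_def)
  have "partial_deriv j (\<lambda>x. cof (A x) $ i $ j) x =
     (\<Sum>k\<in>UNIV. \<Sum>l\<in>UNIV. cof (B j x) $ k $ l * (if k = i then 0 else c * S k j l))" for j
  proof -
    have ax: "(\<Sum>m\<in>UNIV. axis j 1 $ m * S k m l) = S k j l" for k l
      by (simp add: axis_def if_distrib[of "\<lambda>x. x * _"] cong: if_cong)
    have "partial_deriv j (\<lambda>x. det (B j x)) x = (\<Sum>k\<in>UNIV. \<Sum>l\<in>UNIV. cof (B j x) $ k $ l *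
       (if k = i then 0 else c * (\<Sum>m\<in>UNIV. axis j 1 $ m * S k m l)))"
      by (rule partial_derivI[OF has_derivative_det[OF dB]])
    then show ?thesis by (simp only: ax B_def cof_def vec_lambda_beta)
  qed
  then have "(\<Sum>j\<in>UNIV. partial_deriv j (\<lambda>x. cof (A x) $ i $ j) x) =
     (\<Sum>j\<in>UNIV. \<Sum>k\<in>UNIV. \<Sum>l\<in>UNIV. cof (B j x) $ k $ l * (if k = i then 0 else c * S k j l))"
    by simp
  also have "\<dots> = (\<Sum>k\<in>UNIV. \<Sum>j\<in>UNIV. \<Sum>l\<in>UNIV. cof (B j x) $ k $ l * (if k = i then 0 else c * S k j l))"
    by (rule sum.swap)
  also have "\<dots> = 0"
  proof (rule sum.neutral, rule ballI)
    fix k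
    show "(\<Sum>j\<in>UNIV. \<Sum>l\<in>UNIV. cof (B j x) $ k $ l * (if k = i then 0 else c * S k j l)) = 0"
    proof (cases "k = i")
      case True then show ?thesis by simp
    next
      case False
      have cB: "cof (B j x) $ k $ l =
          det (\<chi> r. if r = k then axis l 1 else if r = i then axis j 1 else A x $ r)" for j l
        unfolding cof_def B_def vec_lambda_beta by (intro arg_cong[where f = det]) (simp add: vec_eq_iff)
      have "(\<Sum>j\<in>UNIV. \<Sum>l\<in>UNIV. cof (B j x) $ k $ l * (c * S k j l)) = 0"
      proof (rule sum_antisymmetric_symmetric)
        show "cof (B j x) $ k $ l = - cof (B l x) $ k $ j" for j l
          unfolding cB by (rule det_swap_two_rows[OF False])
        show "c * S k j l = c * S k l j" for j l
          unfolding S_def by (simp only: partial_deriv_hessian_symmetric[OF U f, of j k l])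
      qed
      then show ?thesis using False by simp
    qed
  qed
  finally show ?thesis by (simp add: A_def)
qed

lemma hsig_grad_divergence_free:
  fixes f :: "real^'n \<Rightarrow> real"
  assumes U: "open U" "x \<in> U" and f: "smooth_on U f"
  shows "(\<Sum>j\<in>UNIV. partial_deriv j (\<lambda>x. hsig_grad k (hessian f x) $ i $ j) x) = 0"
proof -
  have c: "smooth_on U (\<lambda>x. cof (mat 1 + c *\<^sub>R hessian f x) $ i $ j)" for c j
    by (intro smooth_on_cof smooth_on_pencil smooth_on_hessian U f)
  have "partial_deriv j (\<lambda>x. hsig_grad k (hessian f x) $ i $ j) x = (\<Sum>m\<le>CARD('n).
      lagrange_coeff CARD('n) k m * real m * partial_deriv j (\<lambda>x. cof (mat 1 + real m *\<^sub>R hessian f x) $ i $ j) x)" for j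
    unfolding hsig_grad_entry
    by (subst partial_deriv_sum)
      (auto intro!: sum.cong partial_deriv_cmult smooth_on_differentiable[OF _ U(2)] c
        smooth_on_mult smooth_on_const)
  then have "(\<Sum>j\<in>UNIV. partial_deriv j (\<lambda>x. hsig_grad k (hessian f x) $ i $ j) x) = (\<Sum>m\<le>CARD('n). \<Sum>j\<in>UNIV.
      lagrange_coeff CARD('n) k m * real m * partial_deriv j (\<lambda>x. cof (mat 1 + real m *\<^sub>R hessian f x) $ i $ j) x)"
    by (simp only: sum.swap[of _ UNIV "{..CARD('n)}"])
  then show ?thesis by (simp only: sum_distrib_left[symmetric] cof_divergence_free[OF U f]) simp
qed

text \<open>T is divergence free, so by the product rule only z is differentiated.\<close>

lemma divergence_hsig_grad_field:
  fixes f :: "real^'n \<Rightarrow> real"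
  assumes U: "open U" "x \<in> U" and f: "smooth_on U f" and z: "\<And>j. smooth_on U (z j)"
  shows "(\<Sum>i\<in>UNIV. partial_deriv i (\<lambda>x. \<Sum>j\<in>UNIV. hsig_grad k (hessian f x) $ i $ j * z j x) x) =
    (\<Sum>i\<in>UNIV. \<Sum>j\<in>UNIV. hsig_grad k (hessian f x) $ i $ j * partial_deriv i (z j) x)"
proof -
  let ?T = "\<lambda>i j x. hsig_grad k (hessian f x) $ i $ j"
  have T: "smooth_on U (?T i j)" for i j by (intro smooth_on_hsig_grad smooth_on_hessian U f)
  note dT = smooth_on_differentiable[OF T U(2)] and dz = smooth_on_differentiable[OF z U(2)]
  \<comment> \<open>Divergence freeness is stated in the column index, whereas the field is
    differentiated in the row index; symmetry of T on all of U permits the exchange under the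
    derivative.\<close>
  have sw: "partial_deriv i (?T i j) x = partial_deriv i (?T j i) x" for i j
    by (rule partial_deriv_cong[OF U _ dT]) (rule hsig_grad_sym[OF transpose_hessian[OF U(1) f]])
  have "partial_deriv i (\<lambda>x. \<Sum>j\<in>UNIV. ?T i j x * z j x) x =
     (\<Sum>j\<in>UNIV. ?T i j x * partial_deriv i (z j) x) + (\<Sum>j\<in>UNIV. partial_deriv i (?T j i) x * z j x)" for i
    by (subst partial_deriv_sum)
      (simp_all add: partial_deriv_mult[OF dT dz] sum.distrib sw differentiable_mult[OF dT dz])
  then have "(\<Sum>i\<in>UNIV. partial_deriv i (\<lambda>x. \<Sum>j\<in>UNIV. ?T i j x * z j x) x) =
     (\<Sum>i\<in>UNIV. \<Sum>j\<in>UNIV. ?T i j x * partial_deriv i (z j) x) +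
     (\<Sum>i\<in>UNIV. \<Sum>j\<in>UNIV. partial_deriv i (?T j i) x * z j x)" by (simp add: sum.distrib)
  also have "(\<Sum>i\<in>UNIV. \<Sum>j\<in>UNIV. partial_deriv i (?T j i) x * z j x) =
     (\<Sum>j\<in>UNIV. \<Sum>i\<in>UNIV. partial_deriv i (?T j i) x * z j x)" by (rule sum.swap)
  also have "\<dots> = 0" by (simp only: sum_distrib_right[symmetric] hsig_grad_divergence_free[OF U f]) simp
  finally show ?thesis by simp
qed

section \<open>Green identities\<close>

lemma set_integrable_smooth:
  fixes f :: "real^'n \<Rightarrow> real"
  assumes "open \<Omega>" "bounded \<Omega>" "closure \<Omega> \<subseteq> U" "smooth_on U f"
  shows "set_integrable lborel \<Omega> f"
  by (rule set_integrable_continuous_closure[OF assms(1,2)])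
    (rule continuous_on_subset[OF smooth_on_continuous[OF assms(4)] assms(3)])

lemma integral_divergence_zero:
  fixes Z :: "'n \<Rightarrow> real^'n \<Rightarrow> real"
  assumes Om: "open \<Omega>" "convex \<Omega>" "bounded \<Omega>"
    and U: "open U" "closure \<Omega> \<subseteq> U" "\<And>i. smooth_on U (Z i)"
    and zero: "\<And>x i. x \<in> frontier \<Omega> \<Longrightarrow> Z i x = 0"
  shows "(LINT x:\<Omega>|lborel. (\<Sum>i\<in>UNIV. partial_deriv i (Z i) x)) = 0"
proof -
  have int: "set_integrable lborel \<Omega> (partial_deriv i (Z i))" for i
    by (rule set_integrable_smooth[OF Om(1,3) U(2) smooth_on_partial_deriv[OF U(1,3)]])
  have "(LINT x:\<Omega>|lborel. (\<Sum>i\<in>UNIV. partial_deriv i (Z i) x)) =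
     (\<Sum>i\<in>UNIV. LINT x:\<Omega>|lborel. partial_deriv i (Z i) x)"
    unfolding set_lebesgue_integral_def scaleR_sum_right
    by (rule Bochner_Integration.integral_sum) (use int in \<open>simp add: set_integrable_def\<close>)
  also have "\<dots> = 0"
    by (rule sum.neutral, rule ballI, rule integral_partial_deriv_zero[OF Om U], rule zero)
  finally show ?thesis .
qed

lemma frob_mult_left_sum:
  "(\<Sum>i\<in>UNIV. \<Sum>j\<in>UNIV. A $ i $ j * (c * B $ i $ j)) = c * frob A B"
  by (simp add: frob_def sum_distrib_left mult_ac)

lemma inner_mat_grad:
  "grad g x \<bullet> (A *v grad f x) = (\<Sum>i\<in>UNIV. \<Sum>j\<in>UNIV. A $ i $ j * (partial_deriv i g x * partial_deriv j f x))"
  by (simp add: inner_vec_def matrix_vector_mult_def grad_def sum_distrib_left mult_ac)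

text \<open>Divergence of the field d T grad d, which vanishes on the frontier together with d.
  Where T is positive semidefinite the left side is nonpositive, and this sign drives the energy
  bound.\<close>

lemma energy_identity:
  fixes d y :: "real^'n \<Rightarrow> real"
  assumes Om: "open \<Omega>" "convex \<Omega>" "bounded \<Omega>"
    and U: "open U" "closure \<Omega> \<subseteq> U" and y: "smooth_on U y" and d: "smooth_on U d"
    and zero: "\<And>x. x \<in> frontier \<Omega> \<Longrightarrow> d x = 0"
  shows "(LINT x:\<Omega>|lborel. d x * frob (hsig_grad k (hessian y x)) (hessian d x)) =
     - (LINT x:\<Omega>|lborel. grad d x \<bullet> (hsig_grad k (hessian y x) *v grad d x))"
proof -
  let ?T = "\<lambda>x. hsig_grad k (hessian y x)"
  define Z where "Z i x = (\<Sum>j\<in>UNIV. ?T x $ i $ j * (d x * partial_deriv j d x))" for i x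
  have T: "smooth_on U (\<lambda>x. ?T x $ i $ j)" for i j by (intro smooth_on_hsig_grad smooth_on_hessian U y)
  have pd: "smooth_on U (partial_deriv j d)" for j by (rule smooth_on_partial_deriv[OF U(1) d])
  have sZ: "smooth_on U (Z i)" for i unfolding Z_def by (intro smooth_on_sum smooth_on_mult T d pd)
  have eq: "(\<Sum>i\<in>UNIV. partial_deriv i (Z i) x) = d x * frob (?T x) (hessian d x) + grad d x \<bullet> (?T x *v grad d x)"
    if "x \<in> U" for x
  proof -
    have "partial_deriv i (\<lambda>x. d x * partial_deriv j d x) x =
        d x * hessian d x $ i $ j + partial_deriv i d x * partial_deriv j d x" for i j
      using partial_deriv_mult[OF smooth_on_differentiable[OF d that] smooth_on_differentiable[OF pd that]]
      by (simp add: hessian_def)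
    then show ?thesis
      unfolding Z_def divergence_hsig_grad_field[OF U(1) that y smooth_on_mult[OF d pd]]
      by (simp add: distrib_left sum.distrib frob_mult_left_sum inner_mat_grad)
  qed
  have in1: "set_integrable lborel \<Omega> (\<lambda>x. d x * frob (?T x) (hessian d x))"
    by (rule set_integrable_smooth[OF Om(1,3) U(2)])
      (intro smooth_on_mult smooth_on_frob T d smooth_on_hessian U)
  have in2: "set_integrable lborel \<Omega> (\<lambda>x. grad d x \<bullet> (?T x *v grad d x))"
    unfolding inner_mat_grad
    by (rule set_integrable_smooth[OF Om(1,3) U(2)]) (intro smooth_on_sum smooth_on_mult T pd)
  have "(LINT x:\<Omega>|lborel. (\<Sum>i\<in>UNIV. partial_deriv i (Z i) x)) = 0"
    by (rule integral_divergence_zero[OF Om U sZ]) (simp add: Z_def zero)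
  moreover have "(LINT x:\<Omega>|lborel. (\<Sum>i\<in>UNIV. partial_deriv i (Z i) x)) =
      (LINT x:\<Omega>|lborel. d x * frob (?T x) (hessian d x) + grad d x \<bullet> (?T x *v grad d x))"
    using eq U(2) closure_subset Om(1) by (intro set_lebesgue_integral_cong) auto
  ultimately show ?thesis using set_integral_add(2)[OF in1 in2] by linarith
qed

text \<open>Green's second identity for the fields h T grad d - d T grad h. A single field may be
  nonzero on the frontier, but the difference of the two vanishes there, so they are subtracted
  before integrating.\<close>

lemma flux_identity:
  fixes d1 d2 y1 y2 h :: "real^'n \<Rightarrow> real"
  assumes Om: "open \<Omega>" "convex \<Omega>" "bounded \<Omega>"
    and U: "open U" "closure \<Omega> \<subseteq> U"
    and sm: "smooth_on U y1" "smooth_on U y2" "smooth_on U d1" "smooth_on U d2" "smooth_on U h"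
    and zero: "\<And>x. x \<in> frontier \<Omega> \<Longrightarrow> d1 x = 0" "\<And>x. x \<in> frontier \<Omega> \<Longrightarrow> d2 x = 0"
    and flux: "\<And>x. x \<in> frontier \<Omega> \<Longrightarrow>
       hsig_grad k (hessian y1 x) *v grad d1 x = hsig_grad k (hessian y2 x) *v grad d2 x"
  shows "(LINT x:\<Omega>|lborel. frob (hsig_grad k (hessian y1 x)) (hessian d1 x) * h x) -
      (LINT x:\<Omega>|lborel. frob (hsig_grad k (hessian y2 x)) (hessian d2 x) * h x) =
     (LINT x:\<Omega>|lborel. d1 x * frob (hsig_grad k (hessian y1 x)) (hessian h x)) -
      (LINT x:\<Omega>|lborel. d2 x * frob (hsig_grad k (hessian y2 x)) (hessian h x))"
proof -
  define T where "T y x = hsig_grad k (hessian y x)" for y :: "real^'n \<Rightarrow> real" and x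
  define Z where "Z y d i x = (\<Sum>j\<in>UNIV. T y x $ i $ j * (h x * partial_deriv j d x - d x * partial_deriv j h x))"
    for y d i x
  have sT: "smooth_on U (\<lambda>x. T y x $ i $ j)" if "smooth_on U y" for y i j
    unfolding T_def by (intro smooth_on_hsig_grad smooth_on_hessian U that)
  have pd: "smooth_on U (partial_deriv j d)" if "smooth_on U d" for j and d :: "real^'n \<Rightarrow> real"
    by (rule smooth_on_partial_deriv[OF U(1) that])
  have sz: "smooth_on U (\<lambda>x. h x * partial_deriv j d x - d x * partial_deriv j h x)" if "smooth_on U d" for d j
    by (intro smooth_on_diff smooth_on_mult that sm pd)
  have sZ: "smooth_on U (Z y d i)" if "smooth_on U y" "smooth_on U d" for y d i
    unfolding Z_def by (intro smooth_on_sum smooth_on_mult sT sz that)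
  have eq: "(\<Sum>i\<in>UNIV. partial_deriv i (Z y d i) x) =
       frob (T y x) (hessian d x) * h x - d x * frob (T y x) (hessian h x)"
    if x: "x \<in> U" and y: "smooth_on U y" and d: "smooth_on U d" for x y d
  proof -
    have e: "partial_deriv i (\<lambda>x. h x * partial_deriv j d x - d x * partial_deriv j h x) x =
        (h x * hessian d x $ i $ j - d x * hessian h x $ i $ j)
        + (partial_deriv i h x * partial_deriv j d x - partial_deriv i d x * partial_deriv j h x)" for i j
      using partial_deriv_diff[OF smooth_on_differentiable[OF smooth_on_mult[OF sm(5) pd[OF d]] x]
          smooth_on_differentiable[OF smooth_on_mult[OF d pd[OF sm(5)]] x]]
        partial_deriv_mult[OF smooth_on_differentiable[OF sm(5) x] smooth_on_differentiable[OF pd[OF d] x]]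
        partial_deriv_mult[OF smooth_on_differentiable[OF d x] smooth_on_differentiable[OF pd[OF sm(5)] x]]
      by (simp add: hessian_def)
    \<comment> \<open>The products of first derivatives cancel because T is symmetric.\<close>
    have "grad h x \<bullet> (T y x *v grad d x) = grad d x \<bullet> (T y x *v grad h x)"
    proof -
      have "transpose (T y x) = T y x"
        using hsig_grad_sym[OF transpose_hessian[OF U(1) y x]] by (simp add: T_def vec_eq_iff transpose_def)
      then show ?thesis by (metis dot_lmul_matrix inner_commute vector_transpose_matrix)
    qed
    then have "(\<Sum>i\<in>UNIV. \<Sum>j\<in>UNIV. T y x $ i $ j * (partial_deriv i h x * partial_deriv j d x)) =
        (\<Sum>i\<in>UNIV. \<Sum>j\<in>UNIV. T y x $ i $ j * (partial_deriv i d x * partial_deriv j h x))"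
      by (simp only: inner_mat_grad)
    then show ?thesis
      unfolding Z_def T_def divergence_hsig_grad_field[OF U(1) x y sz[OF d]] e
      by (simp add: distrib_left right_diff_distrib sum.distrib sum_subtractf frob_mult_left_sum T_def mult.commute)
  qed
  have int: "set_integrable lborel \<Omega> (\<lambda>x. frob (T y x) (hessian d x) * h x)"
      "set_integrable lborel \<Omega> (\<lambda>x. d x * frob (T y x) (hessian h x))" if "smooth_on U y" "smooth_on U d" for y d
    by (rule set_integrable_smooth[OF Om(1,3) U(2)],
        intro smooth_on_mult smooth_on_frob sT smooth_on_hessian U sm that)+
  have "(LINT x:\<Omega>|lborel. (\<Sum>i\<in>UNIV. partial_deriv i (\<lambda>x. Z y1 d1 i x - Z y2 d2 i x) x)) = 0"
  proof (rule integral_divergence_zero[OF Om U])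
    show "smooth_on U (\<lambda>x. Z y1 d1 i x - Z y2 d2 i x)" for i by (intro smooth_on_diff sZ sm)
    fix x i assume x: "x \<in> frontier \<Omega>"
    have "Z y d i x = h x * (T y x *v grad d x) $ i" if "d x = 0" for y d
      by (simp add: Z_def that matrix_vector_mult_def grad_def sum_distrib_left mult_ac)
    then show "Z y1 d1 i x - Z y2 d2 i x = 0" using flux[OF x] zero x by (simp add: T_def)
  qed
  moreover have "(LINT x:\<Omega>|lborel. (\<Sum>i\<in>UNIV. partial_deriv i (\<lambda>x. Z y1 d1 i x - Z y2 d2 i x) x)) =
     (LINT x:\<Omega>|lborel. (frob (T y1 x) (hessian d1 x) * h x - d1 x * frob (T y1 x) (hessian h x)) -
        (frob (T y2 x) (hessian d2 x) * h x - d2 x * frob (T y2 x) (hessian h x)))"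
  proof (intro set_lebesgue_integral_cong allI impI)
    fix x assume "x \<in> \<Omega>"
    then have x: "x \<in> U" using U(2) closure_subset by blast
    have "partial_deriv i (\<lambda>x. Z y1 d1 i x - Z y2 d2 i x) x = partial_deriv i (Z y1 d1 i) x - partial_deriv i (Z y2 d2 i) x" for i
      by (intro partial_deriv_diff smooth_on_differentiable[OF _ x] sZ sm)
    then show "(\<Sum>i\<in>UNIV. partial_deriv i (\<lambda>x. Z y1 d1 i x - Z y2 d2 i x) x) =
       (frob (T y1 x) (hessian d1 x) * h x - d1 x * frob (T y1 x) (hessian h x)) -
        (frob (T y2 x) (hessian d2 x) * h x - d2 x * frob (T y2 x) (hessian h x))"
      using eq[OF x sm(1,3)] eq[OF x sm(2,4)] by (simp only: sum_subtractf)
  qed (use Om in auto)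
  ultimately show ?thesis
    using set_integral_diff(2)[OF int(1)[OF sm(1,3)] int(2)[OF sm(1,3)]]
      set_integral_diff(2)[OF int(1)[OF sm(2,4)] int(2)[OF sm(2,4)]]
      set_integral_diff(2)[OF set_integral_diff(1)[OF int[OF sm(1,3)]] set_integral_diff(1)[OF int[OF sm(2,4)]]]
    unfolding T_def by linarith
qed

section \<open>The main estimate\<close>

text \<open>As a function of s this is a polynomial of degree at most n, and interpolation expresses
  its coefficients by the values at s = 0, ..., n. The variable s is thereby separated from the
  matrices.\<close>

lemma hsig_pencil_expansion:
  fixes A B :: "real^'n^'n"
  shows "hsig k (A + s *\<^sub>R B) =
    (\<Sum>j\<le>CARD('n). (\<Sum>m\<le>CARD('n). lagrange_coeff CARD('n) j m * hsig k (A + real m *\<^sub>R B)) * s ^ j)"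
proof -
  have "\<exists>p. degree p \<le> CARD('n) \<and> (\<forall>s. poly p s = det (mat 1 + c *\<^sub>R (A + s *\<^sub>R B)))" for c
  proof -
    obtain p where p: "degree p \<le> CARD('n)" "\<And>s. poly p s = det ((mat 1 + c *\<^sub>R A) + s *\<^sub>R (c *\<^sub>R B))"
      using det_pencil_poly by blast
    have e: "(mat 1 + c *\<^sub>R A) + s *\<^sub>R (c *\<^sub>R B) = mat 1 + c *\<^sub>R (A + s *\<^sub>R B)" for s
      by (simp add: scaleR_add_right add.assoc mult.commute)
    show ?thesis using p unfolding e by blast
  qed
  then obtain p where p: "\<And>c. degree (p c) \<le> CARD('n)" "\<And>c s. poly (p c) s = det (mat 1 + c *\<^sub>R (A + s *\<^sub>R B))"
    by metis
  define q where "q = (\<Sum>m\<le>CARD('n). smult (lagrange_coeff CARD('n) k m) (p (real m)))"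
  have deg: "degree q \<le> CARD('n)" unfolding q_def
    by (intro degree_sum_le) (auto intro: order_trans[OF degree_smult_le] p(1))
  have q: "poly q s = hsig k (A + s *\<^sub>R B)" for s
    by (simp add: q_def poly_sum p(2) hsig_def)
  have "poly q s = (\<Sum>j\<le>degree q. coeff q j * s ^ j)" by (rule poly_altdef)
  also have "\<dots> = (\<Sum>j\<le>CARD('n). coeff q j * s ^ j)"
    by (rule sum.mono_neutral_left) (use deg in \<open>auto simp: coeff_eq_0\<close>)
  finally show ?thesis unfolding q[symmetric] coeff_eq_sum_lagrange[OF deg] .
qed

text \<open>By the expansion the integral is a polynomial in s with integrated coefficients, so
  differentiation under the integral sign becomes differentiation of a finite sum.\<close>

lemma has_real_derivative_integral_hsig:
  fixes A B :: "real^'n \<Rightarrow> real^'n^'n" and h :: "real^'n \<Rightarrow> real"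
  assumes Om: "open \<Omega>" "bounded \<Omega>" "closure \<Omega> \<subseteq> U"
    and A: "\<And>i j. smooth_on U (\<lambda>x. A x $ i $ j)" and B: "\<And>i j. smooth_on U (\<lambda>x. B x $ i $ j)"
    and h: "smooth_on U h"
  shows "((\<lambda>s. LINT x:\<Omega>|lborel. hsig k (A x + s *\<^sub>R B x) * h x) has_real_derivative
     (LINT x:\<Omega>|lborel. frob (hsig_grad k (A x + s *\<^sub>R B x)) (B x) * h x)) (at s)"
proof -
  define c where "c j x = (\<Sum>m\<le>CARD('n). lagrange_coeff CARD('n) j m * hsig k (A x + real m *\<^sub>R B x))" for j x
  have sm: "smooth_on U (\<lambda>x. (A x + r *\<^sub>R B x) $ i $ j)" for r i j
    using smooth_on_add[OF A[of i j] smooth_on_mult[OF smooth_on_const[of U r] B[of i j]]] by simp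
  have sc: "smooth_on U (c j)" for j
    unfolding c_def by (intro smooth_on_sum smooth_on_mult smooth_on_const smooth_on_hsig sm)
  have int: "set_integrable lborel \<Omega> (\<lambda>x. r * (c j x * h x))" for j r
    by (rule set_integrable_smooth[OF Om]) (intro smooth_on_mult smooth_on_const sc h)
  have sumI: "(LINT x:\<Omega>|lborel. (\<Sum>j\<le>CARD('n). r j * (c j x * h x))) =
     (\<Sum>j\<le>CARD('n). r j * (LINT x:\<Omega>|lborel. c j x * h x))" for r
  proof -
    have "(LINT x:\<Omega>|lborel. (\<Sum>j\<le>CARD('n). r j * (c j x * h x))) =
        (\<Sum>j\<le>CARD('n). LINT x:\<Omega>|lborel. r j * (c j x * h x))"
      unfolding set_lebesgue_integral_def scaleR_sum_right
      by (rule Bochner_Integration.integral_sum) (use int in \<open>simp add: set_integrable_def\<close>)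
    then show ?thesis by simp
  qed
  have ex: "hsig k (A x + s *\<^sub>R B x) = (\<Sum>j\<le>CARD('n). c j x * s ^ j)" for x s
    unfolding c_def by (rule hsig_pencil_expansion)
  \<comment> \<open>Both sides are derivatives in s of the same function, one by the chain rule and
    one term by term.\<close>
  have dex: "frob (hsig_grad k (A x + s *\<^sub>R B x)) (B x) = (\<Sum>j\<le>CARD('n). c j x * (real j * s ^ (j - 1)))" for x
  proof -
    have "((\<lambda>s. \<Sum>j\<le>CARD('n). c j x * s ^ j) has_real_derivative (\<Sum>j\<le>CARD('n). c j x * (real j * s ^ (j - 1)))) (at s)"
      by (intro DERIV_sum DERIV_cmult) (use DERIV_pow in auto)
    then have "((\<lambda>s. hsig k (A x + s *\<^sub>R B x)) has_real_derivative (\<Sum>j\<le>CARD('n). c j x * (real j * s ^ (j - 1)))) (at s)"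
      by (simp only: ex)
    then show ?thesis by (rule DERIV_unique[OF has_derivative_hsig_line])
  qed
  have 1: "(LINT x:\<Omega>|lborel. hsig k (A x + s *\<^sub>R B x) * h x) =
      (\<Sum>j\<le>CARD('n). s ^ j * (LINT x:\<Omega>|lborel. c j x * h x))" for s
    unfolding sumI[symmetric] ex by (simp add: sum_distrib_right sum_distrib_left mult_ac)
  have 2: "(LINT x:\<Omega>|lborel. frob (hsig_grad k (A x + s *\<^sub>R B x)) (B x) * h x) =
      (\<Sum>j\<le>CARD('n). (real j * s ^ (j - 1)) * (LINT x:\<Omega>|lborel. c j x * h x))"
    unfolding sumI[symmetric] dex by (simp add: sum_distrib_right sum_distrib_left mult_ac)
  show ?thesis unfolding 1 2
    by (intro DERIV_sum DERIV_cmult_right) (use DERIV_pow in auto)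
qed

lemma hessian_add_cmult:
  fixes f g :: "real^'n \<Rightarrow> real"
  assumes U: "open U" "x \<in> U" and f: "smooth_on U f" and g: "smooth_on U g"
  shows "hessian (\<lambda>x. f x + c * g x) x = hessian f x + c *\<^sub>R hessian g x"
proof -
  have sg: "smooth_on U (\<lambda>x. c * g x)" by (intro smooth_on_mult smooth_on_const g)
  have p: "partial_deriv j (\<lambda>x. f x + c * g x) y = partial_deriv j f y + c * partial_deriv j g y" if "y \<in> U" for j y
    using partial_deriv_add[OF smooth_on_differentiable[OF f that] smooth_on_differentiable[OF sg that]]
      partial_deriv_cmult[OF smooth_on_differentiable[OF g that]] by simp
  have pf: "smooth_on U (partial_deriv j f)" "smooth_on U (partial_deriv j g)"
      "smooth_on U (\<lambda>x. c * partial_deriv j g x)" for j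
    by (intro smooth_on_mult smooth_on_const smooth_on_partial_deriv U f g)+
  have "partial_deriv i (partial_deriv j (\<lambda>x. f x + c * g x)) x =
      partial_deriv i (partial_deriv j f) x + c * partial_deriv i (partial_deriv j g) x" for i j
  proof -
    have "partial_deriv i (partial_deriv j (\<lambda>x. f x + c * g x)) x =
        partial_deriv i (\<lambda>x. partial_deriv j f x + c * partial_deriv j g x) x"
      by (rule partial_deriv_cong[OF U p])
        (use smooth_on_differentiable[OF smooth_on_partial_deriv[OF U(1) smooth_on_add[OF f sg]] U(2)] in auto)
    then show ?thesis
      using partial_deriv_add[OF smooth_on_differentiable[OF pf(1) U(2)] smooth_on_differentiable[OF pf(3) U(2)]]
        partial_deriv_cmult[OF smooth_on_differentiable[OF pf(2) U(2)]] by simp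
  qed
  then show ?thesis by (simp add: vec_eq_iff hessian_def)
qed

lemma hessian_diff:
  fixes f g :: "real^'n \<Rightarrow> real"
  assumes "open U" "x \<in> U" "smooth_on U f" "smooth_on U g"
  shows "hessian (\<lambda>x. f x - g x) x = hessian f x - hessian g x"
  using hessian_add_cmult[OF assms, of "-1"] by simp

lemma grad_diff:
  fixes f g :: "real^'n \<Rightarrow> real"
  assumes "x \<in> U" "smooth_on U f" "smooth_on U g"
  shows "grad (\<lambda>x. f x - g x) x = grad f x - grad g x"
  using partial_deriv_diff[OF smooth_on_differentiable[OF assms(2,1)] smooth_on_differentiable[OF assms(3,1)]]
  by (simp add: grad_def vec_eq_iff)

lemma frob_diff_right: "frob A (B - C) = frob A B - frob A C"
  using frob_add_right[of A B "(-1) *\<^sub>R C"] by (simp only: frob_scaleR_right) simp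

lemma psd_scaleR: "psd N \<Longrightarrow> 0 \<le> c \<Longrightarrow> psd (c *\<^sub>R N)"
  by (simp add: psd_def vec_eq_iff transpose_def scaleR_matrix_vector_assoc[symmetric])

text \<open>The matrix is s M + (1 - s) N. Strict positivity of s matters, since N = t P with P of
  rank below k lies outside the open cone.\<close>

lemma in_cone_segment:
  assumes "in_cone k M" "psd N" "0 < s" "s \<le> 1"
  shows "in_cone k (N + s *\<^sub>R (M - N))"
proof -
  have "N + s *\<^sub>R (M - N) = s *\<^sub>R M + (1 - s) *\<^sub>R N" by (simp add: algebra_simps)
  then show ?thesis
    using in_cone_add_psd(1)[OF in_cone_scaleR[OF assms(1,3)] psd_scaleR[OF assms(2), of "1 - s"]] assms(4) by simp
qed

text \<open>Euler's relation for \<open>M\<^sub>s = t P + s D\<^sup>2(F - b)\<close> expresses \<open>t T(M\<^sub>s) \<cdot> P\<close> through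
  \<open>\<sigma>\<^sub>k(M\<^sub>s)\<close> and \<open>T(M\<^sub>s) \<cdot> D\<^sup>2(F - b)\<close>; weighted with \<open>b - F\<close> the latter has a sign after
  integration by parts, and the same sign makes the weighted integral of \<open>\<sigma>\<^sub>k(M\<^sub>s)\<close> monotone.\<close>

lemma energy_bound:
  fixes b F :: "real^'n \<Rightarrow> real" and P :: "real^'n^'n"
  assumes Om: "open \<Omega>" "convex \<Omega>" "bounded \<Omega>"
    and U: "open U" "closure \<Omega> \<subseteq> U" and b: "smooth_on U b" and F: "smooth_on U F"
    and hb: "\<And>x. x \<in> U \<Longrightarrow> hessian b x = t *\<^sub>R P" and P: "psd P" and t: "0 < t" and k: "1 \<le> k"
    and bdry: "\<And>x. x \<in> frontier \<Omega> \<Longrightarrow> F x = b x"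
    and cone: "\<And>x. x \<in> \<Omega> \<Longrightarrow> in_cone k (hessian F x)"
    and bounds: "\<And>x. x \<in> \<Omega> \<Longrightarrow> F x \<le> b x" "\<And>x. x \<in> \<Omega> \<Longrightarrow> b x - C \<le> F x"
    and s: "0 < s" "s < 1"
  shows "t * (LINT x:\<Omega>|lborel. (b x - F x) * frob (hsig_grad k (hessian (\<lambda>x. b x + s * (F x - b x)) x)) P)
    \<le> real k * C * (LINT x:\<Omega>|lborel. hsig k (hessian F x))"
proof -
  \<comment> \<open>e is nonpositive on the domain and vanishes on the frontier; the nonnegative
    weight is \<open>- e\<close>, which is at most C.\<close>
  define e where "e x = F x - b x" for x
  define y where "y r x = b x + r * e x" for r x
  have sme: "smooth_on U e" unfolding e_def by (intro smooth_on_diff F b)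
  have smy: "smooth_on U (y r)" for r unfolding y_def by (intro smooth_on_add smooth_on_mult smooth_on_const b sme)
  have OmU: "x \<in> U" if "x \<in> \<Omega>" for x using that U(2) closure_subset by blast
  have he: "hessian e x = hessian F x - t *\<^sub>R P" if "x \<in> U" for x
    using hessian_diff[OF U(1) that F b] hb[OF that] unfolding e_def by simp
  have hy: "hessian (y r) x = t *\<^sub>R P + r *\<^sub>R hessian e x" if "x \<in> U" for r x
    unfolding y_def hessian_add_cmult[OF U(1) that b sme] hb[OF that] ..
  have ptP: "psd (t *\<^sub>R P)" by (rule psd_scaleR[OF P]) (use t in simp)
  have cy: "in_cone k (hessian (y r) x)" if "x \<in> \<Omega>" "0 < r" "r \<le> 1" for r x
    unfolding hy[OF OmU[OF that(1)]] he[OF OmU[OF that(1)]] by (rule in_cone_segment[OF cone[OF that(1)] ptP that(2,3)])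
  have T: "smooth_on U (\<lambda>x. hsig_grad k (hessian (y r) x) $ i $ j)" for r i j
    by (intro smooth_on_hsig_grad smooth_on_hessian U smy)
  have sP: "smooth_on U (\<lambda>x. P $ i $ j)" for i j by (rule smooth_on_const)
  have E0: "(LINT x:\<Omega>|lborel. e x * frob (hsig_grad k (hessian (y r) x)) (hessian e x)) \<le> 0" if "0 < r" "r \<le> 1" for r
  proof -
    have "0 \<le> (LINT x:\<Omega>|lborel. grad e x \<bullet> (hsig_grad k (hessian (y r) x) *v grad e x))"
      unfolding set_lebesgue_integral_def
      by (rule integral_nonneg_AE, rule AE_I2) (use hsig_grad_nonneg[OF cy k] that in \<open>auto simp: indicator_def\<close>)
    then show ?thesis
      using energy_identity[OF Om U smy[of r] sme, of k] bdry by (simp add: e_def)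
  qed
  \<comment> \<open>Weighted integral of sigma_k along the path. Its derivative is minus the energy
    expression, hence nonnegative for 0 < r <= 1, and its value at r = 1 is at most C times the
    integral of sigma_k(D^2 F).\<close>
  define \<Psi> where "\<Psi> r = (LINT x:\<Omega>|lborel. hsig k (t *\<^sub>R P + r *\<^sub>R hessian e x) * (- e x))" for r
  have d\<Psi>: "(\<Psi> has_real_derivative
      (LINT x:\<Omega>|lborel. frob (hsig_grad k (t *\<^sub>R P + r *\<^sub>R hessian e x)) (hessian e x) * (- e x))) (at r)" for r
    unfolding \<Psi>_def
  proof (rule has_real_derivative_integral_hsig[OF Om(1,3) U(2)])
    show "smooth_on U (\<lambda>x. (t *\<^sub>R P) $ i $ j)" for i j by (rule smooth_on_const)
    show "smooth_on U (\<lambda>x. hessian e x $ i $ j)" for i j by (rule smooth_on_hessian[OF U(1) sme])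
    show "smooth_on U (\<lambda>x. - e x)" using smooth_on_diff[OF smooth_on_const[of U 0] sme] by simp
  qed
  have d\<Psi>_nonneg: "0 \<le> (LINT x:\<Omega>|lborel. frob (hsig_grad k (t *\<^sub>R P + r *\<^sub>R hessian e x)) (hessian e x) * (- e x))"
    if "0 < r" "r \<le> 1" for r
  proof -
    have "(LINT x:\<Omega>|lborel. frob (hsig_grad k (t *\<^sub>R P + r *\<^sub>R hessian e x)) (hessian e x) * (- e x)) =
        (LINT x:\<Omega>|lborel. - (e x * frob (hsig_grad k (hessian (y r) x)) (hessian e x)))"
      using Om hy OmU by (intro set_lebesgue_integral_cong) (auto simp: mult.commute)
    also have "\<dots> = - (LINT x:\<Omega>|lborel. e x * frob (hsig_grad k (hessian (y r) x)) (hessian e x))"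
      by (rule set_integral_uminus, rule set_integrable_smooth[OF Om(1,3) U(2)])
        (intro smooth_on_mult smooth_on_frob T sme smooth_on_hessian U)
    finally show ?thesis using E0[OF that] by simp
  qed
  define \<Psi>' where "\<Psi>' r =
      (LINT x:\<Omega>|lborel. frob (hsig_grad k (t *\<^sub>R P + r *\<^sub>R hessian e x)) (hessian e x) * (- e x))" for r
  \<comment> \<open>The intermediate point exceeds s > 0, so the matrices there lie in the cone and
    the sign of the derivative applies.\<close>
  have "\<exists>z>s. z < 1 \<and> \<Psi> 1 - \<Psi> s = (1 - s) * \<Psi>' z"
    by (rule MVT2[OF s(2)]) (unfold \<Psi>'_def, rule d\<Psi>)
  then obtain z where z: "s < z" "z < 1" "\<Psi> 1 - \<Psi> s = (1 - s) *
      (LINT x:\<Omega>|lborel. frob (hsig_grad k (t *\<^sub>R P + z *\<^sub>R hessian e x)) (hessian e x) * (- e x))"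
    unfolding \<Psi>'_def by blast
  have "0 \<le> \<Psi> 1 - \<Psi> s" unfolding z(3) using d\<Psi>_nonneg[of z] z s by (intro mult_nonneg_nonneg) auto
  then have "\<Psi> s \<le> \<Psi> 1" by simp
  also have "\<Psi> 1 \<le> (LINT x:\<Omega>|lborel. C * hsig k (hessian F x))"
  proof -
    have "\<Psi> 1 = (LINT x:\<Omega>|lborel. hsig k (hessian F x) * (- e x))"
      unfolding \<Psi>_def using Om he OmU by (intro set_lebesgue_integral_cong) auto
    also have "\<dots> \<le> (LINT x:\<Omega>|lborel. C * hsig k (hessian F x))"
    proof (rule set_integral_mono)
      show "set_integrable lborel \<Omega> (\<lambda>x. hsig k (hessian F x) * - e x)"
      proof (rule set_integrable_smooth[OF Om(1,3) U(2)])
        have "smooth_on U (\<lambda>x. - e x)" using smooth_on_diff[OF smooth_on_const[of U 0] sme] by simp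
        then show "smooth_on U (\<lambda>x. hsig k (hessian F x) * - e x)"
          by (intro smooth_on_mult smooth_on_hsig smooth_on_hessian U F)
      qed
      show "set_integrable lborel \<Omega> (\<lambda>x. C * hsig k (hessian F x))"
        by (rule set_integrable_smooth[OF Om(1,3) U(2)])
          (intro smooth_on_mult smooth_on_const smooth_on_hsig smooth_on_hessian U F)
      fix x assume x: "x \<in> \<Omega>"
      have "0 < hsig k (hessian F x)" using cone[OF x] k by (simp add: in_cone_def)
      then have "hsig k (hessian F x) * (- e x) \<le> hsig k (hessian F x) * C"
        using bounds(2)[OF x] by (intro mult_left_mono) (auto simp: e_def)
      then show "hsig k (hessian F x) * - e x \<le> C * hsig k (hessian F x)" by (simp add: mult.commute)
    qed
    finally show ?thesis .
  qed
  finally have \<Psi>s: "\<Psi> s \<le> C * (LINT x:\<Omega>|lborel. hsig k (hessian F x))" by simp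
  \<comment> \<open>Euler's relation multiplied by \<open>- e\<close>; the last term has nonpositive
    integral and is dropped at the end.\<close>
  have pw: "t * ((- e x) * frob (hsig_grad k (hessian (y s) x)) P) =
      real k * (hsig k (t *\<^sub>R P + s *\<^sub>R hessian e x) * (- e x)) +
      s * (e x * frob (hsig_grad k (hessian (y s) x)) (hessian e x))" if "x \<in> \<Omega>" for x
  proof -
    let ?M = "hessian (y s) x"
    have "t * frob (hsig_grad k ?M) P + s * frob (hsig_grad k ?M) (hessian e x) = real k * hsig k ?M"
      using hsig_euler[of k ?M] by (subst (asm) (2) hy[OF OmU[OF that]]) (simp add: frob_add_right frob_scaleR_right)
    then have "t * frob (hsig_grad k ?M) P = real k * hsig k ?M - s * frob (hsig_grad k ?M) (hessian e x)" by simp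
    then have "(- e x) * (t * frob (hsig_grad k ?M) P) = (- e x) * (real k * hsig k ?M - s * frob (hsig_grad k ?M) (hessian e x))"
      by simp
    then show ?thesis unfolding hy[OF OmU[OF that], symmetric] by (simp add: algebra_simps)
  qed
  have "t * (LINT x:\<Omega>|lborel. (- e x) * frob (hsig_grad k (hessian (y s) x)) P) =
      (LINT x:\<Omega>|lborel. t * ((- e x) * frob (hsig_grad k (hessian (y s) x)) P))"
    by (rule set_integral_mult_right[symmetric])
  also have "\<dots> = (LINT x:\<Omega>|lborel. real k * (hsig k (t *\<^sub>R P + s *\<^sub>R hessian e x) * (- e x)) +
      s * (e x * frob (hsig_grad k (hessian (y s) x)) (hessian e x)))"
    using Om pw by (intro set_lebesgue_integral_cong) auto
  also have "\<dots> = real k * \<Psi> s + s * (LINT x:\<Omega>|lborel. e x * frob (hsig_grad k (hessian (y s) x)) (hessian e x))"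
  proof -
    have "smooth_on U (\<lambda>x. (t *\<^sub>R P + s *\<^sub>R hessian e x) $ i $ j)" for i j
      using smooth_on_add[OF smooth_on_const[of U "(t *\<^sub>R P) $ i $ j"]
          smooth_on_mult[OF smooth_on_const[of U s] smooth_on_hessian[OF U(1) sme, of i j]]] by simp
    moreover have "smooth_on U (\<lambda>x. - e x)" using smooth_on_diff[OF smooth_on_const[of U 0] sme] by simp
    ultimately have 1: "set_integrable lborel \<Omega> (\<lambda>x. real k * (hsig k (t *\<^sub>R P + s *\<^sub>R hessian e x) * (- e x)))"
      by (intro set_integrable_smooth[OF Om(1,3) U(2)] smooth_on_mult smooth_on_const smooth_on_hsig)
    have 2: "set_integrable lborel \<Omega> (\<lambda>x. s * (e x * frob (hsig_grad k (hessian (y s) x)) (hessian e x)))"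
      by (intro set_integrable_smooth[OF Om(1,3) U(2)] smooth_on_mult smooth_on_const sme smooth_on_frob T smooth_on_hessian U)
    show ?thesis unfolding set_integral_add(2)[OF 1 2] \<Psi>_def set_integral_mult_right ..
  qed
  also have "\<dots> \<le> real k * \<Psi> s + s * 0"
    using E0[of s] s by (intro add_left_mono mult_left_mono) auto
  also have "\<dots> \<le> real k * (C * (LINT x:\<Omega>|lborel. hsig k (hessian F x)))"
    using \<Psi>s by (simp add: mult_left_mono)
  finally have "t * (LINT x:\<Omega>|lborel. (- e x) * frob (hsig_grad k (hessian (y s) x)) P) \<le>
      real k * (C * (LINT x:\<Omega>|lborel. hsig k (hessian F x)))" .
  moreover have "y s = (\<lambda>x. b x + s * (F x - b x))" by (simp add: y_def e_def fun_eq_iff)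
  ultimately show ?thesis by (simp add: e_def mult.assoc)
qed

lemma hessian_exp_inner:
  fixes \<xi> :: "real^'n"
  shows "hessian (\<lambda>x. exp (\<xi> \<bullet> x)) x = exp (\<xi> \<bullet> x) *\<^sub>R rank_one \<xi>"
proof -
  have d: "partial_deriv j (\<lambda>x. exp (\<xi> \<bullet> x)) y = \<xi> $ j * exp (\<xi> \<bullet> y)" for j y
  proof -
    have "((\<lambda>x. exp (\<xi> \<bullet> x)) has_derivative (\<lambda>v. exp (\<xi> \<bullet> y) * (\<xi> \<bullet> v))) (at y)"
      by (auto intro!: derivative_eq_intros)
    from partial_derivI[OF this, of j] show ?thesis by (simp add: inner_axis)
  qed
  have "partial_deriv i (\<lambda>x. \<xi> $ j * exp (\<xi> \<bullet> x)) x = \<xi> $ j * (\<xi> $ i * exp (\<xi> \<bullet> x))" for i j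
    using partial_deriv_cmult[OF smooth_on_differentiable[OF smooth_on_exp_inner[of UNIV \<xi>] UNIV_I], of i "\<xi> $ j" x]
    by (simp add: d)
  moreover have "partial_deriv j (\<lambda>x. exp (\<xi> \<bullet> x)) = (\<lambda>x. \<xi> $ j * exp (\<xi> \<bullet> x))" for j using d by blast
  ultimately show ?thesis by (simp add: hessian_def rank_one_def vec_eq_iff)
qed

lemma rank_one_scaleR: "rank_one (a *\<^sub>R v) = a\<^sup>2 *\<^sub>R rank_one v"
  by (simp add: rank_one_def vec_eq_iff power2_eq_square)

text \<open>The Hessian of h = exp(a v . x) is a^2 h v v^T, and P dominates v v^T, so T . D^2 h is
  at most a^2 H T . P. The energy bound then contributes k C times the integral of sigma_k, divided
  by t, once for each solution.\<close>

lemma exponential_moment_estimate: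
  fixes b F1 F2 :: "real^'n \<Rightarrow> real" and P :: "real^'n^'n" and v :: "real^'n"
  assumes Om: "open \<Omega>" "convex \<Omega>" "bounded \<Omega>"
    and U: "open U" "closure \<Omega> \<subseteq> U" and b: "smooth_on U b" and F: "smooth_on U F1" "smooth_on U F2"
    and hb: "\<And>x. x \<in> U \<Longrightarrow> hessian b x = t *\<^sub>R P" and P: "psd P" "psd (P - rank_one v)" and t: "0 < t" and k: "1 \<le> k"
    and bdry: "\<And>x. x \<in> frontier \<Omega> \<Longrightarrow> F1 x = b x" "\<And>x. x \<in> frontier \<Omega> \<Longrightarrow> F2 x = b x"
    and cauchy: "\<And>x. x \<in> frontier \<Omega> \<Longrightarrow> grad F1 x = grad F2 x"
      "\<And>x. x \<in> frontier \<Omega> \<Longrightarrow> \<exists>c \<nu> a. hessian F1 x - hessian F2 x = c *\<^sub>R rank_one \<nu> \<and> grad F1 x - grad b x = a *\<^sub>R \<nu>"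
    and cone: "\<And>x. x \<in> \<Omega> \<Longrightarrow> in_cone k (hessian F1 x)" "\<And>x. x \<in> \<Omega> \<Longrightarrow> in_cone k (hessian F2 x)"
    and bounds: "\<And>x. x \<in> \<Omega> \<Longrightarrow> F1 x \<le> b x" "\<And>x. x \<in> \<Omega> \<Longrightarrow> b x - C \<le> F1 x"
      "\<And>x. x \<in> \<Omega> \<Longrightarrow> F2 x \<le> b x" "\<And>x. x \<in> \<Omega> \<Longrightarrow> b x - C \<le> F2 x"
    and H: "\<And>x. x \<in> \<Omega> \<Longrightarrow> exp ((a *\<^sub>R v) \<bullet> x) \<le> H" "0 \<le> H"
  shows "\<bar>(LINT x:\<Omega>|lborel. hsig k (hessian F1 x) * exp ((a *\<^sub>R v) \<bullet> x)) -
     (LINT x:\<Omega>|lborel. hsig k (hessian F2 x) * exp ((a *\<^sub>R v) \<bullet> x))\<bar> \<le>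
    (a\<^sup>2 * H * real k * C * ((LINT x:\<Omega>|lborel. hsig k (hessian F1 x)) + (LINT x:\<Omega>|lborel. hsig k (hessian F2 x)))) / t"
proof -
  define h where "h x = exp ((a *\<^sub>R v) \<bullet> x)" for x
  have smh: "smooth_on U h" unfolding h_def by (rule smooth_on_exp_inner)
  have hh: "hessian h x = (h x * a\<^sup>2) *\<^sub>R rank_one v" for x
    unfolding h_def hessian_exp_inner by (simp add: rank_one_scaleR)
  have OmU: "x \<in> U" if "x \<in> \<Omega>" for x using that U(2) closure_subset by blast
  have frU: "x \<in> U" if "x \<in> frontier \<Omega>" for x using that U(2) by (auto simp: frontier_def)
  have ptP: "psd (t *\<^sub>R P)" by (rule psd_scaleR[OF P(1)]) (use t in simp)
  define y where "y F s x = b x + s * (F x - b x)" for F s and x :: "real^'n"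
  have sme: "smooth_on U (\<lambda>x. F x - b x)" if "smooth_on U F" for F by (intro smooth_on_diff that b)
  have smy: "smooth_on U (y F s)" if "smooth_on U F" for F s
    unfolding y_def by (intro smooth_on_add smooth_on_mult smooth_on_const b sme that)
  have hy: "hessian (y F s) x = t *\<^sub>R P + s *\<^sub>R hessian (\<lambda>x. F x - b x) x" if "x \<in> U" "smooth_on U F" for F s x
    unfolding y_def hessian_add_cmult[OF U(1) that(1) b sme[OF that(2)]] hb[OF that(1)] ..
  have he: "hessian (\<lambda>x. F x - b x) x = hessian F x - t *\<^sub>R P" if "x \<in> U" "smooth_on U F" for F x
    using hessian_diff[OF U(1) that b] hb[OF that(1)] by simp
  define \<Phi> where "\<Phi> F s = (LINT x:\<Omega>|lborel. hsig k (t *\<^sub>R P + s *\<^sub>R hessian (\<lambda>x. F x - b x) x) * h x)" for F s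
  define \<Phi>' where "\<Phi>' F s = (LINT x:\<Omega>|lborel. frob (hsig_grad k (t *\<^sub>R P + s *\<^sub>R hessian (\<lambda>x. F x - b x) x))
      (hessian (\<lambda>x. F x - b x) x) * h x)" for F s
  have d\<Phi>: "(\<Phi> F has_real_derivative \<Phi>' F s) (at s)" if "smooth_on U F" for F s
    unfolding \<Phi>_def \<Phi>'_def
    by (rule has_real_derivative_integral_hsig[OF Om(1,3) U(2) smooth_on_const smooth_on_hessian[OF U(1) sme[OF that]] smh])
  \<comment> \<open>The mean value theorem is applied to the difference of the two functions and not
    to each of them: the boundary fluxes agree only when both are taken at the same s.\<close>
  have "\<exists>z>0. z < 1 \<and> (\<Phi> F1 1 - \<Phi> F2 1) - (\<Phi> F1 0 - \<Phi> F2 0) = (1 - 0) * (\<Phi>' F1 z - \<Phi>' F2 z)"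
    by (rule MVT2) (auto intro!: DERIV_diff d\<Phi> F)
  then obtain s where s: "0 < s" "s < 1"
    and mv: "(\<Phi> F1 1 - \<Phi> F2 1) - (\<Phi> F1 0 - \<Phi> F2 0) = \<Phi>' F1 s - \<Phi>' F2 s" by auto
  \<comment> \<open>At s = 0 both paths start from the same matrix t P.\<close>
  have \<Phi>0: "\<Phi> F1 0 = \<Phi> F2 0" by (simp add: \<Phi>_def)
  have \<Phi>1: "\<Phi> F 1 = (LINT x:\<Omega>|lborel. hsig k (hessian F x) * h x)" if "smooth_on U F" for F
    unfolding \<Phi>_def using Om he[OF _ that] OmU by (intro set_lebesgue_integral_cong) auto
  define T where "T F x = hsig_grad k (hessian (y F s) x)" for F x
  have \<Phi>'s: "\<Phi>' F s = (LINT x:\<Omega>|lborel. frob (T F x) (hessian (\<lambda>x. F x - b x) x) * h x)" if "smooth_on U F" for F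
    unfolding \<Phi>'_def T_def using Om hy[OF _ that] OmU by (intro set_lebesgue_integral_cong) auto
  have "\<Phi>' F1 s - \<Phi>' F2 s =
     (LINT x:\<Omega>|lborel. (F1 x - b x) * frob (T F1 x) (hessian h x)) -
      (LINT x:\<Omega>|lborel. (F2 x - b x) * frob (T F2 x) (hessian h x))"
    unfolding \<Phi>'s[OF F(1)] \<Phi>'s[OF F(2)] T_def
  proof (rule flux_identity[OF Om U smy[OF F(1)] smy[OF F(2)] sme[OF F(1)] sme[OF F(2)] smh])
    fix x assume x: "x \<in> frontier \<Omega>"
    show "F1 x - b x = 0" "F2 x - b x = 0" using bdry x by auto
    obtain c \<nu> a where c: "hessian F1 x - hessian F2 x = c *\<^sub>R rank_one \<nu>" "grad F1 x - grad b x = a *\<^sub>R \<nu>"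
      using cauchy(2)[OF x] by blast
    have g: "grad (\<lambda>x. F1 x - b x) x = a *\<^sub>R \<nu>" "grad (\<lambda>x. F2 x - b x) x = a *\<^sub>R \<nu>"
      using grad_diff[OF frU[OF x] F(1) b] grad_diff[OF frU[OF x] F(2) b] c(2) cauchy(1)[OF x] by simp_all
    \<comment> \<open>On the frontier the two paths differ by s c \<nu> \<nu>^T, and T is applied
      only to multiples of \<nu>, on which it does not see this difference.\<close>
    have "hessian (y F1 s) x = hessian (y F2 s) x + s *\<^sub>R (hessian F1 x - hessian F2 x)"
      unfolding hy[OF frU[OF x] F(1)] hy[OF frU[OF x] F(2)] he[OF frU[OF x] F(1)] he[OF frU[OF x] F(2)]
      by (simp add: algebra_simps)
    then have "hessian (y F1 s) x = hessian (y F2 s) x + (s * c) *\<^sub>R rank_one \<nu>" unfolding c(1) by simp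
    then have "hsig_grad k (hessian (y F1 s) x) *v \<nu> = hsig_grad k (hessian (y F2 s) x) *v \<nu>"
      by (simp only: hsig_grad_add_rank_one_mult)
    then show "hsig_grad k (hessian (y F1 s) x) *v grad (\<lambda>x. F1 x - b x) x =
       hsig_grad k (hessian (y F2 s) x) *v grad (\<lambda>x. F2 x - b x) x"
      unfolding g by (simp add: matrix_vector_mult_scaleR)
  qed
  then have diff: "(LINT x:\<Omega>|lborel. hsig k (hessian F1 x) * h x) - (LINT x:\<Omega>|lborel. hsig k (hessian F2 x) * h x) =
     (LINT x:\<Omega>|lborel. (F1 x - b x) * frob (T F1 x) (hessian h x)) -
      (LINT x:\<Omega>|lborel. (F2 x - b x) * frob (T F2 x) (hessian h x))"
    using mv \<Phi>0 \<Phi>1[OF F(1)] \<Phi>1[OF F(2)] by linarith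
  have est: "\<bar>LINT x:\<Omega>|lborel. (F x - b x) * frob (T F x) (hessian h x)\<bar> \<le>
      a\<^sup>2 * H * ((real k * C * (LINT x:\<Omega>|lborel. hsig k (hessian F x))) / t)"
    if F': "smooth_on U F" "\<And>x. x \<in> frontier \<Omega> \<Longrightarrow> F x = b x" "\<And>x. x \<in> \<Omega> \<Longrightarrow> in_cone k (hessian F x)"
      "\<And>x. x \<in> \<Omega> \<Longrightarrow> F x \<le> b x" "\<And>x. x \<in> \<Omega> \<Longrightarrow> b x - C \<le> F x" for F
  proof -
    have sT: "smooth_on U (\<lambda>x. T F x $ i $ j)" for i j
      unfolding T_def by (intro smooth_on_hsig_grad smooth_on_hessian U smy F')
    have i1: "set_integrable lborel \<Omega> (\<lambda>x. (F x - b x) * frob (T F x) (hessian h x))"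
      by (intro set_integrable_smooth[OF Om(1,3) U(2)] smooth_on_mult sme smooth_on_frob sT smooth_on_hessian U smh F')
    have i2: "set_integrable lborel \<Omega> (\<lambda>x. (a\<^sup>2 * H) * ((b x - F x) * frob (T F x) P))"
      by (intro set_integrable_smooth[OF Om(1,3) U(2)] smooth_on_mult smooth_on_const smooth_on_diff smooth_on_frob sT F' b)
    have pw: "\<bar>(F x - b x) * frob (T F x) (hessian h x)\<bar> \<le> (a\<^sup>2 * H) * ((b x - F x) * frob (T F x) P)" if x: "x \<in> \<Omega>" for x
    proof -
      have cn: "in_cone k (hessian (y F s) x)"
        unfolding hy[OF OmU[OF x] F'(1)] he[OF OmU[OF x] F'(1)]
        by (rule in_cone_segment[OF F'(3)[OF x] ptP]) (use s in auto)
      have 0: "0 \<le> frob (T F x) (rank_one v)"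
        unfolding T_def frob_rank_one by (rule hsig_grad_nonneg[OF cn k])
      have "0 \<le> frob (T F x) (P - rank_one v)"
        unfolding T_def by (rule frob_hsig_grad_psd_nonneg[OF cn k P(2)])
      then have 1: "frob (T F x) (rank_one v) \<le> frob (T F x) P" by (simp add: frob_diff_right)
      have hx: "0 < h x" "h x \<le> H" using H(1)[OF x] by (simp_all add: h_def)
      have bF: "0 \<le> b x - F x" using F'(4)[OF x] by simp
      have "\<bar>(F x - b x) * frob (T F x) (hessian h x)\<bar> = (b x - F x) * (h x * a\<^sup>2 * frob (T F x) (rank_one v))"
        using 0 hx bF by (simp add: hh frob_scaleR_right abs_mult)
      also have "\<dots> \<le> (b x - F x) * (H * a\<^sup>2 * frob (T F x) P)"
        using 0 1 hx bF H(2) by (intro mult_left_mono mult_mono) auto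
      finally show ?thesis by (simp add: mult_ac)
    qed
    have "\<bar>LINT x:\<Omega>|lborel. (F x - b x) * frob (T F x) (hessian h x)\<bar> \<le>
        (LINT x:\<Omega>|lborel. (a\<^sup>2 * H) * ((b x - F x) * frob (T F x) P))"
    proof -
      have "(LINT x:\<Omega>|lborel. (F x - b x) * frob (T F x) (hessian h x)) \<le>
        (LINT x:\<Omega>|lborel. (a\<^sup>2 * H) * ((b x - F x) * frob (T F x) P))"
        by (rule set_integral_mono[OF i1 i2]) (use pw in \<open>simp add: abs_le_iff\<close>)
      moreover have "(LINT x:\<Omega>|lborel. - ((F x - b x) * frob (T F x) (hessian h x))) \<le>
        (LINT x:\<Omega>|lborel. (a\<^sup>2 * H) * ((b x - F x) * frob (T F x) P))"
      proof (rule set_integral_mono[OF _ i2])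
        show "set_integrable lborel \<Omega> (\<lambda>x. - ((F x - b x) * frob (T F x) (hessian h x)))"
          using set_integral_diff(1)[OF set_integrable_smooth[OF Om(1,3) U(2) smooth_on_const[of U 0]] i1] by simp
        show "- ((F x - b x) * frob (T F x) (hessian h x)) \<le> (a\<^sup>2 * H) * ((b x - F x) * frob (T F x) P)" if "x \<in> \<Omega>" for x
          using pw[OF that] by (simp only: abs_le_iff)
      qed
      ultimately show ?thesis unfolding set_integral_uminus[OF i1] by (simp add: abs_le_iff)
    qed
    also have "\<dots> = (a\<^sup>2 * H) * (LINT x:\<Omega>|lborel. (b x - F x) * frob (T F x) P)" by simp
    also have "\<dots> \<le> (a\<^sup>2 * H) * ((real k * C * (LINT x:\<Omega>|lborel. hsig k (hessian F x))) / t)"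
    proof (rule mult_left_mono)
      show "(LINT x:\<Omega>|lborel. (b x - F x) * frob (T F x) P) \<le> (real k * C * (LINT x:\<Omega>|lborel. hsig k (hessian F x))) / t"
      proof -
        have "y F s = (\<lambda>x. b x + s * (F x - b x))" by (simp add: y_def fun_eq_iff)
        then show ?thesis
          using energy_bound[OF Om U b F'(1) hb P(1) t k F'(2,3,4,5) s] t
          unfolding T_def by (simp add: pos_le_divide_eq mult.commute)
      qed
    qed (use H(2) in simp)
    finally show ?thesis .
  qed
  have "\<bar>(LINT x:\<Omega>|lborel. hsig k (hessian F1 x) * h x) - (LINT x:\<Omega>|lborel. hsig k (hessian F2 x) * h x)\<bar> \<le>
     a\<^sup>2 * H * ((real k * C * (LINT x:\<Omega>|lborel. hsig k (hessian F1 x))) / t) +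
     a\<^sup>2 * H * ((real k * C * (LINT x:\<Omega>|lborel. hsig k (hessian F2 x))) / t)"
    unfolding diff
    using est[OF F(1) bdry(1) cone(1) bounds(1,2)] est[OF F(2) bdry(2) cone(2) bounds(3,4)] by linarith
  also have "\<dots> = (a\<^sup>2 * H * real k * C * ((LINT x:\<Omega>|lborel. hsig k (hessian F1 x)) + (LINT x:\<Omega>|lborel. hsig k (hessian F2 x)))) / t"
    by (simp add: add_divide_distrib distrib_left mult_ac)
  finally show ?thesis unfolding h_def .
qed

section \<open>Quadratic functions and barriers\<close>

definition quad :: "real^'n^'n \<Rightarrow> real^'n \<Rightarrow> real" where
  "quad N x = (x \<bullet> (N *v x)) / 2"

lemma smooth_on_quad: "smooth_on U (quad N)"
proof -
  have c: "smooth_on U (\<lambda>x. x $ i)" for i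
    by (rule smooth_on_bounded_linear) (rule bounded_linear_vec_nth)
  have "quad N = (\<lambda>x. (1 / 2) * (\<Sum>i\<in>UNIV. x $ i * (\<Sum>j\<in>UNIV. N $ i $ j * x $ j)))"
    by (simp add: fun_eq_iff quad_def inner_vec_def matrix_vector_mult_def)
  then show ?thesis by (simp only:) (intro smooth_on_mult smooth_on_sum smooth_on_const c)
qed

lemma hessian_quad:
  assumes N: "transpose N = N"
  shows "hessian (quad N) x = N"
proof -
  have sym: "v \<bullet> (N *v y) = y \<bullet> (N *v v)" for v y
    by (metis N dot_lmul_matrix inner_commute vector_transpose_matrix)
  have lin: "bounded_linear (\<lambda>y. N *v y)" by (rule matrix_vector_mul_bounded_linear)
  have pd: "partial_deriv j (quad N) y = (N *v y) $ j" for j y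
  proof -
    have "((\<lambda>x. (1 / 2) * (x \<bullet> (N *v x))) has_derivative (\<lambda>v. (1 / 2) * (y \<bullet> (N *v v) + v \<bullet> (N *v y)))) (at y)"
      by (intro has_derivative_mult_right has_derivative_inner has_derivative_ident bounded_linear_imp_has_derivative[OF lin])
    moreover have "(\<lambda>v. (1 / 2) * (y \<bullet> (N *v v) + v \<bullet> (N *v y))) = (\<lambda>v. v \<bullet> (N *v y))"
      using sym[of y] by (simp add: fun_eq_iff)
    moreover have "(\<lambda>x. (1 / 2) * (x \<bullet> (N *v x))) = quad N" by (simp add: fun_eq_iff quad_def)
    ultimately have "(quad N has_derivative (\<lambda>v. v \<bullet> (N *v y))) (at y)" by simp
    from partial_derivI[OF this] show ?thesis by (simp add: inner_axis' inner_commute)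
  qed
  have "partial_deriv i (\<lambda>y. (N *v y) $ j) x = N $ j $ i" for i j
  proof -
    have "((\<lambda>y. (N *v y) $ j) has_derivative (\<lambda>y. (N *v y) $ j)) (at x)"
      by (rule bounded_linear_imp_has_derivative, rule bounded_linear_compose[OF bounded_linear_vec_nth lin])
    from partial_derivI[OF this] show ?thesis
      by (simp add: matrix_vector_mult_basis column_def)
  qed
  moreover have "partial_deriv j (quad N) = (\<lambda>y. (N *v y) $ j)" for j using pd by blast
  moreover have "N $ j $ i = N $ i $ j" for i j
    using arg_cong[OF N, of "\<lambda>M. M $ i $ j"] by (simp add: transpose_def)
  ultimately show ?thesis by (simp add: hessian_def vec_eq_iff)
qed

lemma transpose_pencil:
  "transpose A = A \<Longrightarrow> transpose B = B \<Longrightarrow> transpose (A + c *\<^sub>R B) = A + c *\<^sub>R B"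
  by (simp add: transpose_def vec_eq_iff)

lemma psd_add: "psd A \<Longrightarrow> psd B \<Longrightarrow> psd (A + B)"
  by (simp add: psd_def transpose_def vec_eq_iff matrix_vector_mult_add_rdistrib inner_add_right)

text \<open>Maximum principle: an interior minimum of \<open>quad N - F\<close> would give D^2 F <=
  N there, and monotonicity on the cone would bound the positive number sigma_k(D^2 F) by sigma_k(N)
  = 0.\<close>

lemma solution_below_quadratic:
  fixes F :: "real^'n \<Rightarrow> real" and N :: "real^'n^'n"
  assumes Om: "open \<Omega>" "bounded \<Omega>"
    and U: "open U" "closure \<Omega> \<subseteq> U" "smooth_on U F" and N: "transpose N = N"
    and bdry: "\<And>x. x \<in> frontier \<Omega> \<Longrightarrow> F x = quad N x"
    and k: "1 \<le> k" and cone: "\<And>x. x \<in> \<Omega> \<Longrightarrow> in_cone k (hessian F x)" and rank: "hsig k N = 0"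
    and x: "x \<in> \<Omega>"
  shows "F x \<le> quad N x"
proof -
  let ?g = "\<lambda>x. quad N x - F x"
  have sg: "smooth_on U ?g" by (intro smooth_on_diff smooth_on_quad U)
  have "continuous_on (closure \<Omega>) ?g"
    by (rule continuous_on_subset[OF smooth_on_continuous[OF sg] U(2)])
  moreover have "compact (closure \<Omega>)" using Om by (simp add: compact_closure)
  moreover have "closure \<Omega> \<noteq> {}" using x closure_subset by blast
  ultimately have "\<exists>z\<in>closure \<Omega>. \<forall>y\<in>closure \<Omega>. ?g z \<le> ?g y"
    by (intro continuous_attains_inf)
  then obtain z where z: "z \<in> closure \<Omega>" "\<And>y. y \<in> closure \<Omega> \<Longrightarrow> ?g z \<le> ?g y"
    by blast
  have "z \<notin> \<Omega>"
  proof
    assume zO: "z \<in> \<Omega>"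
    then have zU: "z \<in> U" using U(2) closure_subset by blast
    have sgO: "smooth_on \<Omega> ?g" by (rule smooth_on_subset[OF sg]) (use U(2) closure_subset in blast)
    have "psd (hessian ?g z)"
      by (rule hessian_psd_at_local_min[OF Om(1) sgO zO]) (use z(2) closure_subset in blast)
    then have "psd (N - hessian F z)"
      unfolding hessian_diff[OF U(1) zU smooth_on_quad U(3)] hessian_quad[OF N] .
    from in_cone_add_psd(2)[OF cone[OF zO] this, of k] k
    have "hsig k (hessian F z) \<le> hsig k N" by simp
    moreover have "0 < hsig k (hessian F z)" using cone[OF zO] k by (simp add: in_cone_def)
    ultimately show False using rank by simp
  qed
  then have "z \<in> frontier \<Omega>" using z(1) by (simp add: frontier_def interior_open[OF Om(1)])
  then have "?g z = 0" using bdry by simp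
  moreover have "?g z \<le> ?g x" using z(2)[of x] x closure_subset by blast
  ultimately show ?thesis by simp
qed

lemma mat_one_eq_diag: "(mat 1 :: real^'n^'n) = diag_mat (\<chi> i. 1)"
  by (simp add: mat_def diag_mat_def vec_eq_iff)

lemma one_le_hsig_mat_one:
  assumes "k \<le> CARD('n)"
  shows "1 \<le> hsig k (mat 1 :: real^'n^'n)"
proof -
  obtain I :: "'n set" where "card I = k" using obtain_subset_with_card_n[OF assms] by blast
  then have "{I :: 'n set. card I = k} \<noteq> {}" by blast
  then have "1 \<le> card {I :: 'n set. card I = k}" by (simp add: Suc_le_eq card_gt_0_iff)
  then show ?thesis unfolding mat_one_eq_diag hsig_diag_mat esym_def by simp
qed

lemma in_cone_mat_one: "k \<le> CARD('n) \<Longrightarrow> in_cone k (mat 1 :: real^'n^'n)"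
proof -
  assume k: "k \<le> CARD('n)"
  have "0 < hsig j (mat 1 :: real^'n^'n)" if "j \<in> {1..k}" for j
    using one_le_hsig_mat_one[of j, where 'n = 'n] k that by simp
  then show ?thesis unfolding in_cone_def by (simp add: transpose_mat)
qed

text \<open>The barrier adds to N a multiple of the identity so large that, at an interior contact
  point, D^2 F would dominate it and push sigma_k above B. The loss (B + 1) R^2 / 2 does not involve
  N, which is what makes it uniform in t.\<close>

lemma solution_above_quadratic:
  fixes F :: "real^'n \<Rightarrow> real" and N :: "real^'n^'n"
  assumes Om: "open \<Omega>" "bounded \<Omega>"
    and U: "open U" "closure \<Omega> \<subseteq> U" "smooth_on U F" and N: "psd N"
    and bdry: "\<And>x. x \<in> frontier \<Omega> \<Longrightarrow> F x = quad N x"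
    and k: "1 \<le> k" "k \<le> CARD('n)" and upper: "\<And>x. x \<in> \<Omega> \<Longrightarrow> hsig k (hessian F x) \<le> B" and B: "0 \<le> B"
    and R: "\<And>x. x \<in> closure \<Omega> \<Longrightarrow> norm x \<le> R"
    and x: "x \<in> \<Omega>"
  shows "quad N x - (B + 1) * R\<^sup>2 / 2 \<le> F x"
proof -
  have tN: "transpose N = N" using N by (simp add: psd_def)
  \<comment> \<open>Being at least 1, A does not exceed its k-th power, and it is strictly larger
    than the bound B on sigma_k.\<close>
  define A where "A = B + 1"
  have A: "A \<ge> 1" using B by (simp add: A_def)
  define M where "M = N + A *\<^sub>R mat 1"
  have tM: "transpose M = M" unfolding M_def by (intro transpose_pencil tN) (simp add: transpose_mat)
  have qM: "quad M y = quad N y + A * (norm y)\<^sup>2 / 2" for y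
    by (simp add: quad_def M_def matrix_vector_mult_add_rdistrib scaleR_matrix_vector_assoc[symmetric]
        inner_add_right dot_square_norm add_divide_distrib)
  let ?g = "\<lambda>x. F x - quad M x"
  have sg: "smooth_on U ?g" by (intro smooth_on_diff smooth_on_quad U)
  have "continuous_on (closure \<Omega>) ?g"
    by (rule continuous_on_subset[OF smooth_on_continuous[OF sg] U(2)])
  moreover have "compact (closure \<Omega>)" using Om by (simp add: compact_closure)
  moreover have "closure \<Omega> \<noteq> {}" using x closure_subset by blast
  ultimately have "\<exists>z\<in>closure \<Omega>. \<forall>y\<in>closure \<Omega>. ?g z \<le> ?g y"
    by (intro continuous_attains_inf)
  then obtain z where z: "z \<in> closure \<Omega>" "\<And>y. y \<in> closure \<Omega> \<Longrightarrow> ?g z \<le> ?g y"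
    by blast
  have "z \<notin> \<Omega>"
  proof
    assume zO: "z \<in> \<Omega>"
    then have zU: "z \<in> U" using U(2) closure_subset by blast
    have sgO: "smooth_on \<Omega> ?g" by (rule smooth_on_subset[OF sg]) (use U(2) closure_subset in blast)
    have "psd (hessian ?g z)"
      by (rule hessian_psd_at_local_min[OF Om(1) sgO zO]) (use z(2) closure_subset in blast)
    then have "psd (hessian F z - M)"
      unfolding hessian_diff[OF U(1) zU U(3) smooth_on_quad] hessian_quad[OF tM] .
    \<comment> \<open>Adding N back leaves a comparison with a multiple of the identity alone, which
      lies in the cone.\<close>
    from psd_add[OF this N] have psdA: "psd (hessian F z - A *\<^sub>R mat 1)" by (simp add: M_def)
    have cA: "in_cone k (A *\<^sub>R mat 1 :: real^'n^'n)"
      by (rule in_cone_scaleR[OF in_cone_mat_one[OF k(2)]]) (use A in simp)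
    have "hsig k (A *\<^sub>R mat 1 :: real^'n^'n) \<le> hsig k (A *\<^sub>R mat 1 + (hessian F z - A *\<^sub>R mat 1))"
      by (rule in_cone_add_psd(2)[OF cA psdA]) (use k in auto)
    then have "A ^ k * hsig k (mat 1 :: real^'n^'n) \<le> B" using upper[OF zO] by (simp add: hsig_scaleR)
    moreover have "A * 1 \<le> A ^ k * hsig k (mat 1 :: real^'n^'n)"
      using A one_le_hsig_mat_one[OF k(2)] self_le_power[of A k] k(1) by (intro mult_mono) auto
    ultimately show False by (simp add: A_def)
  qed
  then have zf: "z \<in> frontier \<Omega>" using z(1) by (simp add: frontier_def interior_open[OF Om(1)])
  have "A * (norm z)\<^sup>2 \<le> A * R\<^sup>2" using A R[OF z(1)] by (intro mult_left_mono power_mono) auto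
  then have "- (A * R\<^sup>2 / 2) \<le> ?g z" using bdry[OF zf] qM[of z] by simp
  also have "\<dots> \<le> ?g x" using z(2)[of x] x closure_subset by blast
  also have "\<dots> \<le> F x - quad N x" using qM[of x] A by simp
  finally show ?thesis by (simp add: A_def)
qed

section \<open>Orthogonal projections\<close>

lemma orth_proj_unique:
  assumes "subspace E" "y \<in> E" "\<And>z. z \<in> E \<Longrightarrow> (x - y) \<bullet> z = 0"
  shows "orth_proj E x = y"
  unfolding orth_proj_def
proof (rule the_equality)
  show "y \<in> E \<and> (\<forall>z\<in>E. orthogonal (x - y) z)" using assms by (auto simp: orthogonal_def)
  fix w assume w: "w \<in> E \<and> (\<forall>z\<in>E. orthogonal (x - w) z)"
  have d: "w - y \<in> E" using w assms by (simp add: subspace_diff)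
  then have "(x - y) \<bullet> (w - y) = 0" "(x - w) \<bullet> (w - y) = 0" using w assms by (auto simp: orthogonal_def)
  then have "(w - y) \<bullet> (w - y) = 0" by (simp add: inner_diff_left)
  then show "w = y" by simp
qed

lemma orth_proj_props:
  assumes E: "subspace E"
  shows "orth_proj E x \<in> E" "z \<in> E \<Longrightarrow> (x - orth_proj E x) \<bullet> z = 0"
proof -
  have sE: "span E = E" using E by simp
  obtain y w where yw: "y \<in> span E" "\<And>v. v \<in> span E \<Longrightarrow> orthogonal w v" "x = y + w"
    by (rule orthogonal_subspace_decomp_exists[of E x]) (rule that)
  have "orth_proj E x = y"
    by (rule orth_proj_unique[OF E]) (use yw sE in \<open>auto simp: orthogonal_def\<close>)
  then show "orth_proj E x \<in> E" "z \<in> E \<Longrightarrow> (x - orth_proj E x) \<bullet> z = 0"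
    using yw sE by (auto simp: orthogonal_def)
qed

text \<open>For a unit vector v of E, P dominates v v^T because |v . x| = |v . P x| <= |P x|. Beyond
  the dimension of E sigma_k vanishes because eigenvectors with nonzero eigenvalue lie in E.\<close>

lemma orth_proj_matrix:
  fixes E :: "(real^'n) set"
  assumes E: "subspace E"
  obtains P where "psd P" "\<And>x. P *v x = orth_proj E x" "\<And>x. phi E x = quad P x"
    "\<And>v. v \<in> E \<Longrightarrow> norm v = 1 \<Longrightarrow> psd (P - rank_one v)"
    "\<And>k. dim E < k \<Longrightarrow> hsig k P = 0"
proof -
  let ?p = "orth_proj E"
  note pE = orth_proj_props(1)[OF E] and po = orth_proj_props(2)[OF E]
  have lin: "linear ?p"
  proof (rule linearI)
    show "?p (x + y) = ?p x + ?p y" for x y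
    proof (rule orth_proj_unique[OF E])
      show "?p x + ?p y \<in> E" using pE E by (simp add: subspace_add)
      show "(x + y - (?p x + ?p y)) \<bullet> z = 0" if "z \<in> E" for z
        using po[OF that, of x] po[OF that, of y] by (simp add: inner_diff_left inner_add_left)
    qed
    show "?p (c *\<^sub>R x) = c *\<^sub>R ?p x" for c x
    proof (rule orth_proj_unique[OF E])
      show "c *\<^sub>R ?p x \<in> E" using pE E by (simp add: subspace_scale)
      show "(c *\<^sub>R x - c *\<^sub>R ?p x) \<bullet> z = 0" if "z \<in> E" for z
      proof -
        have "c *\<^sub>R x - c *\<^sub>R ?p x = c *\<^sub>R (x - ?p x)" by (rule scaleR_diff_right[symmetric])
        then show ?thesis using po[OF that, of x] by simp
      qed
    qed
  qed
  define P where "P = matrix ?p"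
  have Pv: "P *v x = ?p x" for x unfolding P_def by (rule fun_cong[OF matrix_vector_mul(2)[OF lin]])
  have pp: "x \<bullet> ?p y = ?p x \<bullet> ?p y" for x y
    using po[OF pE[of y], of x] by (simp add: inner_diff_left)
  have sym: "P $ i $ j = P $ j $ i" for i j
  proof -
    have ent: "P $ i $ j = axis i 1 \<bullet> (P *v axis j 1)" for i j
      by (simp add: matrix_vector_mult_basis column_def inner_axis')
    have "axis i 1 \<bullet> ?p (axis j 1) = axis j 1 \<bullet> ?p (axis i 1)"
      unfolding pp[of "axis i 1" "axis j 1"] pp[of "axis j 1" "axis i 1"] by (rule inner_commute)
    then show ?thesis unfolding ent Pv .
  qed
  then have tP: "transpose P = P" by (simp add: transpose_def vec_eq_iff)
  have "0 \<le> x \<bullet> ?p x" for x unfolding pp[of x x] by simp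
  then have 1: "psd P" unfolding psd_def Pv using tP by blast
  have 2: "phi E x = quad P x" for x
    unfolding phi_def quad_def Pv pp[of x x] by (simp add: dot_square_norm)
  have 3: "psd (P - rank_one v)" if v: "v \<in> E" "norm v = 1" for v
    unfolding psd_def
  proof (intro conjI allI)
    show "transpose (P - rank_one v) = P - rank_one v"
      using sym by (simp add: transpose_def vec_eq_iff rank_one_def)
    fix x
    have "rank_one v *v x = (v \<bullet> x) *\<^sub>R v"
      by (simp add: vec_eq_iff matrix_vector_mult_def rank_one_def inner_vec_def sum_distrib_left mult_ac)
    then have "x \<bullet> ((P - rank_one v) *v x) = (norm (?p x))\<^sup>2 - (v \<bullet> x)\<^sup>2"
      by (simp add: matrix_vector_mult_diff_rdistrib inner_diff_right Pv pp[of x x] dot_square_norm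
          power2_eq_square[of "v \<bullet> x"] inner_commute)
    moreover have "(v \<bullet> x)\<^sup>2 \<le> (norm (?p x))\<^sup>2"
    proof -
      have "v \<bullet> x = v \<bullet> ?p x" using po[OF v(1), of x] by (simp add: inner_diff_left inner_commute[of v])
      then have "\<bar>v \<bullet> x\<bar> \<le> norm (?p x)" using Cauchy_Schwarz_ineq2[of v "?p x"] v(2) by simp
      then show ?thesis using power_mono[of "\<bar>v \<bullet> x\<bar>" "norm (?p x)" 2] by simp
    qed
    ultimately show "0 \<le> x \<bullet> ((P - rank_one v) *v x)" by simp
  qed
  have 4: "hsig k P = 0" if k: "dim E < k" for k
  proof -
    obtain Q l where Q: "orthogonal_matrix Q" "P = Q ** diag_mat l ** transpose Q"
      "\<And>j. P *v column j Q = l $ j *\<^sub>R column j Q"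
      by (rule symmetric_diagonalization[OF tP]) (rule that)
    have ortho: "column i Q \<bullet> column j Q = (if i = j then 1 else 0)" for i j
    proof -
      have "column i Q \<bullet> column j Q = (transpose Q ** Q) $ i $ j"
        by (simp add: column_def inner_vec_def matrix_matrix_mult_def transpose_def)
      also have "\<dots> = (if i = j then 1 else 0)" using Q(1) unfolding orthogonal_matrix by (simp add: mat_def)
      finally show ?thesis .
    qed
    \<comment> \<open>k nonzero eigenvalues would give k orthonormal columns inside E, more than its
      dimension allows.\<close>
    have "(\<Prod>i\<in>I. l $ i) = 0" if I: "card I = k" for I
    proof (rule ccontr)
      assume "(\<Prod>i\<in>I. l $ i) \<noteq> 0"
      then have ne: "l $ i \<noteq> 0" if "i \<in> I" for i using that by (simp add: prod_zero_iff)
      let ?S = "(\<lambda>i. column i Q) ` I"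
      have inj: "inj_on (\<lambda>i. column i Q) I"
      proof (rule inj_onI)
        fix i j assume "column i Q = column j Q"
        then have "column i Q \<bullet> column j Q = 1" using ortho[of i i] by simp
        then show "i = j" using ortho[of i j] by (simp split: if_splits)
      qed
      have "?S \<subseteq> E"
      proof
        fix x assume "x \<in> ?S"
        then obtain i where i: "i \<in> I" "x = column i Q" by blast
        have "x = (1 / l $ i) *\<^sub>R ?p x" using Q(3)[of i] ne[OF i(1)] i(2) by (simp add: Pv)
        moreover have "(1 / l $ i) *\<^sub>R ?p x \<in> E" using E pE by (simp add: subspace_scale)
        ultimately show "x \<in> E" by simp
      qed
      moreover have "independent ?S"
      proof (rule pairwise_orthogonal_independent)
        show "pairwise orthogonal ?S" unfolding pairwise_def orthogonal_def using ortho by auto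
        show "0 \<notin> ?S"
        proof
          assume "0 \<in> ?S"
          then obtain i where "column i Q = 0" by auto
          then show False using ortho[of i i] by simp
        qed
      qed
      ultimately have "card ?S \<le> dim E" by (rule independent_card_le_dim)
      then show False using k I card_image[OF inj] by simp
    qed
    then have "esym k l = 0" unfolding esym_def by (intro sum.neutral) auto
    then show ?thesis unfolding Q(2) hsig_orthogonal[OF Q(1)] hsig_diag_mat .
  qed
  show ?thesis by (rule that[OF 1 Pv 2 3 4])
qed

text \<open>A subspace of dimension m - 1 in the hyperplane orthogonal to v is enlarged by v. For m
  = k - 1 the requirement 1 <= m is met because k >= 2.\<close>

lemma subspace_containing_vector:
  fixes v :: "real^'n"
  assumes v: "norm v = 1" and m: "1 \<le> m" "m \<le> CARD('n)"
  obtains E where "E \<in> Gr m" "v \<in> E"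
proof -
  have v0: "v \<noteq> 0" using v by auto
  have "m - 1 \<le> dim {x. v \<bullet> x = 0}" using dim_hyperplane[OF v0] m by simp
  then obtain T where T: "subspace T" "T \<subseteq> span {x. v \<bullet> x = 0}" "dim T = m - 1"
    by (rule choose_subspace_of_subspace)
  have "span {x. v \<bullet> x = 0} = {x. v \<bullet> x = 0}" by (simp add: span_eq_iff subspace_hyperplane)
  then have "T \<subseteq> {x. v \<bullet> x = 0}" using T(2) by (simp only:)
  then have "v \<notin> T" using v0 by auto
  then have "v \<notin> span T" unfolding iffD2[OF span_eq_iff T(1)] .
  then have "dim (insert v T) = m" using T(3) m by (simp add: dim_insert)
  then have "span (insert v T) \<in> Gr m" by (simp add: Gr_def)
  moreover have "v \<in> span (insert v T)" by (simp add: span_base)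
  ultimately show ?thesis by (rule that)
qed

section \<open>Exponentials determine continuous functions\<close>

text \<open>The span of the exponentials of linear forms, given inductively so that it can serve as
  the predicate in the Stone-Weierstrass theorem. It is an algebra because exponents add.\<close>

inductive exp_sum :: "('a::real_inner \<Rightarrow> real) \<Rightarrow> bool" where
  exp: "exp_sum (\<lambda>x. c * exp (\<xi> \<bullet> x))"
| add: "exp_sum f \<Longrightarrow> exp_sum g \<Longrightarrow> exp_sum (\<lambda>x. f x + g x)"

lemma exp_sum_mult: "exp_sum f \<Longrightarrow> exp_sum g \<Longrightarrow> exp_sum (\<lambda>x. f x * g x)"
proof (induction f rule: exp_sum.induct)
  case (exp c \<xi>)
  from exp show ?case
  proof (induction g rule: exp_sum.induct)
    case (exp d \<eta>)
    have "(\<lambda>x. c * exp (\<xi> \<bullet> x) * (d * exp (\<eta> \<bullet> x))) = (\<lambda>x. (c * d) * exp ((\<xi> + \<eta>) \<bullet> x))"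
      by (simp add: fun_eq_iff inner_add_left exp_add)
    then show ?case by (simp only: exp_sum.exp)
  next
    case (add f g)
    have "(\<lambda>x. c * exp (\<xi> \<bullet> x) * (f x + g x)) = (\<lambda>x. c * exp (\<xi> \<bullet> x) * f x + c * exp (\<xi> \<bullet> x) * g x)"
      by (simp add: fun_eq_iff distrib_left)
    then show ?case using exp_sum.add[OF add.IH] by simp
  qed
next
  case (add f1 f2)
  have "(\<lambda>x. (f1 x + f2 x) * g x) = (\<lambda>x. f1 x * g x + f2 x * g x)"
    by (simp add: fun_eq_iff distrib_right)
  then show ?case using exp_sum.add[OF add.IH] add.prems by simp
qed

lemma exp_sum_continuous: "exp_sum f \<Longrightarrow> continuous_on S f"
  by (induction rule: exp_sum.induct) (auto intro!: continuous_intros)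

lemma exp_sum_approximation:
  fixes g :: "'a::euclidean_space \<Rightarrow> real"
  assumes "compact S" "continuous_on S g" "0 < e"
  shows "\<exists>f. exp_sum f \<and> (\<forall>x\<in>S. \<bar>g x - f x\<bar> < e)"
proof (rule Stone_Weierstrass_HOL[OF assms(1) _ _ _ _ _ assms(2,3)])
  show "exp_sum (\<lambda>x. c)" for c using exp_sum.exp[of c 0] by simp
  show "continuous_on S f" if "exp_sum f" for f by (rule exp_sum_continuous[OF that])
  show "exp_sum (\<lambda>x. f x + g x)" if "exp_sum f \<and> exp_sum g" for f g using that exp_sum.add by blast
  show "exp_sum (\<lambda>x. f x * g x)" if "exp_sum f \<and> exp_sum g" for f g using that exp_sum_mult by blast
  show "\<exists>f. exp_sum f \<and> f x \<noteq> f y" if "x \<in> S \<and> y \<in> S \<and> x \<noteq> y" for x y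
  proof -
    \<comment> \<open>The exponential in direction x - y separates the points: its exponents at x
      and y differ by |x - y|^2.\<close>
    have "(x - y) \<bullet> (x - y) \<noteq> 0" using that by simp
    then have "exp ((x - y) \<bullet> x) \<noteq> exp ((x - y) \<bullet> y)" by (simp add: inner_diff_right)
    then show ?thesis using exp_sum.exp[of 1 "x - y"] by (intro exI[of _ "\<lambda>z. 1 * exp ((x - y) \<bullet> z)"]) simp
  qed
qed

text \<open>g is orthogonal to all exponential sums, hence to arbitrarily good uniform
  approximations of itself, and so the integral of g^2 is zero.\<close>

lemma zero_if_exponential_moments_zero:
  fixes g :: "real^'n \<Rightarrow> real"
  assumes Om: "open \<Omega>" "bounded \<Omega>" and g: "continuous_on (closure \<Omega>) g"
    and mom: "\<And>\<xi>. (LINT x:\<Omega>|lborel. g x * exp (\<xi> \<bullet> x)) = 0"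
    and x: "x \<in> \<Omega>"
  shows "g x = 0"
proof -
  have int: "set_integrable lborel \<Omega> f" if "continuous_on (closure \<Omega>) f" for f :: "real^'n \<Rightarrow> real"
    by (rule set_integrable_continuous_closure[OF Om that])
  have z: "(LINT x:\<Omega>|lborel. g x * f x) = 0" if "exp_sum f" for f
    using that
  proof (induction rule: exp_sum.induct)
    case (exp c \<xi>)
    have "(LINT x:\<Omega>|lborel. g x * (c * exp (\<xi> \<bullet> x))) = (LINT x:\<Omega>|lborel. c * (g x * exp (\<xi> \<bullet> x)))"
      by (simp add: mult_ac)
    then show ?case using mom[of \<xi>] by simp
  next
    case (add f1 f2)
    have "set_integrable lborel \<Omega> (\<lambda>x. g x * f1 x)" "set_integrable lborel \<Omega> (\<lambda>x. g x * f2 x)"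
      by (intro int continuous_intros g exp_sum_continuous add.hyps)+
    from set_integral_add(2)[OF this] show ?case using add.IH by (simp add: distrib_left)
  qed
  define J where "J = (LINT x:\<Omega>|lborel. \<bar>g x\<bar>)"
  have J: "0 \<le> J" unfolding J_def set_lebesgue_integral_def by (rule integral_nonneg_AE) simp
  have "(LINT x:\<Omega>|lborel. g x * g x) \<le> 0 + e" if e: "e > 0" for e
  proof -
    \<comment> \<open>The tolerance is scaled by the L1 norm J of g; the summand 1 covers J =
      0.\<close>
    have "0 < e / (J + 1)" using e J by simp
    from exp_sum_approximation[OF _ g this] Om obtain f where f: "exp_sum f"
      "\<forall>x\<in>closure \<Omega>. \<bar>g x - f x\<bar> < e / (J + 1)" by (auto simp: compact_closure)
    have i: "set_integrable lborel \<Omega> (\<lambda>x. g x * g x)" "set_integrable lborel \<Omega> (\<lambda>x. g x * f x)"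
        "set_integrable lborel \<Omega> (\<lambda>x. g x * g x - g x * f x)"
        "set_integrable lborel \<Omega> (\<lambda>x. e / (J + 1) * \<bar>g x\<bar>)"
      by (intro int continuous_intros g exp_sum_continuous f)+
    have "(LINT x:\<Omega>|lborel. g x * g x) = (LINT x:\<Omega>|lborel. g x * g x - g x * f x)"
      using set_integral_diff(2)[OF i(1,2)] z[OF f(1)] by simp
    also have "\<dots> \<le> (LINT x:\<Omega>|lborel. e / (J + 1) * \<bar>g x\<bar>)"
    proof (rule set_integral_mono[OF i(3,4)])
      fix y assume "y \<in> \<Omega>"
      then have "\<bar>g y - f y\<bar> \<le> e / (J + 1)" using f(2) closure_subset by (auto intro: less_imp_le)
      then have "\<bar>g y\<bar> * \<bar>g y - f y\<bar> \<le> \<bar>g y\<bar> * (e / (J + 1))" by (intro mult_left_mono) auto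
      moreover have "g y * g y - g y * f y \<le> \<bar>g y\<bar> * \<bar>g y - f y\<bar>"
        by (metis abs_ge_self abs_mult right_diff_distrib)
      ultimately show "g y * g y - g y * f y \<le> e / (J + 1) * \<bar>g y\<bar>" by (simp add: mult.commute)
    qed
    also have "\<dots> = e / (J + 1) * J" unfolding J_def by (rule set_integral_mult_right)
    also have "\<dots> \<le> e" using e J by (simp add: field_simps)
    finally show ?thesis by simp
  qed
  then have "(LINT x:\<Omega>|lborel. g x * g x) \<le> 0" by (rule field_le_epsilon)
  moreover have nn: "AE x in lborel. 0 \<le> indicator \<Omega> x *\<^sub>R (g x * g x)" by simp
  ultimately have 0: "(LINT x|lborel. indicator \<Omega> x *\<^sub>R (g x * g x)) = 0"
    unfolding set_lebesgue_integral_def using integral_nonneg_AE[OF nn] by linarith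
  have ii: "integrable lborel (\<lambda>x. indicator \<Omega> x *\<^sub>R (g x * g x))"
    using int[OF continuous_on_mult[OF g g]] by (simp add: set_integrable_def)
  have ae: "AE x in lborel. indicator \<Omega> x *\<^sub>R (g x * g x) = 0"
    using integral_nonneg_eq_0_iff_AE[OF ii nn] 0 by simp
  \<comment> \<open>g vanishes almost everywhere on the domain; by continuity the exceptional set is
    open, and an open null set is empty.\<close>
  define S where "S = {x \<in> \<Omega>. g x \<noteq> 0}"
  have "continuous_on \<Omega> g" using g closure_subset continuous_on_subset by blast
  then have "open (g -` (- {0}) \<inter> \<Omega>)" using Om(1) continuous_on_open_vimage by blast
  moreover have "g -` (- {0}) \<inter> \<Omega> = S" by (auto simp: S_def)
  ultimately have oS: "open S" by simp
  have "AE x in lborel. x \<notin> S" using ae by eventually_elim (auto simp: S_def)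
  then have "S \<in> null_sets lborel" using oS by (subst AE_iff_null_sets) auto
  then have "negligible S" using oS by (simp add: negligible_iff_null_sets null_sets_completionI)
  then have "S = {}" using open_not_negligible[OF oS] by blast
  then show ?thesis using x by (auto simp: S_def)
qed

section \<open>Recovering the right-hand side\<close>

text \<open>Extension and solution are known to agree only on the closure; on the open domain this
  already gives equal Hessians, and the eigenvalue conditions turn into conditions on
  \<open>hsig\<close>.\<close>

lemma solution_hessian:
  fixes \<Omega> :: "(real^'n) set"
  assumes Om: "open \<Omega>" and sol: "smooth_admissible_solution \<Omega> k f g u"
    and U: "open U" "closure \<Omega> \<subseteq> U" "smooth_on U F" "\<And>x. x \<in> closure \<Omega> \<Longrightarrow> F x = u x"
    and x: "x \<in> \<Omega>"
  shows "in_cone k (hessian F x)" "hsig k (hessian F x) = f x"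
proof -
  have sO: "\<Omega> \<subseteq> U" using U(2) closure_subset by blast
  have h: "hessian F x = hessian u x"
    by (rule hessian_cong[OF Om x _ smooth_on_subset[OF U(3) sO]]) (use U(4) closure_subset in blast)
  have t: "transpose (hessian F x) = hessian F x"
    by (rule transpose_hessian[OF U(1,3)]) (use x sO in blast)
  have "eigenvalue_vec (hessian F x) \<in> Gamma_cone k" "sigma_fn k (hessian F x) = f x"
    using sol x unfolding smooth_admissible_solution_def k_admissible_def h by blast+
  then show "in_cone k (hessian F x)" "hsig k (hessian F x) = f x"
    using t by (simp_all add: in_cone_def Gamma_cone_def sigma_fn_def hsig_eq_esym_eigenvalue_vec[OF t])
qed

text \<open>The vector \<nu> is shared by both equations: the Hessians differ by a multiple of \<nu>
  \<nu>^T, and grad F1 - grad b is a multiple of the same \<nu>, as F1 - b vanishes on the frontier.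
  The flux comparison depends on this coincidence.\<close>

lemma equal_DN_data:
  fixes \<Omega> :: "(real^'n) set"
  assumes Om: "open \<Omega>" "smooth_boundary \<Omega>"
    and sol: "smooth_admissible_solution \<Omega> k f1 g v1" "smooth_admissible_solution \<Omega> k f2 g v2"
    and U: "open U" "closure \<Omega> \<subseteq> U" and F: "smooth_on U F1" "smooth_on U F2"
    and ext: "\<And>x. x \<in> closure \<Omega> \<Longrightarrow> F1 x = v1 x" "\<And>x. x \<in> closure \<Omega> \<Longrightarrow> F2 x = v2 x"
    and DN: "\<And>x. x \<in> frontier \<Omega> \<Longrightarrow> normal_deriv \<Omega> v1 x = normal_deriv \<Omega> v2 x"
    and b: "smooth_on U b" "\<And>x. x \<in> frontier \<Omega> \<Longrightarrow> b x = g x"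
    and x: "x \<in> frontier \<Omega>"
  shows "grad F1 x = grad F2 x"
    "\<exists>c \<nu> a. hessian F1 x - hessian F2 x = c *\<^sub>R rank_one \<nu> \<and> grad F1 x - grad b x = a *\<^sub>R \<nu>"
proof -
  have fc: "y \<in> closure \<Omega>" if "y \<in> frontier \<Omega>" for y using that by (simp add: frontier_def)
  have frU: "frontier \<Omega> \<subseteq> U" using fc U(2) by blast
  have \<rho>: "\<exists>V \<rho>. local_defining_function \<Omega> q V \<rho>" if "q \<in> frontier \<Omega>" for q
    using Om(2) that unfolding smooth_boundary_def by blast
  have bd: "F1 q = g q" "F2 q = g q" if "q \<in> frontier \<Omega>" for q
    using sol ext fc[OF that] that unfolding smooth_admissible_solution_def by simp_all
  have sw: "smooth_on U (\<lambda>x. F1 x - F2 x)" by (rule smooth_on_diff[OF F])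
  have gw: "grad (\<lambda>x. F1 x - F2 x) q = grad F1 q - grad F2 q" if "q \<in> U" for q by (rule grad_diff[OF that F])
  have n0: "outward_normal \<Omega> q \<bullet> grad (\<lambda>x. F1 x - F2 x) q = 0" if q: "q \<in> frontier \<Omega>" for q
  proof -
    obtain V \<rho> where \<rho>: "local_defining_function \<Omega> q V \<rho>" using \<rho>[OF q] by blast
    have "outward_normal \<Omega> q \<bullet> grad F1 q = outward_normal \<Omega> q \<bullet> grad F2 q"
      using DN[OF q] normal_deriv_eq[OF \<rho> q U(2) F(1) ext(1)] normal_deriv_eq[OF \<rho> q U(2) F(2) ext(2)] by simp
    then show ?thesis using gw[of q] q frU by (auto simp: inner_diff_right)
  qed
  have w0: "F1 q - F2 q = 0" if "q \<in> frontier \<Omega>" for q using bd[OF that] by simp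
  note cauchy = equal_cauchy_data[where w = "\<lambda>x. F1 x - F2 x", OF \<rho> U(1) frU sw w0 n0 x]
  have xU: "x \<in> U" using x frU by blast
  show "grad F1 x = grad F2 x" using cauchy(1) gw[OF xU] by simp
  obtain c where c: "hessian F1 x - hessian F2 x = c *\<^sub>R rank_one (outward_normal \<Omega> x)"
    using cauchy(2) hessian_diff[OF U(1) xU F] by auto
  obtain V \<rho> where \<rho>': "local_defining_function \<Omega> x V \<rho>" using \<rho>[OF x] by blast
  have "F1 y - b y = 0" if "y \<in> frontier \<Omega> \<inter> U" for y using bd b(2) that by simp
  then obtain a where a: "grad (\<lambda>x. F1 x - b x) x = a *\<^sub>R grad \<rho> x"
    using grad_parallel_normal[OF \<rho>' x U(1) xU smooth_on_diff[OF F(1) b(1)]] by blast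
  have "grad \<rho> x = norm (grad \<rho> x) *\<^sub>R outward_normal \<Omega> x"
    using \<rho>' unfolding outward_normal_eq[OF \<rho>' x] by (simp add: sgn_div_norm local_defining_function_def)
  then have "grad F1 x - grad b x = (a * norm (grad \<rho> x)) *\<^sub>R outward_normal \<Omega> x"
    using a grad_diff[OF xU F(1) b(1)] by (metis scaleR_scaleR)
  then show "\<exists>c \<nu> a. hessian F1 x - hessian F2 x = c *\<^sub>R rank_one \<nu> \<and> grad F1 x - grad b x = a *\<^sub>R \<nu>"
    using c by blast
qed

text \<open>The abstract estimate with b = t \<open>phi E\<close> and C = (B + 1) R^2 / 2. The right
  side depends on t only through the final division.\<close>

lemma moment_bound:
  fixes \<Omega> :: "(real^'n) set" and f1 f2 :: "real^'n \<Rightarrow> real"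
  assumes Om: "open \<Omega>" "convex \<Omega>" "bounded \<Omega>" "smooth_boundary \<Omega>"
    and k: "2 \<le> k" "k \<le> CARD('n)" and E: "E \<in> Gr (k - 1)" "v \<in> E" "norm v = 1" and t: "0 < t"
    and sol: "smooth_admissible_solution \<Omega> k f1 (\<lambda>x. t * phi E x) v1"
      "smooth_admissible_solution \<Omega> k f2 (\<lambda>x. t * phi E x) v2"
    and DN: "\<And>x. x \<in> frontier \<Omega> \<Longrightarrow> normal_deriv \<Omega> v1 x = normal_deriv \<Omega> v2 x"
    and B: "\<And>x. x \<in> \<Omega> \<Longrightarrow> f1 x \<le> B" "\<And>x. x \<in> \<Omega> \<Longrightarrow> f2 x \<le> B" "0 \<le> B"
    and R: "\<And>x. x \<in> closure \<Omega> \<Longrightarrow> norm x \<le> R"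
    and H: "\<And>x. x \<in> \<Omega> \<Longrightarrow> exp ((a *\<^sub>R v) \<bullet> x) \<le> H" "0 \<le> H"
  shows "\<bar>(LINT x:\<Omega>|lborel. f1 x * exp ((a *\<^sub>R v) \<bullet> x)) - (LINT x:\<Omega>|lborel. f2 x * exp ((a *\<^sub>R v) \<bullet> x))\<bar> \<le>
    (a\<^sup>2 * H * real k * ((B + 1) * R\<^sup>2 / 2) * ((LINT x:\<Omega>|lborel. f1 x) + (LINT x:\<Omega>|lborel. f2 x))) / t"
proof -
  have k1: "1 \<le> k" using k by simp
  have subE: "subspace E" "dim E < k" using E(1) k by (auto simp: Gr_def)
  obtain P where P: "psd P" "\<And>x. P *v x = orth_proj E x" "\<And>x. phi E x = quad P x"
    "\<And>v. v \<in> E \<Longrightarrow> norm v = 1 \<Longrightarrow> psd (P - rank_one v)" "\<And>k. dim E < k \<Longrightarrow> hsig k P = 0"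
    by (rule orth_proj_matrix[OF subE(1)]) (rule that)
  define N where "N = t *\<^sub>R P"
  have pN: "psd N" unfolding N_def by (rule psd_scaleR[OF P(1)]) (use t in simp)
  then have tN: "transpose N = N" by (simp add: psd_def)
  \<comment> \<open>This is where the dimension k - 1 of E is used: the boundary quadratic has
    sigma_k = 0 and therefore lies above the solutions.\<close>
  have rN: "hsig k N = 0" unfolding N_def hsig_scaleR P(5)[OF subE(2)] by simp
  have qN: "quad N x = t * phi E x" for x
    by (simp add: N_def P(3) quad_def scaleR_matrix_vector_assoc[symmetric])
  obtain U1 F1 where F1: "open U1" "closure \<Omega> \<subseteq> U1" "smooth_on U1 F1" "\<forall>x\<in>closure \<Omega>. F1 x = v1 x"
    using sol(1) unfolding smooth_admissible_solution_def smooth_on_closure_def by blast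
  obtain U2 F2 where F2: "open U2" "closure \<Omega> \<subseteq> U2" "smooth_on U2 F2" "\<forall>x\<in>closure \<Omega>. F2 x = v2 x"
    using sol(2) unfolding smooth_admissible_solution_def smooth_on_closure_def by blast
  \<comment> \<open>The solutions come with different neighbourhoods of the closure; the integral
    identities need a common one.\<close>
  define U where "U = U1 \<inter> U2"
  have U: "open U" "closure \<Omega> \<subseteq> U" using F1 F2 by (auto simp: U_def)
  have sF: "smooth_on U F1" "smooth_on U F2"
    using smooth_on_subset[OF F1(3)] smooth_on_subset[OF F2(3)] by (simp_all add: U_def)
  have e1: "F1 x = v1 x" if "x \<in> closure \<Omega>" for x using F1(4) that by blast
  have e2: "F2 x = v2 x" if "x \<in> closure \<Omega>" for x using F2(4) that by blast
  have fc: "y \<in> closure \<Omega>" if "y \<in> frontier \<Omega>" for y using that by (simp add: frontier_def)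
  have bd: "F1 x = quad N x" "F2 x = quad N x" if "x \<in> frontier \<Omega>" for x
    using sol that e1[OF fc[OF that]] e2[OF fc[OF that]] unfolding smooth_admissible_solution_def qN by simp_all
  have cone: "in_cone k (hessian F1 x)" "in_cone k (hessian F2 x)"
    and hs: "hsig k (hessian F1 x) = f1 x" "hsig k (hessian F2 x) = f2 x" if "x \<in> \<Omega>" for x
    using solution_hessian[OF Om(1) sol(1) U sF(1) e1 that] solution_hessian[OF Om(1) sol(2) U sF(2) e2 that] by auto
  have up: "hsig k (hessian F1 x) \<le> B" "hsig k (hessian F2 x) \<le> B" if "x \<in> \<Omega>" for x
    using hs[OF that] B that by simp_all
  have L: "(LINT x:\<Omega>|lborel. hsig k (hessian F1 x) * q x) = (LINT x:\<Omega>|lborel. f1 x * q x)"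
      "(LINT x:\<Omega>|lborel. hsig k (hessian F2 x) * q x) = (LINT x:\<Omega>|lborel. f2 x * q x)" for q
    using Om hs by (auto intro!: set_lebesgue_integral_cong)
  note cauchy = equal_DN_data[OF Om(1,4) sol U sF e1 e2 DN smooth_on_quad qN]
  have "\<bar>(LINT x:\<Omega>|lborel. hsig k (hessian F1 x) * exp ((a *\<^sub>R v) \<bullet> x)) -
     (LINT x:\<Omega>|lborel. hsig k (hessian F2 x) * exp ((a *\<^sub>R v) \<bullet> x))\<bar> \<le>
    (a\<^sup>2 * H * real k * ((B + 1) * R\<^sup>2 / 2) *
      ((LINT x:\<Omega>|lborel. hsig k (hessian F1 x)) + (LINT x:\<Omega>|lborel. hsig k (hessian F2 x)))) / t"
  proof (rule exponential_moment_estimate[OF Om(1,2,3) U smooth_on_quad sF _ P(1) P(4)[OF E(2,3)] t k1 bd cauchy cone])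
    show "hessian (quad N) x = t *\<^sub>R P" for x using hessian_quad[OF tN] by (simp add: N_def)
    show "F1 x \<le> quad N x" if "x \<in> \<Omega>" for x
      by (rule solution_below_quadratic[OF Om(1,3) U sF(1) tN bd(1) k1 cone(1) rN that])
    show "F2 x \<le> quad N x" if "x \<in> \<Omega>" for x
      by (rule solution_below_quadratic[OF Om(1,3) U sF(2) tN bd(2) k1 cone(2) rN that])
    show "quad N x - (B + 1) * R\<^sup>2 / 2 \<le> F1 x" if "x \<in> \<Omega>" for x
      by (rule solution_above_quadratic[OF Om(1,3) U sF(1) pN bd(1) k1 k(2) up(1) B(3) R that])
    show "quad N x - (B + 1) * R\<^sup>2 / 2 \<le> F2 x" if "x \<in> \<Omega>" for x
      by (rule solution_above_quadratic[OF Om(1,3) U sF(2) pN bd(2) k1 k(2) up(2) B(3) R that])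
  qed (use H in auto)
  moreover have "(LINT x:\<Omega>|lborel. hsig k (hessian F1 x)) = (LINT x:\<Omega>|lborel. f1 x)"
      "(LINT x:\<Omega>|lborel. hsig k (hessian F2 x)) = (LINT x:\<Omega>|lborel. f2 x)"
    using L[of "\<lambda>_. 1"] by simp_all
  ultimately show ?thesis unfolding L by (simp only:)
qed

theorem theorem1p1:
  fixes \<Omega> :: "(real^'n) set"
    and k :: nat
    and f1 f2 :: "real^'n \<Rightarrow> real"
    and c0 :: real
    and u1 u2 :: "real \<Rightarrow> (real^'n) set \<Rightarrow> real^'n \<Rightarrow> real"
  assumes domain: "bounded_smooth_uniformly_convex_domain \<Omega>"
    and k: "2 \<le> k" "k \<le> CARD('n)"
    and f_smooth: "smooth_on_closure \<Omega> f1" "smooth_on_closure \<Omega> f2"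
    and c0: "0 < c0"
    and f_lower: "\<forall>x\<in>closure \<Omega>. c0 \<le> f1 x" "\<forall>x\<in>closure \<Omega>. c0 \<le> f2 x"
    and u1: "\<forall>E\<in>Gr (k - 1). \<forall>t>0. smooth_admissible_solution \<Omega> k f1 (\<lambda>x. t * phi E x) (u1 t E)"
    and u2: "\<forall>E\<in>Gr (k - 1). \<forall>t>0. smooth_admissible_solution \<Omega> k f2 (\<lambda>x. t * phi E x) (u2 t E)"
    and DN: "\<forall>E\<in>Gr (k - 1). \<exists>tE>0. \<forall>t\<ge>tE. \<forall>x\<in>frontier \<Omega>.
               DN_map \<Omega> k f1 (\<lambda>y. t * phi E y) x = DN_map \<Omega> k f2 (\<lambda>y. t * phi E y) x"
  shows "\<forall>x\<in>\<Omega>. f1 x = f2 x"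
proof -
  have "uniformly_convex \<Omega>" and reg: "open \<Omega>" "bounded \<Omega>" "smooth_boundary \<Omega>"
    using domain by (simp_all add: bounded_smooth_uniformly_convex_domain_def)
  then have Om: "open \<Omega>" "convex \<Omega>" "bounded \<Omega>" "smooth_boundary \<Omega>"
    unfolding uniformly_convex_def by blast+
  have cont: "continuous_on (closure \<Omega>) f" if f: "smooth_on_closure \<Omega> f" for f
  proof -
    obtain U F where U: "open U" "closure \<Omega> \<subseteq> U" "smooth_on U F" "\<forall>x\<in>closure \<Omega>. F x = f x"
      using f unfolding smooth_on_closure_def by blast
    have c: "continuous_on (closure \<Omega>) F"
      by (rule continuous_on_subset[OF smooth_on_continuous[OF U(3)] U(2)])
    have "F x = f x" if "x \<in> closure \<Omega>" for x using U(4) that by blast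
    from continuous_on_eq[OF c this] show ?thesis .
  qed
  have cK: "compact (closure \<Omega>)" using Om(3) by (simp add: compact_closure)
  have bdd: "\<exists>B\<ge>0. \<forall>x\<in>closure \<Omega>. \<bar>f x\<bar> \<le> B" if "continuous_on (closure \<Omega>) f" for f :: "real^'n \<Rightarrow> real"
  proof -
    have "bounded (f ` closure \<Omega>)" by (rule compact_imp_bounded[OF compact_continuous_image[OF that cK]])
    then obtain B where "B > 0" "\<forall>y\<in>f ` closure \<Omega>. norm y \<le> B" unfolding bounded_pos by blast
    then show ?thesis by (intro exI[of _ B]) simp
  qed
  obtain B1 where B1: "B1 \<ge> 0" "\<forall>x\<in>closure \<Omega>. \<bar>f1 x\<bar> \<le> B1" using bdd[OF cont[OF f_smooth(1)]] by blast
  obtain B2 where B2: "B2 \<ge> 0" "\<forall>x\<in>closure \<Omega>. \<bar>f2 x\<bar> \<le> B2" using bdd[OF cont[OF f_smooth(2)]] by blast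
  define B where "B = max B1 B2"
  have B: "f1 x \<le> B" "f2 x \<le> B" if "x \<in> \<Omega>" for x
  proof -
    have "x \<in> closure \<Omega>" using that closure_subset by blast
    then have "\<bar>f1 x\<bar> \<le> B1" "\<bar>f2 x\<bar> \<le> B2" using B1(2) B2(2) by blast+
    then show "f1 x \<le> B" "f2 x \<le> B" by (auto simp: B_def)
  qed
  have B0: "0 \<le> B" using B1(1) by (simp add: B_def)
  obtain R where R: "\<And>x. x \<in> closure \<Omega> \<Longrightarrow> norm x \<le> R"
    using compact_imp_bounded[OF cK] unfolding bounded_iff by blast
  have diffI: "(LINT x:\<Omega>|lborel. (f1 x - f2 x) * exp (\<xi> \<bullet> x)) =
      (LINT x:\<Omega>|lborel. f1 x * exp (\<xi> \<bullet> x)) - (LINT x:\<Omega>|lborel. f2 x * exp (\<xi> \<bullet> x))" for \<xi>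
  proof -
    have "set_integrable lborel \<Omega> (\<lambda>x. f1 x * exp (\<xi> \<bullet> x))" "set_integrable lborel \<Omega> (\<lambda>x. f2 x * exp (\<xi> \<bullet> x))"
      by (rule set_integrable_continuous_closure[OF Om(1,3)], intro continuous_intros cont f_smooth)+
    from set_integral_diff(2)[OF this] show ?thesis by (simp add: left_diff_distrib)
  qed
  have moment: "(LINT x:\<Omega>|lborel. (f1 x - f2 x) * exp ((a *\<^sub>R v) \<bullet> x)) = 0" if v: "norm v = 1" for a v
  proof -
    have "1 \<le> k - 1" "k - 1 \<le> CARD('n)" using k by linarith+
    then obtain E where E: "E \<in> Gr (k - 1)" "v \<in> E"
      by (rule subspace_containing_vector[OF v]) (rule that)
    obtain tE where tE: "tE > 0" "\<forall>t\<ge>tE. \<forall>x\<in>frontier \<Omega>.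
         DN_map \<Omega> k f1 (\<lambda>y. t * phi E y) x = DN_map \<Omega> k f2 (\<lambda>y. t * phi E y) x"
      using DN E(1) by blast
    have "continuous_on (closure \<Omega>) (\<lambda>x. exp ((a *\<^sub>R v) \<bullet> x))" by (intro continuous_intros)
    from bdd[OF this] obtain H where H: "H \<ge> 0" "\<forall>x\<in>closure \<Omega>. \<bar>exp ((a *\<^sub>R v) \<bullet> x)\<bar> \<le> H" by blast
    have H': "exp ((a *\<^sub>R v) \<bullet> x) \<le> H" if "x \<in> \<Omega>" for x
    proof -
      have "x \<in> closure \<Omega>" using that closure_subset by blast
      then have "\<bar>exp ((a *\<^sub>R v) \<bullet> x)\<bar> \<le> H" using H(2) by blast
      then show ?thesis by simp
    qed
    define I where "I = (LINT x:\<Omega>|lborel. (f1 x - f2 x) * exp ((a *\<^sub>R v) \<bullet> x))"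
    define c where "c = a\<^sup>2 * H * real k * ((B + 1) * R\<^sup>2 / 2) * ((LINT x:\<Omega>|lborel. f1 x) + (LINT x:\<Omega>|lborel. f2 x))"
    have le: "\<bar>I\<bar> \<le> c / t" if t: "t \<ge> tE" for t
    proof -
      have t0: "0 < t" using t tE(1) by simp
      let ?g = "\<lambda>x. t * phi E x"
      \<comment> \<open>\<open>DN_map\<close> refers to solutions picked by \<open>SOME\<close>. The
        given \<open>u1\<close> and \<open>u2\<close> witness that such solutions exist, and the
        estimate is applied to the picked ones.\<close>
      let ?v1 = "SOME u. smooth_admissible_solution \<Omega> k f1 ?g u"
      let ?v2 = "SOME u. smooth_admissible_solution \<Omega> k f2 ?g u"
      have sol: "smooth_admissible_solution \<Omega> k f1 ?g ?v1" "smooth_admissible_solution \<Omega> k f2 ?g ?v2"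
        using someI[of "smooth_admissible_solution \<Omega> k f1 ?g", OF u1[rule_format, OF E(1) t0]]
          someI[of "smooth_admissible_solution \<Omega> k f2 ?g", OF u2[rule_format, OF E(1) t0]] .
      have "normal_deriv \<Omega> ?v1 x = normal_deriv \<Omega> ?v2 x" if "x \<in> frontier \<Omega>" for x
        using tE(2)[rule_format, OF t that] unfolding DN_map_def .
      from moment_bound[OF Om k E v t0 sol this B B0 R H' H(1)]
      show ?thesis unfolding I_def c_def diffI .
    qed
    have "\<bar>I\<bar> \<le> 0 + e" if e: "e > 0" for e
    proof -
      \<comment> \<open>Beyond tE the boundary data agree, and beyond |c| / e the bound c / t is at
        most e.\<close>
      define t where "t = max tE (\<bar>c\<bar> / e)"
      have t: "t \<ge> tE" "t > 0" "\<bar>c\<bar> / e \<le> t" using tE(1) by (auto simp: t_def)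
      have "\<bar>c\<bar> \<le> t * e" using t(3) e by (simp add: pos_divide_le_eq)
      then have "c / t \<le> e" using t(2) by (simp add: pos_divide_le_eq mult.commute)
      then show ?thesis using le[OF t(1)] by simp
    qed
    then have "\<bar>I\<bar> \<le> 0" by (rule field_le_epsilon)
    then show ?thesis by (simp add: I_def)
  qed
  have mom: "(LINT x:\<Omega>|lborel. (f1 x - f2 x) * exp (\<xi> \<bullet> x)) = 0" for \<xi>
  proof (cases "\<xi> = 0")
    case True
    \<comment> \<open>The zero frequency is the multiple 0 of an arbitrary unit vector.\<close>
    then show ?thesis using moment[of "axis undefined 1" 0] by (simp add: norm_axis_1)
  next
    case False
    then have "norm (sgn \<xi>) = 1" "\<xi> = norm \<xi> *\<^sub>R sgn \<xi>" by (simp_all add: norm_sgn sgn_div_norm)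
    then show ?thesis using moment[of "sgn \<xi>" "norm \<xi>"] by simp
  qed
  have "continuous_on (closure \<Omega>) (\<lambda>x. f1 x - f2 x)" by (intro continuous_intros cont f_smooth)
  from zero_if_exponential_moments_zero[OF Om(1,3) this mom] show ?thesis by simp
qed

end
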